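(* Every finite simple ISK4-free graph of girth at least $5$ contains a vertex of degree at most $2$ and is $3$-colorable.
   Context: A subdivision of a graph is obtained by repeatedly replacing an edge $vw$ by a path $vuw$ through a new vertex $u$ (a graph is a subdivision of itself). An ISK4 of $G$ is an induced subgraph of $G$ that is a subdivision of $K_4$; $G$ is ISK4-free if it has none. The girth is the length of a shortest cycle (infinite if there is none). *)

theory Defs
  imports "Graph_Theory.Kuratowski" "HOL-Library.Extended_Nat"
begin

text \<open>
  A finite simple graph is a \<open>pair_graph\<close>: every edge is represented by its two orientations,
  and arcs are pairs of vertices. Pair graphs are used rather than \<open>graph\<close> because the library's
  subdivision relation keeps the arc type and its incidence maps fixed, so over an arbitrary arc
  type the graph being subdivided need not be representable.
\<close>

definition ISK4_of :: "'a pair_pre_digraph \<Rightarrow> 'a pair_pre_digraph \<Rightarrow> bool" where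
  "ISK4_of H G \<longleftrightarrow> induced_subgraph (with_proj H) (with_proj G)
     \<and> (\<exists>K. complete_digraph 4 (with_proj K) \<and> subdivision_pair K H)"

definition ISK4_free :: "'a pair_pre_digraph \<Rightarrow> bool" where
  "ISK4_free G \<longleftrightarrow> \<not> (\<exists>H. ISK4_of H G)"

text \<open>
  In a symmetric digraph, traversing an edge back and forth is a \<open>cycle\<close> of length 2; the
  cycles of the underlying undirected simple graph are exactly those of length at least 3.
  The infimum of the empty set in \<^typ>\<open>enat\<close> is infinity.
\<close>

definition girth :: "'a pair_pre_digraph \<Rightarrow> enat" where
  "girth G = (INF p \<in> {p. pre_digraph.cycle (with_proj G) p \<and> 3 \<le> length p}. enat (length p))"

definition colorable :: "nat \<Rightarrow> 'a pair_pre_digraph \<Rightarrow> bool" where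
  "colorable k G \<longleftrightarrow> (\<exists>c :: 'a \<Rightarrow> nat. (\<forall>v \<in> pverts G. c v < k) \<and> (\<forall>(u, v) \<in> parcs G. c u \<noteq> c v))"

end

theory Submission
  imports Defs
begin

text \<open>
  Suppose every vertex has degree at least 3. Among all edges \<open>xb\<close> and all nonempty vertex sets \<open>C\<close>
  that are cut off from the rest of the graph by the double star \<open>N[x] \<union> N[b]\<close>, take \<open>C\<close> minimal, and
  let \<open>U\<close> consist of \<open>C\<close>, its neighbours, \<open>x\<close> and \<open>b\<close>. By minimality and girth 5, no closed
  neighbourhood \<open>N[y]\<close> with \<open>y \<in> U\<close> disconnects \<open>U\<close>.

  This excludes wheels (a hole plus a hub with at least three neighbours on it) in \<open>U\<close>. In a shortest
  wheel, no vertex nonadjacent to the hub has more than one neighbour on the rim. Among the wheels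
  with that hub for which this number is always at most 2, minimise first the number of spokes and then
  the length of a path that avoids the closed neighbourhood of the hub and joins the interiors of two
  different sectors. Rerouting the rim along a piece of the path contradicts minimality or
  produces a hole with a connected set that has exactly three feet on it, hence an ISK4.

  In a graph without wheels, no connected set disjoint from a hole attaches to three of its vertices.
  If \<open>C\<close> has two vertices with at most one neighbour in \<open>C\<close>, this fails for a 5-cycle through \<open>x\<close> and
  \<open>b\<close>. Otherwise \<open>C\<close> contains a hole; taking one for which the component of \<open>x\<close> in its complement is
  largest, any other component contains a hole again, which contradicts the choice.
  The 3-colouring follows because all induced subgraphs have a vertex of degree at most 2.
\<close>

section \<open>Recognising subdivisions of \<open>K\<^sub>4\<close>\<close>

text \<open>Minimality of \<open>C\<close> ranges over the double stars of all edges. If the closed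
  neighbourhood of a neighbour n of x cuts a piece off U, then that piece without its neighbours of
  x is cut off in the whole graph by the double star of the edge xn. If the vertex y removed lies in
  \<open>C\<close>, any edge yz serves: by girth 5 two vertices share at most one neighbour, so the
  neighbours of z cannot exhaust the piece. Either way a set smaller than \<open>C\<close> results.
  The obstacle for wheels is that rerouting may lengthen the rim, so being shortest is lost at once.
  What survives is the bound 2 on the rim neighbours of vertices not adjacent to the hub: a
  rerouting adds at most one neighbour, and exactly three neighbours on a hole already give an ISK4.
  The same exclusion of 3 forces at least 4 spokes, so that a rerouting which drops a single spoke
  still leaves a wheel, with fewer spokes.\<close>

fun plinks :: "'a list \<Rightarrow> ('a \<times> 'a) set" where
  "plinks (x # y # zs) = insert (x, y) (insert (y, x) (plinks (y # zs)))"
| "plinks _ = {}"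

lemma plinks_subset: "plinks xs \<subseteq> set xs \<times> set xs"
  by (induction xs rule: plinks.induct) auto

lemma plinks_inner:
  "(p, q) \<in> plinks (a # xs @ [b]) \<Longrightarrow> p \<in> set xs \<or> q \<in> set xs \<or> (p, q) = (a, b) \<or> (p, q) = (b, a)"
proof (induction xs arbitrary: a)
  case (Cons x xs)
  then show ?case by (cases xs) auto
qed auto

text \<open>Induction on \<open>ws\<close>: dividing the edge from \<open>u\<close> to
  \<open>v\<close> at the first new vertex \<open>w\<close> leaves the edge from \<open>w\<close> to
  \<open>v\<close> to be replaced by the rest of the path.\<close>

lemma subdivision_pair_path:
  assumes "subdivision_pair K \<lparr>pverts = V, parcs = R \<union> {(u, v), (v, u)}\<rparr>"
    and "R \<subseteq> V \<times> V" "u \<in> V" "v \<in> V" "u \<noteq> v" "(u, v) \<notin> R" "(v, u) \<notin> R"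
    and "distinct ws" "set ws \<inter> V = {}"
  shows "subdivision_pair K \<lparr>pverts = V \<union> set ws, parcs = R \<union> plinks (u # ws @ [v])\<rparr>"
  using assms
proof (induction ws arbitrary: u V R)
  case Nil
  then show ?case by (simp add: insert_commute)
next
  case (Cons w ws)
  let ?H = "\<lparr>pverts = V, parcs = R \<union> {(u, v), (v, u)}\<rparr>"
  have w: "w \<notin> V" "w \<noteq> u" "w \<noteq> v"
    using Cons.prems by auto
  have "subdivision_pair K (subdivide ?H (u, v) w)"
    by (rule subdivision_pair_divide) (use Cons.prems w in auto)
  also have "subdivide ?H (u, v) w =
      \<lparr>pverts = V \<union> {w}, parcs = (R \<union> {(u, w), (w, u)}) \<union> {(w, v), (v, w)}\<rparr>"
    using Cons.prems w by (auto simp: subdivide.simps)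
  finally have "subdivision_pair K \<lparr>pverts = V \<union> {w} \<union> set ws,
      parcs = (R \<union> {(u, w), (w, u)}) \<union> plinks (w # ws @ [v])\<rparr>"
    by (rule Cons.IH) (use Cons.prems w in auto)
  moreover have "V \<union> {w} \<union> set ws = V \<union> set (w # ws)" by auto
  moreover have "R \<union> {(u, w), (w, u)} \<union> plinks (w # ws @ [v]) = R \<union> plinks (u # (w # ws) @ [v])"
    by auto
  ultimately show ?case by simp
qed

text \<open>
  The branch vertices are \<open>a\<close>, \<open>b\<close>, \<open>c\<close>, \<open>z\<close>; the lists are the inner vertices of the six paths.
\<close>

definition K4_links :: "'a \<Rightarrow> 'a \<Rightarrow> 'a \<Rightarrow> 'a \<Rightarrow> 'a list \<Rightarrow> 'a list \<Rightarrow> 'a list \<Rightarrow> 'a list \<Rightarrow> 'a list \<Rightarrow> 'a list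
    \<Rightarrow> ('a \<times> 'a) set" where
  "K4_links a b c z X Y Z P Q R = plinks (a # X @ [b]) \<union> plinks (b # Y @ [c]) \<union> plinks (c # Z @ [a])
     \<union> plinks (z # P @ [a]) \<union> plinks (z # Q @ [b]) \<union> plinks (z # R @ [c])"

definition K4_verts :: "'a \<Rightarrow> 'a \<Rightarrow> 'a \<Rightarrow> 'a \<Rightarrow> 'a list \<Rightarrow> 'a list \<Rightarrow> 'a list \<Rightarrow> 'a list \<Rightarrow> 'a list \<Rightarrow> 'a list
    \<Rightarrow> 'a list" where
  "K4_verts a b c z X Y Z P Q R = a # b # c # z # X @ Y @ Z @ P @ Q @ R"

text \<open>Stated for a bare edge relation, so that the combinatorics below is free of digraphs.
  The equivalence over all listed vertices is what makes the subgraph induced.\<close>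

definition has_ISK4 :: "('a \<Rightarrow> 'a \<Rightarrow> bool) \<Rightarrow> bool" where
  "has_ISK4 E \<longleftrightarrow> (\<exists>a b c z X Y Z P Q R. distinct (K4_verts a b c z X Y Z P Q R) \<and>
     (\<forall>u \<in> set (K4_verts a b c z X Y Z P Q R). \<forall>v \<in> set (K4_verts a b c z X Y Z P Q R).
        E u v \<longleftrightarrow> (u, v) \<in> K4_links a b c z X Y Z P Q R))"

lemma plinks_not_inner:
  "u \<notin> set xs \<Longrightarrow> v \<notin> set xs \<Longrightarrow> (u, v) \<noteq> (a, b) \<Longrightarrow> (u, v) \<noteq> (b, a) \<Longrightarrow>
    (u, v) \<notin> plinks (a # xs @ [b])"
  by (auto dest: plinks_inner)

lemma plinks_subsetI:
  "a \<in> V \<Longrightarrow> b \<in> V \<Longrightarrow> set xs \<subseteq> V \<Longrightarrow> plinks (a # xs @ [b]) \<subseteq> V \<times> V"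
  using plinks_subset[of "a # xs @ [b]"] by auto

text \<open>The separate equation for \<open>S\<close> allows the arc set to be reordered at each
  application, so that the edge subdivided next stands last.\<close>

lemma subdivision_pair_path':
  assumes "subdivision_pair K \<lparr>pverts = V, parcs = S\<rparr>" "S = R \<union> {(u, v), (v, u)}"
    and "R \<subseteq> V \<times> V" "u \<in> V" "v \<in> V" "u \<noteq> v" "(u, v) \<notin> R" "(v, u) \<notin> R"
    and "distinct ws" "set ws \<inter> V = {}"
  shows "subdivision_pair K \<lparr>pverts = V \<union> set ws, parcs = R \<union> plinks (u # ws @ [v])\<rparr>"
  using assms(1) unfolding assms(2) by (rule subdivision_pair_path) (rule assms)+

text \<open>The six edges on \<open>{a, b, c, z}\<close> are replaced by paths one at a time;
  distinctness of the whole list makes the inner vertices of each path new.\<close>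

lemma subdivision_pair_K4:
  assumes "distinct (K4_verts a b c z X Y Z P Q R)"
  shows "\<exists>K. complete_digraph 4 (with_proj K) \<and> subdivision_pair K
    \<lparr>pverts = set (K4_verts a b c z X Y Z P Q R), parcs = K4_links a b c z X Y Z P Q R\<rparr>"
proof -
  note d = assms[unfolded K4_verts_def]
  have ne: "a \<noteq> b" "a \<noteq> c" "a \<noteq> z" "b \<noteq> c" "b \<noteq> z" "c \<noteq> z" "b \<noteq> a" "c \<noteq> a" "z \<noteq> a" "c \<noteq> b" "z \<noteq> b" "z \<noteq> c"
    using d by auto
  have nin: "v \<notin> set X" "v \<notin> set Y" "v \<notin> set Z" "v \<notin> set P" "v \<notin> set Q" "v \<notin> set R"
    if "v \<in> {a, b, c, z}" for v
    using d that by auto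
  have "set X \<inter> set (Y @ Z @ P @ Q @ R) = {}" "set Y \<inter> set (Z @ P @ Q @ R) = {}"
    "set Z \<inter> set (P @ Q @ R) = {}" "set P \<inter> set (Q @ R) = {}" "set Q \<inter> set R = {}"
    using d by simp_all
  then have dj: "set Y \<inter> set X = {}" "set Z \<inter> set X = {}" "set Z \<inter> set Y = {}"
    "set P \<inter> set X = {}" "set P \<inter> set Y = {}" "set P \<inter> set Z = {}"
    "set Q \<inter> set X = {}" "set Q \<inter> set Y = {}" "set Q \<inter> set Z = {}" "set Q \<inter> set P = {}"
    "set R \<inter> set X = {}" "set R \<inter> set Y = {}" "set R \<inter> set Z = {}" "set R \<inter> set P = {}" "set R \<inter> set Q = {}"
    unfolding set_append by blast+
  have ds: "distinct X" "distinct Y" "distinct Z" "distinct P" "distinct Q" "distinct R"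
    using d by simp_all
  let ?e = "\<lambda>u v. {(u, v), (v, u)}"
  let ?B = "{a, b, c, z}"
  let ?ab = "plinks (a # X @ [b])" and ?bc = "plinks (b # Y @ [c])" and ?ca = "plinks (c # Z @ [a])"
  let ?za = "plinks (z # P @ [a])" and ?zb = "plinks (z # Q @ [b])" and ?zc = "plinks (z # R @ [c])"
  define K where "K = \<lparr>pverts = ?B, parcs = ?e a b \<union> ?e b c \<union> ?e c a \<union> ?e z a \<union> ?e z b \<union> ?e z c\<rparr>"
  have K4: "complete_digraph 4 (with_proj K)"
    using d unfolding complete_digraph_pair_def K_def by auto
  then have "pair_graph K" by (rule pair_graphI_complete)
  then interpret K: pair_graph K .
  have "subdivision_pair K K"
    by (rule subdivision_pair_base) unfold_locales
  then have "subdivision_pair K \<lparr>pverts = ?B,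
      parcs = ?e a b \<union> ?e b c \<union> ?e c a \<union> ?e z a \<union> ?e z b \<union> ?e z c\<rparr>"
    by (simp only: K_def)
  then have "subdivision_pair K \<lparr>pverts = ?B \<union> set X,
      parcs = (?e b c \<union> ?e c a \<union> ?e z a \<union> ?e z b \<union> ?e z c) \<union> ?ab\<rparr>"
    by (rule subdivision_pair_path') 
      (simp only: Un_ac, (intro Un_least plinks_subsetI; auto), simp, simp, simp add: ne, simp add: ne nin plinks_not_inner,
       simp add: ne nin plinks_not_inner, simp add: ds, simp add: nin dj Int_Un_distrib)
  then have "subdivision_pair K \<lparr>pverts = ?B \<union> set X \<union> set Y,
      parcs = (?e c a \<union> ?e z a \<union> ?e z b \<union> ?e z c \<union> ?ab) \<union> ?bc\<rparr>"
    by (rule subdivision_pair_path')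
      (simp only: Un_ac, (intro Un_least plinks_subsetI; auto), simp, simp, simp add: ne, simp add: ne nin plinks_not_inner,
       simp add: ne nin plinks_not_inner, simp add: ds, simp add: nin dj Int_Un_distrib)
  then have "subdivision_pair K \<lparr>pverts = ?B \<union> set X \<union> set Y \<union> set Z,
      parcs = (?e z a \<union> ?e z b \<union> ?e z c \<union> ?ab \<union> ?bc) \<union> ?ca\<rparr>"
    by (rule subdivision_pair_path')
      (simp only: Un_ac, (intro Un_least plinks_subsetI; auto), simp, simp, simp add: ne, simp add: ne nin plinks_not_inner,
       simp add: ne nin plinks_not_inner, simp add: ds, simp add: nin dj Int_Un_distrib)
  then have "subdivision_pair K \<lparr>pverts = ?B \<union> set X \<union> set Y \<union> set Z \<union> set P,
      parcs = (?e z b \<union> ?e z c \<union> ?ab \<union> ?bc \<union> ?ca) \<union> ?za\<rparr>"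
    by (rule subdivision_pair_path')
      (simp only: Un_ac, (intro Un_least plinks_subsetI; auto), simp, simp, simp add: ne, simp add: ne nin plinks_not_inner,
       simp add: ne nin plinks_not_inner, simp add: ds, simp add: nin dj Int_Un_distrib)
  then have "subdivision_pair K \<lparr>pverts = ?B \<union> set X \<union> set Y \<union> set Z \<union> set P \<union> set Q,
      parcs = (?e z c \<union> ?ab \<union> ?bc \<union> ?ca \<union> ?za) \<union> ?zb\<rparr>"
    by (rule subdivision_pair_path')
      (simp only: Un_ac, (intro Un_least plinks_subsetI; auto), simp, simp, simp add: ne, simp add: ne nin plinks_not_inner,
       simp add: ne nin plinks_not_inner, simp add: ds, simp add: nin dj Int_Un_distrib)
  then have "subdivision_pair K \<lparr>pverts = ?B \<union> set X \<union> set Y \<union> set Z \<union> set P \<union> set Q \<union> set R,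
      parcs = (?ab \<union> ?bc \<union> ?ca \<union> ?za \<union> ?zb) \<union> ?zc\<rparr>"
    by (rule subdivision_pair_path')
      (simp only: Un_ac, (intro Un_least plinks_subsetI; auto), simp, simp, simp add: ne, simp add: ne nin plinks_not_inner,
       simp add: ne nin plinks_not_inner, simp add: ds, simp add: nin dj Int_Un_distrib)
  moreover have "?B \<union> set X \<union> set Y \<union> set Z \<union> set P \<union> set Q \<union> set R = set (K4_verts a b c z X Y Z P Q R)"
    by (auto simp: K4_verts_def)
  ultimately have "subdivision_pair K
    \<lparr>pverts = set (K4_verts a b c z X Y Z P Q R), parcs = K4_links a b c z X Y Z P Q R\<rparr>"
    unfolding K4_links_def by (simp only:)
  with K4 show ?thesis by blast
qed

lemma ISK4_free_imp_not_has_ISK4: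
  assumes "pair_graph G" "ISK4_free G"
  shows "\<not> has_ISK4 (\<lambda>u v. (u, v) \<in> parcs G)"
proof
  assume "has_ISK4 (\<lambda>u v. (u, v) \<in> parcs G)"
  then obtain a b c z X Y Z P Q R where
    d: "distinct (K4_verts a b c z X Y Z P Q R)" and
    e: "\<And>u v. u \<in> set (K4_verts a b c z X Y Z P Q R) \<Longrightarrow> v \<in> set (K4_verts a b c z X Y Z P Q R)
      \<Longrightarrow> (u, v) \<in> parcs G \<longleftrightarrow> (u, v) \<in> K4_links a b c z X Y Z P Q R"
    unfolding has_ISK4_def by auto
  interpret G: pair_graph G by fact
  let ?V = "set (K4_verts a b c z X Y Z P Q R)" and ?L = "K4_links a b c z X Y Z P Q R"
  let ?H = "\<lparr>pverts = ?V, parcs = ?L\<rparr>"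
  obtain K where K: "complete_digraph 4 (with_proj K)" "subdivision_pair K ?H"
    using subdivision_pair_K4[OF d] by blast
  have L: "?L \<subseteq> ?V \<times> ?V"
    unfolding K4_links_def by (intro Un_least plinks_subsetI) (auto simp: K4_verts_def)
  \<comment> \<open>\<open>has_ISK4\<close> does not mention \<open>pverts G\<close>; a listed
    vertex belongs to it because some link, hence an arc of \<open>G\<close>, leaves that
    vertex.\<close>
  have nb: "\<exists>w. (v, w) \<in> ?L" if "v \<in> ?V" for v
  proof -
    have path: "v \<in> set (x # xs @ [y]) \<Longrightarrow> \<exists>w. (v, w) \<in> plinks (x # xs @ [y])" for x y :: 'a and xs
    proof (induction xs arbitrary: x)
      case (Cons x' xs)
      then show ?case by auto
    qed auto
    have "v \<in> set (a # X @ [b]) \<or> v \<in> set (b # Y @ [c]) \<or> v \<in> set (c # Z @ [a]) \<or>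
        v \<in> set (z # P @ [a]) \<or> v \<in> set (z # Q @ [b]) \<or> v \<in> set (z # R @ [c])"
      using that by (auto simp: K4_verts_def)
    then show ?thesis
      unfolding K4_links_def using path by blast
  qed
  have "?L = {e \<in> parcs G. fst e \<in> ?V \<and> snd e \<in> ?V}"
  proof (intro set_eqI)
    fix p
    show "p \<in> ?L \<longleftrightarrow> p \<in> {e \<in> parcs G. fst e \<in> ?V \<and> snd e \<in> ?V}"
    proof (cases p)
      case (Pair u v)
      then show ?thesis using L e[of u v] by auto
    qed
  qed
  moreover have "?V \<subseteq> pverts G"
  proof
    fix v assume v: "v \<in> ?V"
    then obtain w where w: "(v, w) \<in> ?L" using nb by blast
    then have "(v, w) \<in> parcs G" using e[of v w] v L by blast
    then show "v \<in> pverts G" by (rule G.in_arcsD1)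
  qed
  moreover have "wf_digraph (with_proj ?H)"
    using L by (auto simp: wf_digraph_wp_iff pair_wf_digraph_def)
  moreover have "wf_digraph (with_proj G)" by unfold_locales
  ultimately have "induced_subgraph (with_proj ?H) (with_proj G)"
    by (auto simp: induced_subgraph_def subgraph_def compatible_def)
  then show False
    using assms(2) K unfolding ISK4_free_def ISK4_of_def by blast
qed

text \<open>The only use of the girth: from here on, girth 5 means the absence of triangles and
  4-cycles.\<close>

lemma girth_no_short_cycle:
  assumes "pair_graph G" "girth G \<ge> 5"
  shows "(a, b) \<in> parcs G \<Longrightarrow> (b, c) \<in> parcs G \<Longrightarrow> (c, a) \<in> parcs G \<Longrightarrow> False"
    and "(a, b) \<in> parcs G \<Longrightarrow> (b, c) \<in> parcs G \<Longrightarrow> (c, d) \<in> parcs G \<Longrightarrow> (d, a) \<in> parcs G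
      \<Longrightarrow> a \<noteq> c \<Longrightarrow> b \<noteq> d \<Longrightarrow> False"
proof -
  interpret G: pair_graph G by fact
  have len: "5 \<le> length p" if "G.cycle p" "3 \<le> length p" for p
  proof -
    have "girth G \<le> enat (length p)"
      unfolding girth_def using that by (intro INF_lower) simp
    with assms(2) have "enat 5 \<le> enat (length p)"
      by (metis numeral_eq_enat order_trans)
    then show ?thesis by simp
  qed
  show False if "(a, b) \<in> parcs G" "(b, c) \<in> parcs G" "(c, a) \<in> parcs G"
  proof -
    have "G.cycle [(a, b), (b, c), (c, a)]"
      unfolding G.cycle_def using that G.no_loops'
      by (intro exI[of _ a]) (auto simp: G.awalk_def dest: G.in_arcsD1 G.in_arcsD2)
    from len[OF this] show False by simp
  qed
  show False if "(a, b) \<in> parcs G" "(b, c) \<in> parcs G" "(c, d) \<in> parcs G" "(d, a) \<in> parcs G" "a \<noteq> c" "b \<noteq> d"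
  proof -
    have "G.cycle [(a, b), (b, c), (c, d), (d, a)]"
      unfolding G.cycle_def using that G.no_loops'
      by (intro exI[of _ a]) (auto simp: G.awalk_def dest: G.in_arcsD1 G.in_arcsD2)
    from len[OF this] show False by simp
  qed
qed

section \<open>Induced paths, holes and connected sets\<close>

text \<open>Serves to show that two vertices cut a hole into the same two arcs however the hole is
  listed.\<close>

lemma two_partitions:
  assumes "A \<union> B = C \<union> D" "A \<inter> B = {}" "C \<inter> D = {}"
    "A \<subseteq> C \<or> A \<subseteq> D" "B \<subseteq> C \<or> B \<subseteq> D" "C \<subseteq> A \<or> C \<subseteq> B" "D \<subseteq> A \<or> D \<subseteq> B"
  shows "(A = C \<and> B = D) \<or> (A = D \<and> B = C)"
proof -
  have 1: "\<And>x. x \<in> A \<Longrightarrow> x \<in> B \<Longrightarrow> False" "\<And>x. x \<in> C \<Longrightarrow> x \<in> D \<Longrightarrow> False" using assms(2,3) by auto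
  have 2: "\<And>x. x \<in> A \<Longrightarrow> x \<in> C \<or> x \<in> D" "\<And>x. x \<in> B \<Longrightarrow> x \<in> C \<or> x \<in> D" 
     "\<And>x. x \<in> C \<Longrightarrow> x \<in> A \<or> x \<in> B" "\<And>x. x \<in> D \<Longrightarrow> x \<in> A \<or> x \<in> B" using assms(1) by auto
  show ?thesis using assms(4-7) 1 2 by (elim disjE) (metis subset_antisym subsetD subsetI)+
qed

text \<open>\<open>E\<close> lives on the whole type and no vertex set is fixed. Vertex sets enter
  as parameters of the later results, so passing to an induced subgraph needs no new graph.\<close>

locale g5_graph =
  fixes E :: "'a \<Rightarrow> 'a \<Rightarrow> bool"
  assumes sym: "E u v \<Longrightarrow> E v u"
    and irrefl: "\<not> E u u"
    and no_C3: "E a b \<Longrightarrow> E b c \<Longrightarrow> E c a \<Longrightarrow> False"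
    and no_C4: "E a b \<Longrightarrow> E b c \<Longrightarrow> E c d \<Longrightarrow> E d a \<Longrightarrow> a \<noteq> c \<Longrightarrow> b \<noteq> d \<Longrightarrow> False"
    and no_ISK4: "\<not> has_ISK4 E"
begin

lemma E_commute: "E u v \<longleftrightarrow> E v u"
  using sym by blast

section \<open>Induced paths and holes as lists\<close>

fun ipath :: "'a list \<Rightarrow> bool" where
  "ipath [] \<longleftrightarrow> True"
| "ipath [x] \<longleftrightarrow> True"
| "ipath (x # y # zs) \<longleftrightarrow> E x y \<and> x \<notin> set (y # zs) \<and> (\<forall>z \<in> set zs. \<not> E x z) \<and> ipath (y # zs)"

lemma ipath_distinct: "ipath xs \<Longrightarrow> distinct xs"
  by (induction xs rule: ipath.induct) auto

lemma ipath_Cons: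
  "ys \<noteq> [] \<Longrightarrow> ipath (x # ys) \<longleftrightarrow> ipath ys \<and> x \<notin> set ys \<and> (\<forall>y \<in> set ys. E x y \<longleftrightarrow> y = hd ys)"
  by (cases ys) (auto dest: ipath_distinct)

lemma ipath_append:
  assumes "xs \<noteq> []" "ys \<noteq> []"
  shows "ipath (xs @ ys) \<longleftrightarrow> ipath xs \<and> ipath ys \<and> set xs \<inter> set ys = {} \<and>
    (\<forall>x \<in> set xs. \<forall>y \<in> set ys. E x y \<longleftrightarrow> x = last xs \<and> y = hd ys)"
  using assms
proof (induction xs)
  case (Cons x xs)
  show ?case
  proof (cases "xs = []")
    case True
    with Cons.prems show ?thesis by (auto simp: ipath_Cons)
  next
    case False
    have m: "hd xs \<in> set xs" "last xs \<in> set xs" using False by auto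
    have 1: "(\<forall>y \<in> set (xs @ ys). E x y \<longleftrightarrow> y = hd (xs @ ys)) \<longleftrightarrow>
        (\<forall>y \<in> set xs. E x y \<longleftrightarrow> y = hd xs) \<and> (\<forall>y \<in> set ys. \<not> E x y)" if "set xs \<inter> set ys = {}"
    proof -
      have "y \<noteq> hd xs" if "y \<in> set ys" for y
        using that m \<open>set xs \<inter> set ys = {}\<close> by blast
      then show ?thesis using False by (simp add: ball_Un)
    qed
    have 2: "(\<forall>p \<in> set (x # xs). \<forall>y \<in> set ys. E p y \<longleftrightarrow> p = last (x # xs) \<and> y = hd ys) \<longleftrightarrow>
        (\<forall>y \<in> set ys. \<not> E x y) \<and> (\<forall>p \<in> set xs. \<forall>y \<in> set ys. E p y \<longleftrightarrow> p = last xs \<and> y = hd ys)"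
      if "x \<notin> set xs"
    proof -
      have "x \<noteq> last xs" using that m by blast
      then show ?thesis using False by simp
    qed
    have 3: "ipath ((x # xs) @ ys) \<longleftrightarrow> ipath (xs @ ys) \<and> x \<notin> set xs \<and> x \<notin> set ys \<and>
        (\<forall>y \<in> set (xs @ ys). E x y \<longleftrightarrow> y = hd (xs @ ys))"
      using ipath_Cons[of "xs @ ys" x] False by simp
    note IH = Cons.IH[OF False Cons.prems(2)]
    show ?thesis
    proof (cases "set xs \<inter> set ys = {} \<and> x \<notin> set xs")
      case True
      have "set (x # xs) \<inter> set ys = {} \<longleftrightarrow> x \<notin> set ys" using True by simp
      then show ?thesis
        unfolding 3 using 1 2 True IH ipath_Cons[OF False, of x] by argo
    next
      case False
      then show ?thesis
        unfolding 3 using IH ipath_distinct[of "x # xs"] by auto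
    qed
  qed
qed simp

lemma ipath_appendD:
  assumes "ipath (xs @ ys)"
  shows "ipath xs" "ipath ys"
  using assms by (cases "xs = []"; cases "ys = []"; simp add: ipath_append)+

lemma ipath_rev: "ipath xs \<Longrightarrow> ipath (rev xs)"
proof (induction xs)
  case (Cons x xs)
  show ?case
  proof (cases "xs = []")
    case False
    with Cons show ?thesis
      by (auto simp: ipath_append ipath_Cons last_rev E_commute[of _ x])
  qed simp
qed simp

lemma plinks_append:
  assumes "xs \<noteq> []" "ys \<noteq> []"
  shows "plinks (xs @ ys) = plinks xs \<union> plinks ys \<union> {(last xs, hd ys), (hd ys, last xs)}"
  using assms
proof (induction xs rule: plinks.induct)
  case ("2_2" v)
  then show ?case by (cases ys) auto
qed auto

lemma ipath_links:
  assumes "ipath xs" "u \<in> set xs" "v \<in> set xs"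
  shows "E u v \<longleftrightarrow> (u, v) \<in> plinks xs"
  using assms
proof (induction xs arbitrary: u v rule: ipath.induct)
  case (2 x)
  then show ?case by (simp add: irrefl)
next
  case (3 x y zs)
  have "plinks (y # zs) \<subseteq> set (y # zs) \<times> set (y # zs)" by (rule plinks_subset)
  moreover have "y \<notin> set zs" using 3 ipath_distinct by fastforce
  ultimately show ?case
    using 3 by (auto simp: irrefl E_commute[of _ x])
qed simp

text \<open>An induced cycle, listed from an arbitrary vertex. The length bound only rules out
  degenerate lists; by \<open>no_C3\<close> and \<open>no_C4\<close> every hole has length at least
  5.\<close>

definition hole :: "'a list \<Rightarrow> bool" where
  "hole zs \<longleftrightarrow> length zs \<ge> 3 \<and> ipath (tl zs) \<and> hd zs \<notin> set (tl zs) \<and>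
     (\<forall>y \<in> set (tl zs). E (hd zs) y \<longleftrightarrow> y = hd (tl zs) \<or> y = last (tl zs))"

text \<open>Unlike the definition this treats both pieces alike, which makes rotation
  immediate.\<close>

lemma hole_append:
  assumes "xs \<noteq> []" "ys \<noteq> []"
  shows "hole (xs @ ys) \<longleftrightarrow> length xs + length ys \<ge> 3 \<and> ipath xs \<and> ipath ys \<and> set xs \<inter> set ys = {} \<and>
    (\<forall>x \<in> set xs. \<forall>y \<in> set ys. E x y \<longleftrightarrow> (x = last xs \<and> y = hd ys) \<or> (x = hd xs \<and> y = last ys))"
proof -
  obtain x xs' where xs: "xs = x # xs'" using assms(1) by (cases xs) auto
  show ?thesis
  proof (cases "xs' = []")
    case True
    then show ?thesis using assms xs by (auto simp: hole_def)
  next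
    case False
    have m: "hd xs' \<in> set xs'" "last xs' \<in> set xs'" "hd ys \<in> set ys" "last ys \<in> set ys"
      using False assms by auto
    have 1: "(\<forall>y \<in> set (xs' @ ys). E x y \<longleftrightarrow> y = hd (xs' @ ys) \<or> y = last (xs' @ ys)) \<longleftrightarrow>
        (\<forall>y \<in> set xs'. E x y \<longleftrightarrow> y = hd xs') \<and> (\<forall>y \<in> set ys. E x y \<longleftrightarrow> y = last ys)"
      if "set xs' \<inter> set ys = {}"
    proof -
      have "y \<noteq> last ys" if "y \<in> set xs'" for y
        using that m \<open>set xs' \<inter> set ys = {}\<close> by blast
      moreover have "y \<noteq> hd xs'" if "y \<in> set ys" for y
        using that m \<open>set xs' \<inter> set ys = {}\<close> by blast
      ultimately show ?thesis using False assms(2) by (simp add: ball_Un)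
    qed
    have 2: "(\<forall>p \<in> set xs. \<forall>y \<in> set ys. E p y \<longleftrightarrow> (p = last xs \<and> y = hd ys) \<or> (p = hd xs \<and> y = last ys)) \<longleftrightarrow>
        (\<forall>y \<in> set ys. E x y \<longleftrightarrow> y = last ys) \<and> (\<forall>p \<in> set xs'. \<forall>y \<in> set ys. E p y \<longleftrightarrow> p = last xs' \<and> y = hd ys)"
      if "x \<notin> set xs'"
    proof -
      have "x \<noteq> last xs'" using that m by blast
      moreover have "p \<noteq> x" if "p \<in> set xs'" for p
        using that \<open>x \<notin> set xs'\<close> by blast
      ultimately show ?thesis using False xs by simp
    qed
    have 3: "hole (xs @ ys) \<longleftrightarrow> length xs + length ys \<ge> 3 \<and> ipath (xs' @ ys) \<and> x \<notin> set xs' \<and> x \<notin> set ys \<and>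
        (\<forall>y \<in> set (xs' @ ys). E x y \<longleftrightarrow> y = hd (xs' @ ys) \<or> y = last (xs' @ ys))"
      unfolding hole_def using xs by simp
    show ?thesis
    proof (cases "set xs' \<inter> set ys = {} \<and> x \<notin> set xs'")
      case True
      have "ipath xs \<longleftrightarrow> ipath xs' \<and> (\<forall>y \<in> set xs'. E x y \<longleftrightarrow> y = hd xs')"
        using xs ipath_Cons[OF False, of x] True by simp
      moreover have "set xs \<inter> set ys = {} \<longleftrightarrow> x \<notin> set ys" using xs True by simp
      ultimately show ?thesis
        unfolding 3 using 1 2 True ipath_append[OF False assms(2)] by argo
    next
      case False
      then show ?thesis
        unfolding 3 using ipath_append[OF \<open>xs' \<noteq> []\<close> assms(2)] ipath_distinct[of xs] xs by auto
    qed
  qed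
qed

lemma hole_appendD:
  assumes "hole (xs @ ys)" "xs \<noteq> []" "ys \<noteq> []"
  shows "ipath xs" "ipath ys" "set xs \<inter> set ys = {}"
    "x \<in> set xs \<Longrightarrow> y \<in> set ys \<Longrightarrow> E x y \<longleftrightarrow> (x = last xs \<and> y = hd ys) \<or> (x = hd xs \<and> y = last ys)"
  using assms(1) unfolding hole_append[OF assms(2,3)] by blast+

lemma hole_rotate: "hole (xs @ ys) \<Longrightarrow> hole (ys @ xs)"
proof (cases "xs = [] \<or> ys = []")
  case False
  assume "hole (xs @ ys)"
  with False have h: "length xs + length ys \<ge> 3" "ipath xs" "ipath ys" "set xs \<inter> set ys = {}"
    "\<And>x y. x \<in> set xs \<Longrightarrow> y \<in> set ys \<Longrightarrow> E x y \<longleftrightarrow> (x = last xs \<and> y = hd ys) \<or> (x = hd xs \<and> y = last ys)"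
    by (simp_all add: hole_append)
  have "E y x \<longleftrightarrow> (y = last ys \<and> x = hd xs) \<or> (y = hd ys \<and> x = last xs)" if "x \<in> set xs" "y \<in> set ys" for x y
    using h(5)[OF that] E_commute[of x y] by argo
  then show ?thesis
    using h False by (simp add: hole_append Int_commute add.commute)
qed auto

lemma hole_rev:
  assumes "hole zs"
  shows "hole (rev zs)"
proof (cases zs)
  case (Cons x ys)
  have "ys \<noteq> []" using assms Cons by (auto simp: hole_def)
  then have "hole (x # rev ys)"
    using assms Cons by (auto simp: hole_def ipath_rev hd_rev last_rev)
  then have "hole ([x] @ rev ys)" by simp
  then have "hole (rev ys @ [x])" by (rule hole_rotate)
  with Cons show ?thesis by simp
qed (use assms in auto)

lemma hole_distinct: "hole zs \<Longrightarrow> distinct zs"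
  by (cases zs) (auto simp: hole_def dest: ipath_distinct)

lemma hole_start:
  assumes "hole zs" "u \<in> set zs"
  obtains B where "hole (u # B)" "set (u # B) = set zs" "length (u # B) = length zs"
proof -
  obtain xs ys where zs: "zs = xs @ u # ys" using assms(2) by (metis split_list)
  have "hole ((u # ys) @ xs)" using assms(1) zs hole_rotate by blast
  then show thesis using that[of "ys @ xs"] zs by auto
qed

lemma hole_two:
  assumes "hole zs" "u \<in> set zs" "w \<in> set zs" "u \<noteq> w"
  obtains A B where "hole (u # A @ w # B)" "set (u # A @ w # B) = set zs"
    "length (u # A @ w # B) = length zs"
proof -
  obtain C where C: "hole (u # C)" "set (u # C) = set zs" "length (u # C) = length zs"
    by (rule hole_start[OF assms(1,2)])
  then have "w \<in> set C" using assms by auto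
  then obtain A B where "C = A @ w # B" by (metis split_list)
  with C show thesis using that by blast
qed

lemma hole_mirror: "hole (u # A @ w # B) \<Longrightarrow> hole (u # rev B @ w # rev A)"
  using hole_rotate[of "rev B @ w # rev A" "[u]"] hole_rev[of "u # A @ w # B"] by simp

lemma hole_swap: "hole (u # A @ w # B) \<Longrightarrow> hole (w # B @ u # A)"
  using hole_rotate[of "u # A" "w # B"] by simp

lemma hole_three:
  assumes "hole zs" "a \<in> set zs" "b \<in> set zs" "c \<in> set zs" "a \<noteq> b" "b \<noteq> c" "a \<noteq> c"
  obtains X Y Z where "hole (a # X @ b # Y @ c # Z)" "set (a # X @ b # Y @ c # Z) = set zs"
proof -
  obtain A B where h: "hole (a # A @ b # B)" "set (a # A @ b # B) = set zs"
    by (rule hole_two[OF assms(1,2,3,5)])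
  show thesis
  proof (cases "c \<in> set B")
    case True
    then obtain Y Z where "B = Y @ c # Z" by (metis split_list)
    with h show thesis using that by blast
  next
    case False
    then have "c \<in> set A" using h(2) assms by auto
    then obtain Y Z where A: "rev A = Y @ c # Z" by (metis split_list set_rev)
    have "hole (a # rev B @ b # rev A)" using h(1) by (rule hole_mirror)
    moreover have "set (a # rev B @ b # rev A) = set zs" using h(2) by auto
    ultimately show thesis using that A by metis
  qed
qed

text \<open>Consecutive vertices are adjacent, so a path meeting both sets would use an edge between
  them.\<close>

lemma ipath_separated:
  assumes "ipath xs" "set xs \<subseteq> X \<union> Y" "\<And>x y. x \<in> X \<Longrightarrow> y \<in> Y \<Longrightarrow> \<not> E x y"
    "set xs \<inter> X \<noteq> {}"
  shows "set xs \<subseteq> X"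
  using assms(1,2,4)
proof (induction xs rule: ipath.induct)
  case (3 x y zs)
  have sub: "x \<in> X \<union> Y" "y \<in> X \<union> Y" "set (y # zs) \<subseteq> X \<union> Y" and p: "ipath (y # zs)"
    using "3.prems"(1,2) by simp_all
  have xy: "E x y" "E y x" using "3.prems"(1) sym by simp_all
  show ?case
  proof (cases "x \<in> X")
    case True
    then have "y \<in> X" using sub xy assms(3) by blast
    then have "set (y # zs) \<subseteq> X" using "3.IH"[OF p sub(3)] by simp
    then show ?thesis using True by simp
  next
    case False
    then have "set (y # zs) \<inter> X \<noteq> {}" using "3.prems"(3) by simp
    then have "y \<in> X" using "3.IH"[OF p sub(3)] by simp
    then show ?thesis using False sub xy assms(3) by blast
  qed
qed auto

lemma hole_arcs_apart:
  assumes "hole (u # A @ w # B)" "a \<in> set A" "b \<in> set B"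
  shows "\<not> E a b" "\<not> E b a" "a \<noteq> b"
proof -
  have "hole ((u # A) @ (w # B))" using assms(1) by simp
  from hole_appendD(4)[OF this, of a b] assms(2,3) hole_distinct[OF assms(1)]
  show "\<not> E a b" "a \<noteq> b" by auto
  then show "\<not> E b a" using sym by blast
qed

lemma hole_ipath_arc:
  assumes "hole (u # A @ w # B)"
  shows "ipath A" "ipath B" "B \<noteq> [] \<Longrightarrow> ipath (u # A @ [w])"
proof -
  have 1: "ipath B" if "hole (u # A @ w # B)" for u A w B
  proof -
    have "hole ((u # A) @ (w # B))" using that by simp
    then have "ipath ([w] @ B)" using hole_appendD(2) by fastforce
    then show ?thesis by (rule ipath_appendD)
  qed
  then show "ipath B" using assms by blast
  show "ipath A" using hole_swap[OF assms] by (rule 1)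
  show "ipath (u # A @ [w])" if "B \<noteq> []"
  proof -
    have "hole ((u # A @ [w]) @ B)" using assms by simp
    then show ?thesis using hole_appendD(1) that by blast
  qed
qed

text \<open>Each open arc is a path, and the two open arcs of a listing have no edge between them,
  so no arc of one listing is split by the other listing.\<close>

lemma hole_arcs_unique:
  assumes "hole (u # A @ w # B)" "hole (u # A' @ w # B')" "set (u # A @ w # B) = set (u # A' @ w # B')"
  shows "(set A = set A' \<and> set B = set B') \<or> (set A = set B' \<and> set B = set A')"
proof -
  have d: "distinct (u # A @ w # B)" "distinct (u # A' @ w # B')"
    using assms(1,2) hole_distinct by blast+
  have un: "set A \<union> set B = set A' \<union> set B'"
  proof -
    have "set A \<union> set B = set (u # A @ w # B) - {u, w}" using d(1) by auto
    also have "\<dots> = set A' \<union> set B'" unfolding assms(3) using d(2) by auto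
    finally show ?thesis .
  qed
  have dj: "set A \<inter> set B = {}" "set A' \<inter> set B' = {}" using d by auto
  have sub: "set X \<subseteq> set Y \<or> set X \<subseteq> set Z"
    if "ipath X" "set X \<subseteq> set Y \<union> set Z" "\<And>y z. y \<in> set Y \<Longrightarrow> z \<in> set Z \<Longrightarrow> \<not> E y z" for X Y Z
    using ipath_separated[OF that] that(2) by blast
  have apart: "\<And>y z. y \<in> set A \<Longrightarrow> z \<in> set B \<Longrightarrow> \<not> E y z" "\<And>y z. y \<in> set A' \<Longrightarrow> z \<in> set B' \<Longrightarrow> \<not> E y z"
    by (rule hole_arcs_apart(1)[OF assms(1)], assumption+) (rule hole_arcs_apart(1)[OF assms(2)], assumption+)
  show ?thesis
  proof (rule two_partitions[OF un dj])
    show "set A \<subseteq> set A' \<or> set A \<subseteq> set B'"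
      by (rule sub[OF hole_ipath_arc(1)[OF assms(1)] _ apart(2)]) (use un in auto)
    show "set B \<subseteq> set A' \<or> set B \<subseteq> set B'"
      by (rule sub[OF hole_ipath_arc(2)[OF assms(1)] _ apart(2)]) (use un in auto)
    show "set A' \<subseteq> set A \<or> set A' \<subseteq> set B"
      by (rule sub[OF hole_ipath_arc(1)[OF assms(2)] _ apart(1)]) (use un in auto)
    show "set B' \<subseteq> set A \<or> set B' \<subseteq> set B"
      by (rule sub[OF hole_ipath_arc(2)[OF assms(2)] _ apart(1)]) (use un in auto)
  qed
qed

section \<open>Connected sets and the induced paths inside them\<close>

definition conn :: "'a set \<Rightarrow> bool" where
  "conn S \<longleftrightarrow> (\<forall>u \<in> S. \<forall>v \<in> S. (\<lambda>a b. E a b \<and> b \<in> S)\<^sup>*\<^sup>* u v)"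

text \<open>The step relation tests only its target, so \<open>x\<close> belongs to
  \<open>comp_of S x\<close> even when it is not in \<open>S\<close>.\<close>

definition comp_of :: "'a set \<Rightarrow> 'a \<Rightarrow> 'a set" where
  "comp_of S x = {v. (\<lambda>a b. E a b \<and> b \<in> S)\<^sup>*\<^sup>* x v}"

lemma comp_of_self: "x \<in> comp_of S x"
  by (simp add: comp_of_def)

lemma comp_of_subset: "x \<in> S \<Longrightarrow> comp_of S x \<subseteq> S"
proof
  fix v assume "x \<in> S" "v \<in> comp_of S x"
  from this(2)[unfolded comp_of_def, simplified] this(1) show "v \<in> S"
    by (induction rule: rtranclp_induct) auto
qed

lemma comp_of_closed: "u \<in> comp_of S x \<Longrightarrow> E u v \<Longrightarrow> v \<in> S \<Longrightarrow> v \<in> comp_of S x"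
  unfolding comp_of_def by (auto intro: rtranclp.rtrancl_into_rtrancl)

lemma conn_from:
  assumes "x \<in> S" "\<And>v. v \<in> S \<Longrightarrow> v \<in> comp_of S x"
  shows "conn S"
proof -
  let ?r = "\<lambda>a b. E a b \<and> b \<in> S"
  have bwd: "rtranclp ?r v x" if "rtranclp ?r x v" for v
    using that
  proof (induction rule: rtranclp_induct)
    case (step y z)
    have "y \<in> S" using comp_of_subset[OF assms(1)] step(1) by (auto simp: comp_of_def)
    then have "?r z y" using step(2) sym by blast
    with step(3) show ?case by (rule converse_rtranclp_into_rtranclp[rotated])
  qed simp
  show ?thesis unfolding conn_def
  proof (intro ballI)
    fix u v assume "u \<in> S" "v \<in> S"
    then have "rtranclp ?r x u" "rtranclp ?r x v" using assms(2) by (auto simp: comp_of_def)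
    then show "rtranclp ?r u v" using bwd by (meson rtranclp_trans)
  qed
qed

lemma comp_of_mono: "S \<subseteq> T \<Longrightarrow> comp_of S x \<subseteq> comp_of T x"
  unfolding comp_of_def by (auto elim!: rtranclp_mono[THEN predicate2D, rotated])

lemma conn_comp_of:
  assumes "conn S" "u \<in> S"
  shows "S \<subseteq> comp_of S u"
  using assms by (auto simp: conn_def comp_of_def)

lemma comp_of_conn:
  assumes "x \<in> S"
  shows "conn (comp_of S x)"
proof (rule conn_from[OF comp_of_self])
  fix v assume "v \<in> comp_of S x"
  then have "(\<lambda>a b. E a b \<and> b \<in> S)\<^sup>*\<^sup>* x v" by (simp add: comp_of_def)
  then show "v \<in> comp_of (comp_of S x) x"
  proof (induction rule: rtranclp_induct)
    case base
    show ?case by (rule comp_of_self)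
  next
    case (step y z)
    have "z \<in> comp_of S x"
      using step(1,2) by (auto simp: comp_of_def intro: rtranclp.rtrancl_into_rtrancl)
    then show ?case using comp_of_closed[OF step(3)] step(2) by blast
  qed
qed

lemma conn_Un:
  assumes "conn A" "conn B" "a \<in> A" "b \<in> B" "E a b"
  shows "conn (A \<union> B)"
proof (rule conn_from)
  show "a \<in> A \<union> B" using assms by blast
  fix v assume "v \<in> A \<union> B"
  then consider "v \<in> A" | "v \<in> B" by blast
  then show "v \<in> comp_of (A \<union> B) a"
  proof cases
    case 1
    then show ?thesis
      using conn_comp_of[OF assms(1,3)] comp_of_mono[of A "A \<union> B"] by blast
  next
    case 2
    have "b \<in> comp_of (A \<union> B) a"
      by (rule comp_of_closed[OF comp_of_self assms(5)]) (use assms in blast)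
    moreover have "v \<in> comp_of (A \<union> B) b"
      using 2 conn_comp_of[OF assms(2,4)] comp_of_mono[of B "A \<union> B"] by blast
    ultimately show ?thesis by (auto simp: comp_of_def)
  qed
qed

lemma conn_singleton: "conn {x}"
  by (rule conn_from[of x]) (auto intro: comp_of_self)

lemma conn_insert: "conn A \<Longrightarrow> a \<in> A \<Longrightarrow> E x a \<Longrightarrow> conn (insert x A)"
  using conn_Un[of "{x}" A x a] conn_singleton by simp

lemma conn_ipath: "ipath xs \<Longrightarrow> conn (set xs)"
proof (induction xs rule: ipath.induct)
  case (3 x y zs)
  then show ?case using conn_insert[of "set (y # zs)" y x] by simp
qed (auto simp: conn_def)

text \<open>A walk is followed step by step. When it reaches a new vertex \<open>z\<close>, the path
  built so far is cut at the earliest neighbour of \<open>z\<close>, which keeps it induced; when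
  \<open>z\<close> is already on the path, it is cut there.\<close>

lemma comp_of_ipath:
  assumes "v \<in> comp_of S u" "u \<in> S"
  shows "\<exists>xs. ipath xs \<and> xs \<noteq> [] \<and> hd xs = u \<and> last xs = v \<and> set xs \<subseteq> S"
  using assms(1)[unfolded comp_of_def, simplified]
proof (induction rule: rtranclp_induct)
  case base
  show ?case by (rule exI[of _ "[u]"]) (use assms in auto)
next
  case (step y z)
  then obtain xs where xs: "ipath xs" "xs \<noteq> []" "hd xs = u" "last xs = y" "set xs \<subseteq> S" by blast
  show ?case
  proof (cases "z \<in> set xs")
    case True
    then obtain ys zs where e: "xs = ys @ z # zs" by (metis split_list)
    then have "ipath (ys @ [z])" using xs(1) ipath_appendD(1)[of "ys @ [z]" zs] by simp
    moreover have "hd (ys @ [z]) = u" using xs e by (cases ys) auto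
    ultimately show ?thesis using xs e by (intro exI[of _ "ys @ [z]"]) auto
  next
    case False
    have "\<exists>w \<in> set xs. E w z" using step(2) xs(2,4) last_in_set[of xs] by blast
    from split_list_first_prop[OF this] obtain ys w zs
      where e: "xs = ys @ w # zs" "E w z" "\<forall>y \<in> set ys. \<not> E y z" by blast
    have "ipath (ys @ [w])" using xs(1) e ipath_appendD(1)[of "ys @ [w]" zs] by simp
    moreover have "E x z \<longleftrightarrow> x = w" if "x \<in> set (ys @ [w])" for x
      using e(2,3) that by auto
    moreover have "z \<notin> set (ys @ [w])" using False e(1) by simp
    ultimately have "ipath ((ys @ [w]) @ [z])"
      using ipath_append[of "ys @ [w]" "[z]"] by simp
    moreover have "hd ((ys @ [w]) @ [z]) = u" using xs e by (cases ys) auto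
    moreover have "last ((ys @ [w]) @ [z]) = z" by simp
    moreover have "set ((ys @ [w]) @ [z]) \<subseteq> S" using xs(5) e(1) step(2) by simp
    ultimately show ?thesis by (intro exI[of _ "(ys @ [w]) @ [z]"]) simp
  qed
qed

lemma conn_path:
  assumes "conn S" "u \<in> S" "v \<in> S"
  obtains xs where "ipath xs" "xs \<noteq> []" "hd xs = u" "last xs = v" "set xs \<subseteq> S"
  using comp_of_ipath[of v S u] conn_comp_of[OF assms(1,2)] assms by blast

text \<open>A shortest induced path from \<open>X\<close> to \<open>Y\<close> does it: meeting
  \<open>X\<close> again, or \<open>Y\<close> too early, would allow a cut.\<close>

lemma conn_path_between:
  assumes "conn S" "u \<in> S" "u \<in> X" "v \<in> S" "v \<in> Y"
  obtains xs where "ipath xs" "xs \<noteq> []" "set xs \<subseteq> S" "hd xs \<in> X" "last xs \<in> Y"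
    "set (tl xs) \<inter> X = {}" "set (butlast xs) \<inter> Y = {}"
proof -
  let ?P = "\<lambda>xs. ipath xs \<and> xs \<noteq> [] \<and> set xs \<subseteq> S \<and> hd xs \<in> X \<and> last xs \<in> Y"
  obtain ps where "ipath ps" "ps \<noteq> []" "hd ps = u" "last ps = v" "set ps \<subseteq> S"
    by (rule conn_path[OF assms(1,2,4)])
  then have "?P ps" using assms by simp
  from ex_has_least_nat[of ?P, OF this, of length]
  obtain xs where xs: "?P xs" and min: "\<And>ys. ?P ys \<Longrightarrow> length xs \<le> length ys" by blast
  have "x \<notin> X" if "x \<in> set (tl xs)" for x
  proof
    assume "x \<in> X"
    obtain as bs where "tl xs = as @ x # bs" using \<open>x \<in> set (tl xs)\<close> by (metis split_list)
    then have e: "xs = (hd xs # as) @ (x # bs)" using xs by (cases xs) auto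
    have "ipath (x # bs)" using xs e ipath_appendD(2)[of "hd xs # as" "x # bs"] by simp
    moreover have "last (x # bs) = last xs" using arg_cong[OF e, of last] by simp
    moreover have "set (x # bs) \<subseteq> set xs" using arg_cong[OF e, of set] by auto
    ultimately have "?P (x # bs)" using xs \<open>x \<in> X\<close> by auto
    from min[OF this] show False using arg_cong[OF e, of length] by simp
  qed
  moreover have "x \<notin> Y" if "x \<in> set (butlast xs)" for x
  proof
    assume "x \<in> Y"
    obtain as bs where "butlast xs = as @ x # bs" using \<open>x \<in> set (butlast xs)\<close> by (metis split_list)
    then have e: "xs = (as @ [x]) @ (bs @ [last xs])" using xs
      by (metis append.assoc append_Cons append_Nil append_butlast_last_id)
    then have "ipath (as @ [x])" using xs ipath_appendD(1)[of "as @ [x]" "bs @ [last xs]"] by simp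
    moreover have "hd (as @ [x]) = hd xs" using arg_cong[OF e, of hd] by (cases as) simp_all
    moreover have "set (as @ [x]) \<subseteq> set xs" using arg_cong[OF e, of set] by auto
    ultimately have "?P (as @ [x])" using xs \<open>x \<in> Y\<close> by auto
    from min[OF this] show False using arg_cong[OF e, of length] by simp
  qed
  ultimately show thesis using that xs by blast
qed

section \<open>A hole with three feet\<close>

text \<open>The start is repeated at the end of the list so that the closing edge becomes a link as
  well.\<close>

lemma hole_links:
  assumes "hole (x # ys)" "u \<in> set (x # ys)" "v \<in> set (x # ys)"
  shows "E u v \<longleftrightarrow> (u, v) \<in> plinks (x # ys @ [x])"
proof -
  have ys: "ys \<noteq> []" "ipath ys" "x \<notin> set ys" "\<And>y. y \<in> set ys \<Longrightarrow> E x y \<longleftrightarrow> y = hd ys \<or> y = last ys"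
    using assms(1) by (auto simp: hole_def)
  have l: "plinks (x # ys @ [x]) = plinks ys \<union> {(x, hd ys), (hd ys, x), (last ys, x), (x, last ys)}"
    using plinks_append[of "[x]" "ys @ [x]"] plinks_append[of ys "[x]"] ys(1) by auto
  have s: "(p, q) \<in> plinks ys \<Longrightarrow> p \<in> set ys \<and> q \<in> set ys" for p q
    using plinks_subset[of ys] by auto
  have m: "hd ys \<in> set ys" "last ys \<in> set ys" using ys(1) by auto
  then have ne: "hd ys \<noteq> x" "last ys \<noteq> x" using ys(3) by blast+
  consider "u = x" "v = x" | "u = x" "v \<in> set ys" | "u \<in> set ys" "v = x" | "u \<in> set ys" "v \<in> set ys"
    using assms(2,3) by auto
  then show ?thesis
  proof cases
    case 1
    then show ?thesis using irrefl s[of x x] ys(3) ne unfolding l by auto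
  next
    case 2
    then show ?thesis using ys(4)[of v] s[of x v] ys(3) ne unfolding l by auto
  next
    case 3
    then show ?thesis using ys(4)[of u] E_commute[of u x] s[of u x] ys(3) ne unfolding l by auto
  next
    case 4
    then have "u \<noteq> x" "v \<noteq> x" using ys(3) by blast+
    then show ?thesis using ipath_links[OF ys(2) 4] unfolding l by auto
  qed
qed

text \<open>The branch vertices are \<open>a\<close>, \<open>b\<close>, \<open>c\<close> and the
  claw centre \<open>z\<close>; the three arcs of the hole and the three legs, each prolonged to the
  hole, are the six paths. With an empty leg, \<open>z\<close> itself is adjacent to the
  hole.\<close>

lemma claw_on_hole:
  assumes h: "hole (a # X @ b # Y @ c # Z)"
    and p: "ipath (z # P)" "ipath (z # Q)" "ipath (z # R)"
    and dj: "set P \<inter> set Q = {}" "set P \<inter> set R = {}" "set Q \<inter> set R = {}"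
    and apart: "\<And>x y. x \<in> set P \<Longrightarrow> y \<in> set Q \<Longrightarrow> \<not> E x y" "\<And>x y. x \<in> set P \<Longrightarrow> y \<in> set R \<Longrightarrow> \<not> E x y"
      "\<And>x y. x \<in> set Q \<Longrightarrow> y \<in> set R \<Longrightarrow> \<not> E x y"
    and off: "set (z # P @ Q @ R) \<inter> set (a # X @ b # Y @ c # Z) = {}"
    and feet: "\<And>v h. v \<in> set (z # P @ Q @ R) \<Longrightarrow> h \<in> set (a # X @ b # Y @ c # Z) \<Longrightarrow>
      E h v \<longleftrightarrow> (h = a \<and> v = last (z # P)) \<or> (h = b \<and> v = last (z # Q)) \<or> (h = c \<and> v = last (z # R))"
  shows False
proof -
  let ?H = "set (a # X @ b # Y @ c # Z)" and ?T = "set (z # P @ Q @ R)"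
  have dH: "distinct (a # X @ b # Y @ c # Z)" using h by (rule hole_distinct)
  have dT: "distinct (z # P)" "distinct (z # Q)" "distinct (z # R)" using p ipath_distinct by blast+
  have d: "distinct (K4_verts a b c z X Y Z P Q R)"
  \<comment> \<open>\<open>K4_verts\<close> lists the vertices in another order than the hole
    followed by the claw, so distinctness is transferred by comparing set and length.\<close>
  proof (rule card_distinct)
    have "distinct (z # P @ Q @ R)" using dT dj by (simp add: Int_Un_distrib)
    then have D: "distinct ((z # P @ Q @ R) @ (a # X @ b # Y @ c # Z))"
      using dH off unfolding distinct_append by blast
    have "set (K4_verts a b c z X Y Z P Q R) = set ((z # P @ Q @ R) @ (a # X @ b # Y @ c # Z))"
      by (auto simp: K4_verts_def)
    moreover have "length (K4_verts a b c z X Y Z P Q R) = length ((z # P @ Q @ R) @ (a # X @ b # Y @ c # Z))"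
      by (simp add: K4_verts_def)
    ultimately show "card (set (K4_verts a b c z X Y Z P Q R)) = length (K4_verts a b c z X Y Z P Q R)"
      using distinct_card[OF D] by metis
  qed
  have V: "set (K4_verts a b c z X Y Z P Q R) = ?H \<union> ?T" by (auto simp: K4_verts_def)
  let ?HL = "plinks (a # X @ [b]) \<union> plinks (b # Y @ [c]) \<union> plinks (c # Z @ [a])"
  let ?TL = "plinks (z # P) \<union> plinks (z # Q) \<union> plinks (z # R)"
  let ?F = "{(a, last (z # P)), (b, last (z # Q)), (c, last (z # R))}"
  let ?F' = "{(last (z # P), a), (last (z # Q), b), (last (z # R), c)}"
  have L: "K4_links a b c z X Y Z P Q R = ?HL \<union> ?TL \<union> (?F \<union> ?F')"
    unfolding K4_links_def using plinks_append[of "z # P" "[a]"] plinks_append[of "z # Q" "[b]"]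
      plinks_append[of "z # R" "[c]"] by auto
  have HLs: "?HL \<subseteq> ?H \<times> ?H"
    by (intro Un_least plinks_subsetI) auto
  have TLs: "?TL \<subseteq> ?T \<times> ?T"
    using plinks_subset[of "z # P"] plinks_subset[of "z # Q"] plinks_subset[of "z # R"] by auto
  have lT: "last (z # P) \<in> ?T" "last (z # Q) \<in> ?T" "last (z # R) \<in> ?T" by auto
  have HL: "E u v \<longleftrightarrow> (u, v) \<in> ?HL" if "u \<in> ?H" "v \<in> ?H" for u v
  proof -
    have "plinks (a # (X @ b # Y @ c # Z) @ [a]) = ?HL"
      using plinks_append[of "a # X" "b # Y @ c # Z @ [a]"] plinks_append[of "a # X" "[b]"]
        plinks_append[of "b # Y" "c # Z @ [a]"] plinks_append[of "b # Y" "[c]"] by auto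
    then show ?thesis using hole_links[OF h, of u v] that by simp
  qed
  have TL: "E u v \<longleftrightarrow> (u, v) \<in> ?TL" if "u \<in> ?T" "v \<in> ?T" for u v
  proof -
    have inP: "E u v \<longleftrightarrow> (u, v) \<in> ?TL" if S: "u \<in> set (z # S)" "v \<in> set (z # S)" and "S = P \<or> S = Q \<or> S = R" for S
    proof -
      have z: "(u, v) \<in> plinks (z # W) \<Longrightarrow> u \<in> set W \<or> v \<in> set W" for W
        using plinks_subset[of W] by (cases W) auto
      have zW: "z \<notin> set W \<and> ipath (z # W)" if "W \<in> {P, Q, R}" for W using that dT p by auto
      have dW: "set W \<inter> set W' = {}" if "W \<in> {P, Q, R}" "W' \<in> {P, Q, R}" "W \<noteq> W'" for W W'
        using that dj by auto
      have S': "S \<in> {P, Q, R}" using that(3) by blast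
      have "(u, v) \<in> plinks (z # S)" if W: "W \<in> {P, Q, R}" and l: "(u, v) \<in> plinks (z # W)" for W
      proof (cases "W = S")
        case False
        then have "set W \<inter> set S = {}" using dW[OF W S'] by blast
        moreover have "u \<in> set W \<or> v \<in> set W" using z[OF l] .
        ultimately have "u \<in> set W \<and> u = z \<or> v \<in> set W \<and> v = z" using S by auto
        then show ?thesis using zW[OF W] by blast
      qed (use l in simp)
      then have "(u, v) \<in> ?TL \<longleftrightarrow> (u, v) \<in> plinks (z # S)" using S' by blast
      then show ?thesis using ipath_links[OF _ S] zW[OF S'] by blast
    qed
    show ?thesis
    proof (cases "\<exists>S \<in> {P, Q, R}. u \<in> set (z # S) \<and> v \<in> set (z # S)")
      case True
      then show ?thesis using inP by blast
    next
      case False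
      then have "\<not> E u v"
        using that apart(1)[of u v] apart(1)[of v u] apart(2)[of u v] apart(2)[of v u]
          apart(3)[of u v] apart(3)[of v u] E_commute[of u v] by auto
      moreover have "(u, v) \<notin> ?TL"
        using False plinks_subset[of "z # P"] plinks_subset[of "z # Q"] plinks_subset[of "z # R"] by auto
      ultimately show ?thesis by blast
    qed
  qed
  have cr: "E h v \<longleftrightarrow> (h, v) \<in> ?F" "E v h \<longleftrightarrow> (v, h) \<in> ?F'" if "h \<in> ?H" "v \<in> ?T" for h v
    using feet[OF that(2,1)] E_commute[of v h] by auto
  have "E u v \<longleftrightarrow> (u, v) \<in> ?HL \<union> ?TL \<union> (?F \<union> ?F')" if uv: "u \<in> ?H \<union> ?T" "v \<in> ?H \<union> ?T" for u v
  proof -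
    have F: "?F \<subseteq> ?H \<times> ?T" "?F' \<subseteq> ?T \<times> ?H" using lT by auto
    consider "u \<in> ?H" "v \<in> ?H" | "u \<in> ?H" "v \<in> ?T" | "u \<in> ?T" "v \<in> ?H" | "u \<in> ?T" "v \<in> ?T"
      using uv by blast
    then show ?thesis
    proof cases
      case 1
      then show ?thesis using HL[OF 1] TLs F off by blast
    next
      case 2
      then show ?thesis using cr(1)[OF 2] HLs TLs F off by blast
    next
      case 3
      then show ?thesis using cr(2)[OF 3(2,1)] HLs TLs F off by blast
    next
      case 4
      then show ?thesis using TL[OF 4] HLs F off by blast
    qed
  qed
  then have "has_ISK4 E"
    unfolding has_ISK4_def using d V L by metis
  with no_ISK4 show False ..
qed

lemma ipath_cross:
  assumes "ipath (xs @ ys)" "x \<in> set xs" "y \<in> set ys"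
  shows "E x y \<longleftrightarrow> x = last xs \<and> y = hd ys"
proof -
  have "xs \<noteq> []" "ys \<noteq> []" using assms by auto
  from ipath_append[OF this] show ?thesis using assms by blast
qed

lemma ipath_split:
  assumes "ipath (xs @ z # ys)"
  shows "ipath (z # rev xs)" "ipath (z # ys)" "set xs \<inter> set ys = {}"
    "\<And>x y. x \<in> set xs \<Longrightarrow> y \<in> set ys \<Longrightarrow> \<not> E x y"
proof -
  have "ipath ((xs @ [z]) @ ys)" using assms by simp
  then have "ipath (xs @ [z])" by (rule ipath_appendD)
  then show "ipath (z # rev xs)" using ipath_rev by fastforce
  show 2: "ipath (z # ys)" using assms by (rule ipath_appendD)
  have d: "distinct (xs @ z # ys)" using assms by (rule ipath_distinct)
  then show "set xs \<inter> set ys = {}" by auto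
  fix x y assume xy: "x \<in> set xs" "y \<in> set ys"
  then have "E x y \<longleftrightarrow> x = last xs \<and> y = z"
    using ipath_cross[OF assms, of x y] by simp
  then show "\<not> E x y" using d xy by auto
qed

text \<open>A subdivided claw inside \<open>A\<close> with ends \<open>a'\<close>,
  \<open>b'\<close>, \<open>c'\<close> (not necessarily different) suffices. To find it, join
  \<open>a'\<close> to \<open>b'\<close> by an induced path \<open>P\<close> and run from
  \<open>c'\<close> to the closed neighbourhood of \<open>P\<close>.\<close>

lemma three_feet:
  assumes h: "hole zs" and A: "conn A" "A \<inter> set zs = {}"
    and abc: "a \<in> set zs" "b \<in> set zs" "c \<in> set zs" "a \<noteq> b" "b \<noteq> c" "a \<noteq> c"
    and abc': "a' \<in> A" "b' \<in> A" "c' \<in> A"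
    and feet: "\<And>h v. h \<in> set zs \<Longrightarrow> v \<in> A \<Longrightarrow>
      E h v \<longleftrightarrow> (h = a \<and> v = a') \<or> (h = b \<and> v = b') \<or> (h = c \<and> v = c')"
  shows False
proof -
  obtain X Y Z where H: "hole (a # X @ b # Y @ c # Z)" "set (a # X @ b # Y @ c # Z) = set zs"
    by (rule hole_three[OF h abc])
  have claw: False
    if "ipath (z # P)" "ipath (z # Q)" "ipath (z # R)"
      "set P \<inter> set Q = {}" "set P \<inter> set R = {}" "set Q \<inter> set R = {}"
      "\<And>x y. x \<in> set P \<Longrightarrow> y \<in> set Q \<Longrightarrow> \<not> E x y" "\<And>x y. x \<in> set P \<Longrightarrow> y \<in> set R \<Longrightarrow> \<not> E x y"
      "\<And>x y. x \<in> set Q \<Longrightarrow> y \<in> set R \<Longrightarrow> \<not> E x y"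
      "set (z # P @ Q @ R) \<subseteq> A" "last (z # P) = a'" "last (z # Q) = b'" "last (z # R) = c'"
    for z P Q R
  proof (rule claw_on_hole[OF H(1) that(1-9)])
    show "set (z # P @ Q @ R) \<inter> set (a # X @ b # Y @ c # Z) = {}" using that(10) A(2) H(2) by blast
    fix v h assume "v \<in> set (z # P @ Q @ R)" "h \<in> set (a # X @ b # Y @ c # Z)"
    then have "v \<in> A" "h \<in> set zs" using that(10) H(2) by blast+
    then show "E h v \<longleftrightarrow> (h = a \<and> v = last (z # P)) \<or> (h = b \<and> v = last (z # Q)) \<or> (h = c \<and> v = last (z # R))"
      unfolding that(11-13) using feet by blast
  qed
  obtain P where P: "ipath P" "P \<noteq> []" "hd P = a'" "last P = b'" "set P \<subseteq> A"
    by (rule conn_path[OF A(1) abc'(1,2)])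
  show False
  proof (cases "c' \<in> set P")
    case True
    then obtain P1 P2 where e: "P = P1 @ c' # P2" by (metis split_list)
    have "last (c' # rev P1) = a'" using P(3) e by (cases P1) auto
    moreover have "last (c' # P2) = b'" using P(4) e by simp
    ultimately show False
      using ipath_split[of P1 c' P2] P(1,5) e by (intro claw[of c' "rev P1" P2 "[]"]) auto
  next
    case False
    let ?Y = "{v. v \<in> set P \<or> (\<exists>p \<in> set P. E v p)}"
    have "a' \<in> ?Y" using P by auto
    obtain R where R: "ipath R" "R \<noteq> []" "set R \<subseteq> A" "hd R \<in> {c'}" "last R \<in> ?Y" "set (butlast R) \<inter> ?Y = {}"
      by (rule conn_path_between[OF A(1) abc'(3) singletonI abc'(1) \<open>a' \<in> ?Y\<close>]) blast
    define R0 r where "R0 = butlast R" and "r = last R"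
    have R': "R = R0 @ [r]" unfolding R0_def r_def using R(2) by simp
    have R0: "\<And>v p. v \<in> set R0 \<Longrightarrow> p \<in> set P \<Longrightarrow> v \<noteq> p \<and> \<not> E v p \<and> \<not> E p v"
      using R(6) sym unfolding R0_def by blast
    have rP: "r \<notin> set P"
    proof
      assume r: "r \<in> set P"
      show False
      proof (cases "R0 = []")
        case True
        then show False using R(4) R' False r by simp
      next
        case False
        then have "E (last R0) r" using R(1) R' ipath_append[of R0 "[r]"] by simp
        then show False using R0[of "last R0" r] r False by simp
      qed
    qed
    then have "\<exists>p \<in> set P. E r p" using R(5) unfolding r_def by blast
    from split_list_first_prop[OF this] obtain P1 p P2'
      where e: "P = P1 @ p # P2'" "E r p" "\<forall>y \<in> set P1. \<not> E r y" by blast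
    have ends: "hd (P1 @ [p]) = a'" "last (p # P2') = b'" using P e by (cases P1; simp)+
    have Rc: "last (r # rev R0) = c'" using R(4) R' by (cases R0) auto
    have revR: "ipath (r # rev R0)" using ipath_rev[OF R(1)] R' by simp
    show False
    \<comment> \<open>If \<open>r\<close> has the single neighbour \<open>p\<close> on
      \<open>P\<close>, then \<open>p\<close> is the centre. Otherwise \<open>r\<close> is the
      centre, and the part of \<open>P\<close> between its extreme neighbours \<open>p\<close> and
      \<open>q\<close> is dropped.\<close>
    proof (cases "\<exists>q \<in> set P2'. E r q")
      case False
      note sp = ipath_split[of P1 p P2'] P(1) e(1)
      have "ipath (p # r # rev R0)"
        using revR e(1,2) R0[of _ p] rP sym[OF e(2)] by (auto simp: ipath_Cons)
      moreover have "last (p # rev P1) = a'" using ends by (cases P1) auto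
      moreover have "set (rev P1) \<inter> set (r # rev R0) = {}" "set P2' \<inter> set (r # rev R0) = {}"
        using R0 rP e(1) by auto
      moreover have "\<not> E x y" if "x \<in> set (rev P1)" "y \<in> set (r # rev R0)" for x y
        using that R0[of y x] e(1,3) E_commute[of x y] by auto
      moreover have "\<not> E x y" if "x \<in> set P2'" "y \<in> set (r # rev R0)" for x y
        using that R0[of y x] e(1) False E_commute[of x y] by auto
      moreover have "set (p # rev P1 @ P2' @ r # rev R0) \<subseteq> A" using P(5) R(3) e(1) R' by auto
      ultimately show False
        using sp ends Rc by (intro claw[of p "rev P1" P2' "r # rev R0"]) auto
    next
      case True
      from split_list_last_prop[OF this] obtain M q P2
        where e2: "P2' = M @ q # P2" "E r q" "\<forall>y \<in> set P2. \<not> E r y" by blast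
      have e3: "P = (P1 @ [p]) @ M @ q # P2" using e(1) e2(1) by simp
      have ip: "ipath (P1 @ [p])" "ipath (M @ q # P2)"
        using P(1) unfolding e3 by (rule ipath_appendD)+
      have cr: "E x y \<longleftrightarrow> x = p \<and> y = hd (M @ q # P2)" if "x \<in> set (P1 @ [p])" "y \<in> set (M @ q # P2)" for x y
        using ipath_cross[OF P(1)[unfolded e3] that] by simp
      have dP: "distinct P" using P(1) by (rule ipath_distinct)
      \<comment> \<open>As there are no triangles, \<open>p\<close> and \<open>q\<close> are not
        consecutive on \<open>P\<close>; hence no edge joins the two legs that remain of
        \<open>P\<close>.\<close>
      have "M \<noteq> []"
      proof
        assume "M = []"
        then have "E p q" using cr[of p q] by simp
        then show False using no_C3[of r p q] e(2) e2(2) sym by blast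
      qed
      then have apart: "\<not> E x y" if "x \<in> set (p # rev P1)" "y \<in> set (q # P2)" for x y
      proof -
        have "hd (M @ q # P2) \<in> set M" using \<open>M \<noteq> []\<close> by simp
        then have "y \<noteq> hd (M @ q # P2)" using dP that(2) unfolding e3 by auto
        then show ?thesis using cr[of x y] that by auto
      qed
      have "ipath (p # rev P1)" using ipath_rev[OF ip(1)] by simp
      then have 1: "ipath (r # p # rev P1)"
        using e rP by (auto simp: ipath_Cons)
      have "ipath (q # P2)" using ip(2) by (rule ipath_appendD)
      then have 2: "ipath (r # q # P2)"
        using e e2 rP by (auto simp: ipath_Cons)
      show False
      proof (rule claw[OF 1 2 revR])
        show "set (p # rev P1) \<inter> set (q # P2) = {}" using dP unfolding e3 by auto
        show "set (p # rev P1) \<inter> set (rev R0) = {}" "set (q # P2) \<inter> set (rev R0) = {}"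
          using R0 unfolding e3 by auto
        show "last (r # p # rev P1) = a'" using ends by (cases P1) auto
        show "last (r # q # P2) = b'" using ends e2(1) by simp
        show "set (r # (p # rev P1) @ (q # P2) @ rev R0) \<subseteq> A" using P(5) R(3) R' unfolding e3 by auto
        show "\<not> E x y" if "x \<in> set (p # rev P1)" "y \<in> set (rev R0)" for x y
          using R0[of y x] that unfolding e3 by auto
        show "\<not> E x y" if "x \<in> set (q # P2)" "y \<in> set (rev R0)" for x y
          using R0[of y x] that unfolding e3 by auto
      qed (use apart Rc in auto)
    qed
  qed
qed

section \<open>Counting the neighbours of a vertex on a hole\<close>

definition nb :: "'a \<Rightarrow> 'a set \<Rightarrow> 'a set" where
  "nb y S = {v \<in> S. E y v}"

lemma finite_nb [simp]: "finite S \<Longrightarrow> finite (nb y S)"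
  by (simp add: nb_def)

lemma nb_Un: "nb y (S \<union> T) = nb y S \<union> nb y T"
  by (auto simp: nb_def)

text \<open>This is \<open>three_feet\<close> with a single vertex as connected set. It gives every
  wheel at least 4 spokes, and it later improves a bound 3 to 2.\<close>

lemma not_three_nb:
  assumes "hole W" "y \<notin> set W"
  shows "card (nb y (set W)) \<noteq> 3"
proof
  assume "card (nb y (set W)) = 3"
  then obtain a b c where abc: "nb y (set W) = {a, b, c}" "a \<noteq> b" "b \<noteq> c" "a \<noteq> c"
    by (auto simp: card_3_iff)
  then have m: "a \<in> set W" "b \<in> set W" "c \<in> set W" by (auto simp: nb_def)
  have "E h y \<longleftrightarrow> h = a \<or> h = b \<or> h = c" if "h \<in> set W" for h
    using abc(1) that sym[of y h] sym[of h y] by (auto simp: nb_def)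
  then show False
    using three_feet[OF assms(1) conn_singleton[of y] _ m abc(2,3,4), of y y y] assms(2) by auto
qed

text \<open>Two common neighbours would close a 4-cycle.\<close>

lemma common_nb_card:
  assumes "q \<noteq> y"
  shows "card (nb q S \<inter> nb y S) \<le> 1"
proof -
  have "u = v" if "u \<in> nb q S \<inter> nb y S" "v \<in> nb q S \<inter> nb y S" for u v
    using that no_C4[of q u y v] assms sym by (auto simp: nb_def)
  then show ?thesis
    by (metis card_le_Suc0_iff_eq One_nat_def card.infinite le0)
qed

section \<open>Wheels\<close>

lemma hole_arc_cross:
  assumes "hole (t # T @ t' # B)" "h \<in> set (t # T @ [t'])" "v \<in> set B"
  shows "E h v \<longleftrightarrow> (h = t' \<and> v = hd B) \<or> (h = t \<and> v = last B)"
proof -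
  have 1: "hole ((t # T @ [t']) @ B)" using assms(1) by simp
  have 2: "B \<noteq> []" using assms(3) by auto
  show ?thesis using hole_appendD(4)[OF 1 _ 2 assms(2,3)] by simp
qed

text \<open>\<open>Q\<close> runs from \<open>t\<close> to \<open>t'\<close>, whereas the listing of
  the hole returns from \<open>t'\<close> to \<open>t\<close>; hence the reversal.\<close>

lemma hole_reroute:
  assumes h: "hole (t # T @ t' # B)" "B \<noteq> []"
    and Q: "ipath Q" "Q \<noteq> []" "set Q \<inter> set (t # T @ [t']) = {}"
    and cr: "\<And>h p. h \<in> set (t # T @ [t']) \<Longrightarrow> p \<in> set Q \<Longrightarrow> E h p \<longleftrightarrow> (h = t \<and> p = hd Q) \<or> (h = t' \<and> p = last Q)"
  shows "hole (t # T @ t' # rev Q)"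
proof -
  have 1: "hole ((t # T @ [t']) @ B)" using h(1) by simp
  have ip: "ipath (t # T @ [t'])" using hole_appendD(1)[OF 1 _ h(2)] by simp
  have "hole ((t # T @ [t']) @ rev Q)"
  proof (subst hole_append)
    show "t # T @ [t'] \<noteq> []" "rev Q \<noteq> []" using Q(2) by simp_all
    have "length Q \<ge> 1" using Q(2) by (cases Q) auto
    moreover have "E x y \<longleftrightarrow> x = last (t # T @ [t']) \<and> y = hd (rev Q) \<or> x = hd (t # T @ [t']) \<and> y = last (rev Q)"
      if "x \<in> set (t # T @ [t'])" "y \<in> set (rev Q)" for x y
      using cr[of x y] that Q(2) by (auto simp: hd_rev last_rev)
    moreover have "set (t # T @ [t']) \<inter> set (rev Q) = {}" using Q(3) by auto
    ultimately show "3 \<le> length (t # T @ [t']) + length (rev Q) \<and> ipath (t # T @ [t']) \<and> ipath (rev Q) \<and>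
      set (t # T @ [t']) \<inter> set (rev Q) = {} \<and>
      (\<forall>x\<in>set (t # T @ [t']). \<forall>y\<in>set (rev Q). E x y =
         (x = last (t # T @ [t']) \<and> y = hd (rev Q) \<or> x = hd (t # T @ [t']) \<and> y = last (rev Q)))"
      using ip ipath_rev[OF Q(1)] by auto
  qed
  then show ?thesis by simp
qed

text \<open>The bound on \<open>B\<close> says that the new hole is strictly shorter. An empty
  \<open>B\<close> would give a triangle with \<open>q\<close>, a single vertex in \<open>B\<close>
  a 4-cycle through \<open>q\<close>.\<close>

lemma hole_sector:
  assumes h: "hole (t # T @ t' # B)" and q: "q \<notin> set (t # T @ t' # B)" "E q t" "E q t'" "nb q (set T) = {}"
  shows "hole (t # T @ t' # [q])" "length B \<ge> 2"
proof -
  have d: "distinct (t # T @ t' # B)" using h by (rule hole_distinct)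
  have B: "B \<noteq> []"
  proof
    assume "B = []"
    then have "hole ((t # T) @ [t'])" using h by simp
    then have "E t t'" using hole_appendD(4)[of "t # T" "[t']" t t'] by simp
    then show False using no_C3[of q t t'] q sym by blast
  qed
  show "hole (t # T @ t' # [q])"
  proof -
    have "hole (t # T @ t' # rev [q])"
    proof (rule hole_reroute[OF h B])
      fix h p assume *: "h \<in> set (t # T @ [t'])" "p \<in> set [q]"
      have "\<not> E h q" if "h \<in> set T" using q(4) that sym by (auto simp: nb_def)
      then show "E h p \<longleftrightarrow> h = t \<and> p = hd [q] \<or> h = t' \<and> p = last [q]"
        using * d q sym by auto
    qed (use q in auto)
    then show ?thesis by simp
  qed
  show "length B \<ge> 2"
  proof (rule ccontr)
    assume "\<not> ?thesis"
    with B obtain b where b: "B = [b]" by (cases B) (auto simp: Suc_le_eq)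
    have "E t b" "E t' b" using hole_arc_cross[OF h, of t b] hole_arc_cross[OF h, of t' b] b by auto
    then show False using no_C4[of q t b t'] q d b sym by auto
  qed
qed

text \<open>The hole and \<open>Q\<close> form a theta. On the hole made of the arc from
  \<open>t\<close> to \<open>t'\<close> and \<open>Q\<close>, the connected set of \<open>y\<close>
  and \<open>B1 @ [g]\<close> has three feet: \<open>h1\<close> and \<open>h2\<close> because of
  \<open>y\<close>, and \<open>t'\<close> because of the start of \<open>B1 @ [g]\<close>. The
  nonempty \<open>B2\<close> keeps this set away from \<open>t\<close>.\<close>

lemma theta_with_hub:
  assumes h: "hole (t # T @ t' # B1 @ g # B2)" "B2 \<noteq> []"
    and K: "hole (t # T @ t' # rev Q)" "set Q \<inter> set (t # T @ t' # B1 @ g # B2) = {}"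
    and y: "y \<notin> set (t # T @ t' # B1 @ g # B2)" "y \<notin> set Q" "nb y (set Q) = {}"
      "nb y (set (t # T @ [t'])) = {h1, h2}" "h1 \<noteq> h2" "\<not> E y t'" "E y g"
    and apart: "\<And>v p. v \<in> set (B1 @ [g]) \<Longrightarrow> p \<in> set Q \<Longrightarrow> \<not> E p v"
  shows False
proof -
  let ?B = "B1 @ [g]"
  have d: "distinct (t # T @ t' # B1 @ g # B2)" using h(1) by (rule hole_distinct)
  have "hole ((t # T @ [t']) @ (B1 @ [g]) @ B2)" using h(1) by simp
  then have "ipath (?B @ B2)" by (rule hole_appendD) auto
  then have ipB: "ipath ?B" by (rule ipath_appendD)
  have A: "conn (insert y (set ?B))" using conn_insert[OF conn_ipath[OF ipB], of g y] y(7) by simp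
  have hh: "h1 \<in> set (t # T @ [t'])" "h2 \<in> set (t # T @ [t'])" "E y h1" "E y h2"
    using y(4) unfolding nb_def by blast+
  have ty: "E h y \<longleftrightarrow> h = h1 \<or> h = h2" if "h \<in> set (t # T @ [t'])" for h
    using y(4) that E_commute[of h y] unfolding nb_def by blast
  show False
  proof (rule three_feet[OF K(1) A])
    show "insert y (set ?B) \<inter> set (t # T @ t' # rev Q) = {}" using d y K(2) by auto
    show "h1 \<in> set (t # T @ t' # rev Q)" "h2 \<in> set (t # T @ t' # rev Q)" "t' \<in> set (t # T @ t' # rev Q)"
      using hh by auto
    show "h1 \<noteq> h2" "h2 \<noteq> t'" "h1 \<noteq> t'" using y(5,6) hh by auto
    show "y \<in> insert y (set ?B)" "y \<in> insert y (set ?B)" by auto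
    show "hd ?B \<in> insert y (set ?B)" using hd_in_set[of ?B] by blast
    fix h v assume hv: "h \<in> set (t # T @ t' # rev Q)" "v \<in> insert y (set ?B)"
    have hdy: "hd ?B \<noteq> y" using y(1) hd_in_set[of ?B] by auto
    consider "h \<in> set (t # T @ [t'])" "v = y" | "h \<in> set Q" "v = y"
      | "h \<in> set (t # T @ [t'])" "v \<in> set ?B" | "h \<in> set Q" "v \<in> set ?B"
      using hv by auto
    then show "E h v \<longleftrightarrow> (h = h1 \<and> v = y) \<or> (h = h2 \<and> v = y) \<or> (h = t' \<and> v = hd ?B)"
    proof cases
      case 1
      then show ?thesis using ty[of h] hdy by auto
    next
      case 2
      then have "\<not> E h v" using y(3) sym[of h y] by (auto simp: nb_def)
      moreover have "h \<noteq> h1" "h \<noteq> h2" using 2 K(2) hh by auto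
      ultimately show ?thesis using 2 hdy by auto
    next
      case 3
      have "hd (B1 @ g # B2) = hd ?B" by (cases B1) auto
      moreover have "v \<noteq> last (B1 @ g # B2)" using 3 d h(2) last_in_set[of B2] by auto
      moreover have "v \<noteq> y" using 3 y(1) by auto
      ultimately show ?thesis using hole_arc_cross[OF h(1) 3(1), of v] 3 by auto
    next
      case 4
      then have "\<not> E h v" using apart by blast
      moreover have "h \<noteq> t'" "v \<noteq> y" using 4 K(2) y(1) by auto
      ultimately show ?thesis by auto
    qed
  qed
qed

text \<open>\<open>g\<close> is the spoke of \<open>y\<close> on \<open>B\<close> nearest to
  \<open>t'\<close>. If \<open>q\<close> has no neighbour on the way there,
  \<open>theta_with_hub\<close> applies with \<open>Q = [q]\<close>. Otherwise the way is cut at the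
  neighbour \<open>s\<close> of \<open>q\<close> nearest to \<open>g\<close>, and \<open>q\<close>
  takes the place of \<open>t'\<close> as third foot.\<close>

lemma two_hubs_aux:
  assumes h: "hole (t # T @ t' # B)"
    and q: "q \<notin> set (t # T @ t' # B)" "E q t" "E q t'" "nb q (set T) = {}"
    and y: "y \<notin> set (t # T @ t' # B)" "q \<noteq> y" "\<not> E q y" "card (nb y (set (t # T @ [t']))) = 2"
      "card (nb y (set B)) \<ge> 2" "\<not> E y t'"
  shows False
proof -
  obtain h1 h2 where hh: "nb y (set (t # T @ [t'])) = {h1, h2}" "h1 \<noteq> h2"
    using y(4) by (auto simp: card_2_iff)
  have "nb y (set B) \<noteq> {}" using y(5) by auto
  then have "\<exists>g \<in> set B. E y g" by (auto simp: nb_def)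
  from split_list_first_prop[OF this] obtain B1 g B2
    where B: "B = B1 @ g # B2" "E y g" "\<forall>v \<in> set B1. \<not> E y v" by blast
  have "B2 \<noteq> []"
  proof
    assume "B2 = []"
    then have "nb y (set B) \<subseteq> {g}" using B by (auto simp: nb_def)
    then have "card (nb y (set B)) \<le> card {g}" by (intro card_mono) auto
    then show False using y(5) by simp
  qed
  have d: "distinct (t # T @ t' # B)" using h by (rule hole_distinct)
  have K: "hole (t # T @ t' # rev [q])" using hole_sector(1)[OF h q] by simp
  have yq: "\<not> E y q" using y(3) sym by blast
  show False
  proof (cases "\<exists>v \<in> set (B1 @ [g]). E q v")
    case False
    show False
    proof (rule theta_with_hub[OF h[unfolded B(1)] \<open>B2 \<noteq> []\<close> K _ _ _ _ hh y(6) B(2)])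
      show "nb y (set [q]) = {}" using yq by (auto simp: nb_def)
    qed (use q y B(1) False in auto)
  next
    case True
    from split_list_last_prop[OF this] obtain C1 s C2
      where C: "B1 @ [g] = C1 @ s # C2" "E q s" "\<forall>v \<in> set C2. \<not> E q v" by blast
    have BC: "B = C1 @ s # C2 @ B2" using B(1) C(1) by (metis append.assoc append_Cons append_Nil)
    have gC: "g \<in> set (s # C2)"
    proof -
      have "g = last (B1 @ [g])" by simp
      also have "\<dots> = last (s # C2)" unfolding C(1) by simp
      finally show ?thesis using last_in_set[of "s # C2"] by simp
    qed
    \<comment> \<open>Otherwise \<open>s\<close> follows \<open>t'\<close> on the rim and closes a
      triangle with \<open>q\<close>. So the stretch from \<open>s\<close> to \<open>g\<close> does
      not touch \<open>t'\<close>.\<close>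
    have "C1 \<noteq> []"
    proof
      assume "C1 = []"
      then have "E t' s" using hole_arc_cross[OF h, of t' s] BC by simp
      then show False using no_C3[of q t' s] q C(2) sym by blast
    qed
    have "ipath B" using h by (rule hole_ipath_arc)
    then have "ipath (C1 @ (s # C2) @ B2)" using BC by simp
    then have ipC: "ipath (s # C2)" using ipath_appendD by blast
    have A: "conn (insert y (set (s # C2)))"
      by (rule conn_insert[OF conn_ipath[OF ipC] gC B(2)])
    have hm: "h1 \<in> set (t # T @ [t'])" "h2 \<in> set (t # T @ [t'])" "E y h1" "E y h2"
      using hh(1) unfolding nb_def by blast+
    have ty: "E h y \<longleftrightarrow> h = h1 \<or> h = h2" if "h \<in> set (t # T @ [t'])" for h
      using hh(1) that E_commute[of h y] unfolding nb_def by blast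
    show False
    proof (rule three_feet[OF K A])
      show "insert y (set (s # C2)) \<inter> set (t # T @ t' # rev [q]) = {}" using d y q BC by auto
      show "h1 \<in> set (t # T @ t' # rev [q])" "h2 \<in> set (t # T @ t' # rev [q])" "q \<in> set (t # T @ t' # rev [q])"
        using hm by auto
      show "h1 \<noteq> h2" "h2 \<noteq> q" "h1 \<noteq> q" using hh(2) q(1) hm by auto
      show "y \<in> insert y (set (s # C2))" "y \<in> insert y (set (s # C2))" "s \<in> insert y (set (s # C2))" by auto
      fix h v assume hv: "h \<in> set (t # T @ t' # rev [q])" "v \<in> insert y (set (s # C2))"
      have sy: "s \<noteq> y" using y(1) BC by auto
      consider "h \<in> set (t # T @ [t'])" "v = y" | "h = q" "v = y"
        | "h \<in> set (t # T @ [t'])" "v \<in> set (s # C2)" | "h = q" "v \<in> set (s # C2)"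
        using hv by auto
      then show "E h v \<longleftrightarrow> (h = h1 \<and> v = y) \<or> (h = h2 \<and> v = y) \<or> (h = q \<and> v = s)"
      proof cases
        case 1
        then show ?thesis using ty[of h] sy q(1) by auto
      next
        case 2
        then show ?thesis using y(3) sy \<open>h2 \<noteq> q\<close> \<open>h1 \<noteq> q\<close> by auto
      next
        case 3
        have "hd B \<in> set C1" unfolding BC using \<open>C1 \<noteq> []\<close> by simp
        then have "v \<noteq> hd B" using 3 d BC by auto
        moreover have "last B \<in> set B2" unfolding BC using \<open>B2 \<noteq> []\<close> by simp
        then have "v \<noteq> last B" using 3 d BC by auto
        moreover have "v \<noteq> y" "h \<noteq> q" using 3 y(1) q(1) BC by auto
        moreover have "v \<in> set B" using 3 BC by auto
        ultimately show ?thesis using hole_arc_cross[OF h 3(1), of v] by auto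
      next
        case 4
        then have "v \<noteq> y" using y(1) BC by auto
        then show ?thesis using 4 C(2,3) by auto
      qed
    qed
  qed
qed

text \<open>\<open>y\<close> is not adjacent to both \<open>t\<close> and \<open>t'\<close>, since
  \<open>q\<close> would complete a 4-cycle; so \<open>two_hubs_aux\<close> applies to the hole or
  to its mirror image.\<close>

lemma two_hubs:
  assumes h: "hole (t # T @ t' # B)"
    and q: "q \<notin> set (t # T @ t' # B)" "E q t" "E q t'" "nb q (set T) = {}"
    and y: "y \<notin> set (t # T @ t' # B)" "q \<noteq> y" "\<not> E q y" "card (nb y (set (t # T @ [t']))) = 2"
      "card (nb y (set B)) \<ge> 2"
  shows False
proof (cases "E y t'")
  case False
  then show False using two_hubs_aux[OF assms] by blast
next
  case True
  have d: "distinct (t # T @ t' # B)" using h by (rule hole_distinct)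
  have nt: "\<not> E y t" using no_C4[of q t y t'] True q y(2) sym d by auto
  have h': "hole (t' # rev T @ t # rev B)" using hole_swap[OF hole_mirror[OF h]] .
  have "set (t' # rev T @ [t]) = set (t # T @ [t'])" "set (rev B) = set B" "set (rev T) = set T"
    "set (t' # rev T @ t # rev B) = set (t # T @ t' # B)" by auto
  then show False
    using two_hubs_aux[OF h' _ q(3,2) _ _ y(2,3) _ _ nt] q y by simp
qed

text \<open>Closing the sector through \<open>q\<close> gives a shorter hole, on which
  \<open>y\<close> has at most two neighbours by minimality. If it has exactly two, at least two
  more lie on \<open>B\<close>, which \<open>two_hubs\<close> excludes.\<close>

lemma sector_one_spoke:
  assumes min: "\<And>K v. hole K \<Longrightarrow> set K \<subseteq> U \<Longrightarrow> length K < length (t # T @ t' # B) \<Longrightarrow> v \<in> U - set K \<Longrightarrow> card (nb v (set K)) \<le> 2"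
    and h: "hole (t # T @ t' # B)" "set (t # T @ t' # B) \<subseteq> U"
    and q: "q \<in> U" "q \<notin> set (t # T @ t' # B)" "E q t" "E q t'" "nb q (set T) = {}"
    and y: "y \<in> U" "y \<notin> set (t # T @ t' # B)" "q \<noteq> y" "\<not> E q y" "card (nb y (set (t # T @ t' # B))) \<ge> 4"
  shows "card (nb y (set (t # T @ [t']))) \<le> 1"
proof (rule ccontr)
  assume neg: "\<not> ?thesis"
  note K = hole_sector[OF h(1) q(2-5)]
  have "card (nb y (set (t # T @ t' # [q]))) \<le> 2"
    by (rule min[OF K(1)]) (use h(2) q(1,2) y K(2) in auto)
  moreover have "nb y (set (t # T @ t' # [q])) = nb y (set (t # T @ [t']))"
    using y(4) sym by (auto simp: nb_def)
  ultimately have two: "card (nb y (set (t # T @ [t']))) = 2" using neg by simp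
  have "nb y (set (t # T @ t' # B)) = nb y (set (t # T @ [t'])) \<union> nb y (set B)" by (auto simp: nb_def)
  then have "card (nb y (set (t # T @ t' # B))) \<le> 2 + card (nb y (set B))"
    using card_Un_le[of "nb y (set (t # T @ [t']))" "nb y (set B)"] two by simp
  then have "card (nb y (set B)) \<ge> 2" using y(5) by simp
  then show False using two_hubs[OF h(1) q(2-5) y(2-4) two] by blast
qed

text \<open>As 3 is excluded, \<open>q\<close> would have 2 or at least 4 neighbours on
  \<open>W\<close>. With 2, the rim consists of two sectors of \<open>q\<close> with at most one
  spoke of \<open>y\<close> each, which is too few. With 4 or more, both \<open>q\<close> and
  \<open>y\<close> are hubs of \<open>W\<close>, and no sector of one contains two spokes of the
  other.\<close>

lemma shortest_wheel:
  assumes min: "\<And>K v. hole K \<Longrightarrow> set K \<subseteq> U \<Longrightarrow> length K < length W \<Longrightarrow> v \<in> U - set K \<Longrightarrow> card (nb v (set K)) \<le> 2"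
    and h: "hole W" "set W \<subseteq> U"
    and y: "y \<in> U" "y \<notin> set W" "card (nb y (set W)) \<ge> 4"
    and q: "q \<in> U" "q \<notin> set W" "q \<noteq> y" "\<not> E q y"
  shows "card (nb q (set W)) \<le> 1"
proof (rule ccontr)
  assume "\<not> ?thesis"
  then have r: "card (nb q (set W)) \<ge> 2" by simp
  have yq: "\<not> E y q" using q(4) sym by blast
  have sec_q: "card (nb y (set (t # T @ [t']))) \<le> 1"
    if "hole (t # T @ t' # B)" "set (t # T @ t' # B) = set W" "E q t" "E q t'" "nb q (set T) = {}" for t T t' B
  proof -
    have "length (t # T @ t' # B) = length W"
      using distinct_card[OF hole_distinct] that(1,2) h(1) by metis
    then show ?thesis
      by (intro sector_one_spoke[where U = U and q = q and B = B, OF _ that(1)] min)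
        (use that(2-5) h(2) y q in auto)
  qed
  have sec_y: "card (nb q (set (t # T @ [t']))) \<le> 1"
    if "card (nb q (set W)) \<ge> 4" "hole (t # T @ t' # B)" "set (t # T @ t' # B) = set W" "E y t" "E y t'" "nb y (set T) = {}" for t T t' B
  proof -
    have "length (t # T @ t' # B) = length W"
      using distinct_card[OF hole_distinct] that(2,3) h(1) by metis
    then show ?thesis
      by (intro sector_one_spoke[where U = U and q = y and B = B, OF _ that(2)] min)
        (use that(1,3-6) h(2) y q yq in auto)
  qed
  consider "card (nb q (set W)) = 2" | "card (nb q (set W)) \<ge> 4"
    using r not_three_nb[OF h(1) q(2)] by linarith
  then show False
  proof cases
    case 1
    then obtain u w where uw: "nb q (set W) = {u, w}" "u \<noteq> w" by (auto simp: card_2_iff)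
    then have m: "u \<in> set W" "w \<in> set W" "E q u" "E q w" unfolding nb_def by blast+
    obtain A B where AB: "hole (u # A @ w # B)" "set (u # A @ w # B) = set W"
      by (rule hole_two[OF h(1) m(1,2) uw(2)])
    have d: "distinct (u # A @ w # B)" using AB(1) by (rule hole_distinct)
    have "nb q (set A) = {}" "nb q (set B) = {}"
    proof -
      have "nb q (set A) \<subseteq> {u, w}" "nb q (set B) \<subseteq> {u, w}"
        using uw(1) AB(2) unfolding nb_def by auto
      then show "nb q (set A) = {}" "nb q (set B) = {}" using d by (auto simp: nb_def)
    qed
    then have "card (nb y (set (u # A @ [w]))) \<le> 1" "card (nb y (set (w # B @ [u]))) \<le> 1"
      using sec_q[OF AB m(3,4)] sec_q[OF hole_swap[OF AB(1)] _ m(4,3)] AB(2) by auto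
    moreover have "nb y (set W) = nb y (set (u # A @ [w])) \<union> nb y (set (w # B @ [u]))"
      unfolding AB(2)[symmetric] by (auto simp: nb_def)
    ultimately have "card (nb y (set W)) \<le> 2"
      using card_Un_le[of "nb y (set (u # A @ [w]))" "nb y (set (w # B @ [u]))"] by simp
    then show False using y(3) by simp
  next
    case 2
    \<comment> \<open>Provides a spoke \<open>h2\<close> of \<open>y\<close> that is no spoke of
      \<open>q\<close>. Below, \<open>t1\<close> and \<open>t2\<close> are the spokes of
      \<open>q\<close> next to \<open>h2\<close> on either side, and \<open>h1\<close> and
      \<open>h3\<close> the next spokes of \<open>y\<close> beyond them.\<close>
    have "\<not> nb y (set W) \<subseteq> nb q (set W)"
    proof
      assume "nb y (set W) \<subseteq> nb q (set W)"
      then have "nb q (set W) \<inter> nb y (set W) = nb y (set W)" by blast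
      then show False using common_nb_card[OF q(3), of "set W"] y(3) by simp
    qed
    then obtain h2 where h2: "h2 \<in> set W" "E y h2" "\<not> E q h2" unfolding nb_def by blast
    obtain B where B: "hole (h2 # B)" "set (h2 # B) = set W" by (rule hole_start[OF h(1) h2(1)])
    have qW: "nb q (set W) = nb q (set B)" unfolding B(2)[symmetric] using h2(3) by (auto simp: nb_def)
    have "nb q (set B) \<noteq> {}" using 2 qW by auto
    then have "\<exists>t \<in> set B. E q t" by (auto simp: nb_def)
    from split_list_first_prop[OF this] obtain B1 t2 B2
      where t2: "B = B1 @ t2 # B2" "E q t2" "\<forall>v \<in> set B1. \<not> E q v" by blast
    have "nb q (set B2) \<noteq> {}"
    proof
      assume "nb q (set B2) = {}"
      then have "nb q (set B) \<subseteq> {t2}" using t2 by (auto simp: nb_def)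
      then have "card (nb q (set B)) \<le> card {t2}" by (intro card_mono) auto
      then show False using 2 qW by simp
    qed
    then have "\<exists>t \<in> set B2. E q t" by (auto simp: nb_def)
    from split_list_last_prop[OF this] obtain B3 t1 B4
      where t1: "B2 = B3 @ t1 # B4" "E q t1" "\<forall>v \<in> set B4. \<not> E q v" by blast
    let ?L = "t1 # (B4 @ h2 # B1) @ [t2]"
    have W1: "hole (t1 # (B4 @ h2 # B1) @ t2 # B3)"
      using hole_rotate[of "h2 # B1 @ t2 # B3" "t1 # B4"] B(1) t1(1) t2(1) by simp
    have sW1: "set (t1 # (B4 @ h2 # B1) @ t2 # B3) = set W" using B(2) t1(1) t2(1) by auto
    have dW: "distinct (t1 # (B4 @ h2 # B1) @ t2 # B3)" using W1 by (rule hole_distinct)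
    have nqT: "nb q (set (B4 @ h2 # B1)) = {}" using h2(3) t2(3) t1(3) by (auto simp: nb_def)
    have "card (nb y (set ?L)) \<le> 1" by (rule sec_q[OF W1 sW1 t1(2) t2(2) nqT])
    moreover have "h2 \<in> nb y (set ?L)" using h2(2) by (auto simp: nb_def)
    ultimately have nyL: "nb y (set ?L) = {h2}"
      using card_le_Suc0_iff_eq[of "nb y (set ?L)"] by (simp only: finite_nb List.finite_set One_nat_def) blast
    then have ny: "\<And>v. v \<in> set ?L \<Longrightarrow> E y v \<longleftrightarrow> v = h2" unfolding nb_def by blast
    have "nb y (set W) = nb y (set ?L) \<union> nb y (set B3)" unfolding sW1[symmetric] by (auto simp: nb_def)
    then have cB3: "card (nb y (set B3)) \<ge> 3"
      using card_Un_le[of "nb y (set ?L)" "nb y (set B3)"] y(3) unfolding nyL by simp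
    then have "nb y (set B3) \<noteq> {}" by auto
    then have "\<exists>v \<in> set B3. E y v" by (auto simp: nb_def)
    from split_list_first_prop[OF this] obtain C1 h3 C2
      where h3: "B3 = C1 @ h3 # C2" "E y h3" "\<forall>v \<in> set C1. \<not> E y v" by blast
    have "nb y (set C2) \<noteq> {}"
    proof
      assume "nb y (set C2) = {}"
      then have "nb y (set B3) \<subseteq> {h3}" using h3 by (auto simp: nb_def)
      then have "card (nb y (set B3)) \<le> card {h3}" by (intro card_mono) auto
      then show False using cB3 by simp
    qed
    then have "\<exists>v \<in> set C2. E y v" by (auto simp: nb_def)
    from split_list_last_prop[OF this] obtain C3 h1 C4
      where h1: "C2 = C3 @ h1 # C4" "E y h1" "\<forall>v \<in> set C4. \<not> E y v" by blast
    have one: "v \<notin> nb q S" if "card (nb q S) \<le> 1" "t \<in> nb q S" "v \<noteq> t" "finite S" for v t S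
      using that card_le_Suc0_iff_eq[of "nb q S"] by (simp only: finite_nb One_nat_def) blast
    \<comment> \<open>The sector of \<open>y\<close> from \<open>h2\<close> to \<open>h3\<close>
      already contains the spoke \<open>t2\<close> of \<open>q\<close>, so it contains no other
      one.\<close>
    have nq1: "\<not> E q v" if v: "v \<in> set (C1 @ [h3])" for v
    proof -
      have W2: "hole (h2 # (B1 @ t2 # C1) @ h3 # (C2 @ t1 # B4))"
        using B(1) t1(1) t2(1) h3(1) by simp
      have "card (nb q (set (h2 # (B1 @ t2 # C1) @ [h3]))) \<le> 1"
      proof (rule sec_y[OF 2 W2 _ h2(2) h3(2)])
        show "set (h2 # (B1 @ t2 # C1) @ h3 # C2 @ t1 # B4) = set W" using sW1 h3(1) by auto
        show "nb y (set (B1 @ t2 # C1)) = {}" using ny h3(3) dW by (auto simp: nb_def)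
      qed
      then have "v \<notin> nb q (set (h2 # (B1 @ t2 # C1) @ [h3]))"
        by (rule one[of _ t2]) (use t2(2) v dW h3(1) in \<open>auto simp: nb_def\<close>)
      then show ?thesis using v by (auto simp: nb_def)
    qed
    have nq2: "\<not> E q v" if v: "v \<in> set (h1 # C4)" for v
    proof -
      have W2: "hole (h1 # (C4 @ t1 # B4) @ h2 # (B1 @ t2 # C1 @ h3 # C3))"
        using hole_rotate[of "h2 # B1 @ t2 # C1 @ h3 # C3" "h1 # C4 @ t1 # B4"] B(1) t1(1) t2(1) h3(1) h1(1) by simp
      have "card (nb q (set (h1 # (C4 @ t1 # B4) @ [h2]))) \<le> 1"
      proof (rule sec_y[OF 2 W2 _ h1(2) h2(2)])
        show "set (h1 # (C4 @ t1 # B4) @ h2 # B1 @ t2 # C1 @ h3 # C3) = set W" using sW1 h3(1) h1(1) by auto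
        show "nb y (set (C4 @ t1 # B4)) = {}" using ny h1(3) dW by (auto simp: nb_def)
      qed
      then have "v \<notin> nb q (set (h1 # (C4 @ t1 # B4) @ [h2]))"
        by (rule one[of _ t1]) (use t1(2) v dW h3(1) h1(1) in \<open>auto simp: nb_def\<close>)
      then show ?thesis using v by (auto simp: nb_def)
    qed
    have eB3: "B3 = (C1 @ [h3]) @ C3 @ (h1 # C4)" using h3(1) h1(1) by simp
    have K: "hole (t1 # (B4 @ h2 # B1) @ t2 # [q])"
      by (rule hole_sector(1)[OF W1 _ t1(2) t2(2) nqT]) (use q(2) sW1 in blast)
    have "ipath B3" using W1 by (rule hole_ipath_arc)
    then have ip: "ipath (C1 @ [h3])" "ipath (h1 # C4)" unfolding eB3 using ipath_appendD by blast+
    \<comment> \<open>\<open>y\<close> together with the stretches after \<open>t2\<close> up to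
      \<open>h3\<close> and from \<open>h1\<close> up to before \<open>t1\<close> touches the hole
      through \<open>t1\<close>, \<open>h2\<close>, \<open>t2\<close>, \<open>q\<close> exactly at
      \<open>h2\<close>, \<open>t2\<close> and \<open>t1\<close>.\<close>
    let ?A = "insert y (set (C1 @ [h3])) \<union> set (h1 # C4)"
    have A: "conn ?A"
    proof (rule conn_Un[of _ _ y h1])
      show "conn (insert y (set (C1 @ [h3])))"
        by (rule conn_insert[OF conn_ipath[OF ip(1)] _ h3(2)]) simp
      show "conn (set (h1 # C4))" by (rule conn_ipath[OF ip(2)])
    qed (use h1(2) in auto)
    have sub: "set (C1 @ [h3]) \<union> set (h1 # C4) \<subseteq> set B3" unfolding eB3 by auto
    have yW: "y \<notin> set (t1 # (B4 @ h2 # B1) @ t2 # B3)" "q \<notin> set (t1 # (B4 @ h2 # B1) @ t2 # B3)"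
      using y(2) q(2) sW1 by blast+
    have hdl: "hd B3 = hd (C1 @ [h3])" "last B3 = last (h1 # C4)" unfolding eB3 by (cases C1; simp)+
    have mem: "hd B3 \<in> ?A" "last B3 \<in> ?A" using hd_in_set[of "C1 @ [h3]"] last_in_set[of "h1 # C4"] unfolding hdl by blast+
    have memB: "hd B3 \<in> set B3" "last B3 \<in> set B3" using h3(1) hd_in_set[of B3] last_in_set[of B3] by auto
    show False
    proof (rule three_feet[OF K A, of h2 t2 t1 y "hd B3" "last B3"])
      show "?A \<inter> set (t1 # (B4 @ h2 # B1) @ t2 # [q]) = {}"
        using sub yW dW q(3) by auto
      show "h2 \<noteq> t2" "t2 \<noteq> t1" "h2 \<noteq> t1" using dW by auto
      fix h v assume hv: "h \<in> set (t1 # (B4 @ h2 # B1) @ t2 # [q])" "v \<in> ?A"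
      have hb: "hd B3 \<noteq> y" "last B3 \<noteq> y" using memB yW(1) by auto
      consider "h \<in> set ?L" "v = y" | "h = q" "v = y" | "h \<in> set ?L" "v \<in> set B3" | "h = q" "v \<noteq> y"
        using hv sub by auto
      then show "E h v \<longleftrightarrow> (h = h2 \<and> v = y) \<or> (h = t2 \<and> v = hd B3) \<or> (h = t1 \<and> v = last B3)"
      proof cases
        case 1
        then show ?thesis using ny[of h] E_commute[of h y] hb by auto
      next
        case 2
        then show ?thesis using q(4) yW hb by auto
      next
        case 3
        then have "v \<noteq> y" using yW(1) by auto
        then show ?thesis using hole_arc_cross[OF W1 3] by auto
      next
        case 4
        then have "\<not> E h v" using hv(2) nq1 nq2 by auto
        moreover have "q \<noteq> h2" "q \<noteq> t1" "q \<noteq> t2" using yW(2) by auto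
        ultimately show ?thesis using 4 by auto
      qed
    qed (use mem in auto)
  qed
qed

text \<open>The bound is 2, although \<open>shortest_wheel\<close> yields 1, because 2 is what
  \<open>mild_wheel_reroute\<close> preserves.\<close>

definition mild_wheel :: "'a set \<Rightarrow> 'a \<Rightarrow> 'a list \<Rightarrow> bool" where
  "mild_wheel U y W \<longleftrightarrow> hole W \<and> set W \<subseteq> U \<and> y \<in> U \<and> y \<notin> set W \<and> card (nb y (set W)) \<ge> 3 \<and>
     (\<forall>q \<in> U. q \<notin> set W \<longrightarrow> q \<noteq> y \<longrightarrow> \<not> E q y \<longrightarrow> card (nb q (set W)) \<le> 2)"

text \<open>This expresses that \<open>u\<close> and \<open>w\<close> lie in the interiors of
  different sectors.\<close>

definition separated :: "'a \<Rightarrow> 'a list \<Rightarrow> 'a \<Rightarrow> 'a \<Rightarrow> bool" where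
  "separated y W u w \<longleftrightarrow> \<not> E y u \<and> \<not> E y w \<and>
     (\<exists>A B. hole (u # A @ w # B) \<and> set (u # A @ w # B) = set W \<and> nb y (set A) \<noteq> {} \<and> nb y (set B) \<noteq> {})"

definition detour :: "'a set \<Rightarrow> 'a \<Rightarrow> 'a list \<Rightarrow> 'a \<Rightarrow> 'a \<Rightarrow> 'a list \<Rightarrow> bool" where
  "detour U y W u w P \<longleftrightarrow> ipath P \<and> P \<noteq> [] \<and> set P \<subseteq> U \<and> set P \<inter> set W = {} \<and> y \<notin> set P \<and> nb y (set P) = {} \<and>
     separated y W u w \<and> E u (hd P) \<and> E w (last P)"

lemma mild_wheelD:
  assumes "mild_wheel U y W"
  shows "hole W" "set W \<subseteq> U" "y \<in> U" "y \<notin> set W" "card (nb y (set W)) \<ge> 4"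
    "\<And>q. q \<in> U \<Longrightarrow> q \<notin> set W \<Longrightarrow> q \<noteq> y \<Longrightarrow> \<not> E q y \<Longrightarrow> card (nb q (set W)) \<le> 2"
proof -
  show 1: "hole W" "set W \<subseteq> U" "y \<in> U" "y \<notin> set W"
    "\<And>q. q \<in> U \<Longrightarrow> q \<notin> set W \<Longrightarrow> q \<noteq> y \<Longrightarrow> \<not> E q y \<Longrightarrow> card (nb q (set W)) \<le> 2"
    using assms unfolding mild_wheel_def by blast+
  have "card (nb y (set W)) \<ge> 3" using assms unfolding mild_wheel_def by blast
  then show "card (nb y (set W)) \<ge> 4" using not_three_nb[OF 1(1,4)] by linarith
qed

lemma separated_sym: "separated y W u w \<Longrightarrow> separated y W w u"
  unfolding separated_def by (metis hole_swap append_Cons set_append Un_commute)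

lemma separatedI:
  assumes "hole (u # A @ w # B)" "set (u # A @ w # B) = set W" "\<not> E y u" "\<not> E y w" "nb y (set A) \<noteq> {}" "nb y (set B) \<noteq> {}"
  shows "separated y W u w"
  unfolding separated_def using assms by blast

text \<open>The last fact passes from the one listing of the rim given by the definition to every
  listing, by \<open>hole_arcs_unique\<close>.\<close>

lemma separatedD:
  assumes "separated y W u w"
  shows "\<not> E y u" "\<not> E y w" "u \<noteq> w" "u \<in> set W" "w \<in> set W" "\<not> E u w"
    "hole (u # A @ w # B) \<Longrightarrow> set (u # A @ w # B) = set W \<Longrightarrow> nb y (set A) \<noteq> {} \<and> nb y (set B) \<noteq> {}"
proof -
  obtain A0 B0 where h: "hole (u # A0 @ w # B0)" "set (u # A0 @ w # B0) = set W" "nb y (set A0) \<noteq> {}" "nb y (set B0) \<noteq> {}"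
    and y: "\<not> E y u" "\<not> E y w"
    using assms unfolding separated_def by blast
  have d: "distinct (u # A0 @ w # B0)" using h(1) by (rule hole_distinct)
  have ne: "A0 \<noteq> []" "B0 \<noteq> []" using h(3,4) by (auto simp: nb_def)
  show "\<not> E y u" "\<not> E y w" by (rule y)+
  show "u \<noteq> w" "u \<in> set W" "w \<in> set W" using d h(2) by auto
  have h1: "hole ([u] @ (A0 @ w # B0))" using h(1) by simp
  have "E u w \<longleftrightarrow> w = hd (A0 @ w # B0) \<or> w = last (A0 @ w # B0)"
    using hole_appendD(4)[OF h1, of u w] by simp
  moreover have "hd (A0 @ w # B0) \<in> set A0" "last (A0 @ w # B0) \<in> set B0" using ne by simp_all
  ultimately show "\<not> E u w" using d by auto
  assume h': "hole (u # A @ w # B)" "set (u # A @ w # B) = set W"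
  have "(set A0 = set A \<and> set B0 = set B) \<or> (set A0 = set B \<and> set B0 = set A)"
    by (rule hole_arcs_unique[OF h(1) h'(1)]) (use h(2) h'(2) in simp)
  then show "nb y (set A) \<noteq> {} \<and> nb y (set B) \<noteq> {}" using h(3,4) by metis
qed

text \<open>The rim vertices other than spokes are grouped into sectors, and \<open>v\<close> cannot
  share its sector with both \<open>u\<close> and \<open>w\<close>.\<close>

lemma separated_middle:
  assumes "separated y W u w" "hole W" "v \<in> set W" "\<not> E y v"
  shows "separated y W u v \<or> separated y W v w"
proof (cases "v = u \<or> v = w")
  case True
  then show ?thesis using assms(1) by blast
next
  case False
  have aux: "separated y W u v \<or> separated y W v w"
    if h: "hole (u # A @ w # B)" "set (u # A @ w # B) = set W" "v \<in> set A" for A B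
  proof -
    have n: "nb y (set A) \<noteq> {}" "nb y (set B) \<noteq> {}" using separatedD(7)[OF assms(1) h(1,2)] by blast+
    obtain A1 A2 where A: "A = A1 @ v # A2" using h(3) by (metis split_list)
    show ?thesis
    proof (cases "nb y (set A1) = {}")
      case False
      have "hole (u # A1 @ v # (A2 @ w # B))" using h(1) A by simp
      moreover have "nb y (set (A2 @ w # B)) \<noteq> {}" using n(2) by (auto simp: nb_def)
      ultimately show ?thesis
        using separatedI[of u A1 v "A2 @ w # B" W y] False h(2) A separatedD(1)[OF assms(1)] assms(4) by auto
    next
      case True
      then have n2: "nb y (set A2) \<noteq> {}" using n(1) assms(4) A by (auto simp: nb_def)
      have "hole (v # A2 @ w # (B @ u # A1))"
        using hole_rotate[of "u # A1" "v # A2 @ w # B"] h(1) A by simp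
      moreover have "nb y (set (B @ u # A1)) \<noteq> {}" using n(2) by (auto simp: nb_def)
      moreover have "set (v # A2 @ w # B @ u # A1) = set W" using h(2) A by auto
      ultimately show ?thesis
        using separatedI[of v A2 w "B @ u # A1" W y] n2 separatedD(2)[OF assms(1)] assms(4) by auto
    qed
  qed
  obtain A B where h: "hole (u # A @ w # B)" "set (u # A @ w # B) = set W"
    using assms(1) unfolding separated_def by blast
  show ?thesis
  proof (cases "v \<in> set A")
    case True
    then show ?thesis using aux[OF h] by blast
  next
    case False
    then have "v \<in> set (rev B)" using h(2) assms(3) \<open>\<not> (v = u \<or> v = w)\<close> by auto
    moreover have "set (u # rev B @ w # rev A) = set W" using h(2) by auto
    ultimately show ?thesis using aux[OF hole_mirror[OF h(1)]] by blast
  qed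
qed

lemma detour_rev:
  assumes "detour U y W u w P"
  shows "detour U y W w u (rev P)"
  using assms ipath_rev[of P] separated_sym[of y W u w] unfolding detour_def by (simp add: hd_rev last_rev)

text \<open>A vertex off \<open>W\<close> has at most two neighbours on \<open>W\<close> and one on
  \<open>Q\<close>, and \<open>not_three_nb\<close> lowers the sum 3 to 2. A vertex of the abandoned
  arc \<open>B\<close> that is not adjacent to \<open>y\<close> can only be adjacent to
  \<open>f\<close> and \<open>f'\<close>.\<close>

lemma mild_wheel_reroute:
  assumes W: "mild_wheel U y W" "hole (f # A @ f' # B)" "set (f # A @ f' # B) = set W" "B \<noteq> []"
    and Q: "ipath Q" "Q \<noteq> []" "set Q \<subseteq> U" "set Q \<inter> set W = {}" "y \<notin> set Q" "nb y (set Q) = {}"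
    and cr: "\<And>v p. v \<in> set (f # A @ [f']) \<Longrightarrow> p \<in> set Q \<Longrightarrow> E v p \<longleftrightarrow> (v = f \<and> p = hd Q) \<or> (v = f' \<and> p = last Q)"
    and noB: "\<And>v p. v \<in> set B \<Longrightarrow> \<not> E v y \<Longrightarrow> p \<in> set Q \<Longrightarrow> \<not> E v p"
    and few: "\<And>q. q \<in> U \<Longrightarrow> q \<notin> set W \<Longrightarrow> q \<noteq> y \<Longrightarrow> \<not> E q y \<Longrightarrow> q \<notin> set Q \<Longrightarrow> card (nb q (set Q)) \<le> 1"
    and three: "card (nb y (set (f # A @ [f']))) \<ge> 3"
  shows "mild_wheel U y (f # A @ f' # rev Q)" "nb y (set (f # A @ f' # rev Q)) = nb y (set (f # A @ [f']))"
proof -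
  note w = mild_wheelD[OF W(1)]
  have sub: "set (f # A @ [f']) \<subseteq> set W" "set B \<subseteq> set W" using W(3) by auto
  have h: "hole (f # A @ f' # rev Q)"
    by (rule hole_reroute[OF W(2,4) Q(1,2) _ cr]) (use Q(4) sub in auto)
  have s: "set (f # A @ f' # rev Q) = set (f # A @ [f']) \<union> set Q" by auto
  show n: "nb y (set (f # A @ f' # rev Q)) = nb y (set (f # A @ [f']))"
    unfolding s nb_Un Q(6) by simp
  have "card (nb q (set (f # A @ f' # rev Q))) \<le> 2"
    if q: "q \<in> U" "q \<notin> set (f # A @ f' # rev Q)" "q \<noteq> y" "\<not> E q y" for q
  proof (cases "q \<in> set W")
    case True
    then have qB: "q \<in> set B" using q(2) W(3) by auto
    have "nb q (set (f # A @ f' # rev Q)) \<subseteq> {f, f'}"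
    proof
      fix v assume "v \<in> nb q (set (f # A @ f' # rev Q))"
      then have v: "v \<in> set (f # A @ [f']) \<or> v \<in> set Q" "E q v" by (auto simp: nb_def)
      then have "v \<in> set (f # A @ [f'])" using noB[OF qB q(4)] by blast
      then show "v \<in> {f, f'}" using hole_arc_cross[OF W(2) _ qB, of v] sym[OF v(2)] by blast
    qed
    then have "card (nb q (set (f # A @ f' # rev Q))) \<le> card {f, f'}" by (intro card_mono) auto
    also have "\<dots> \<le> 2" by (simp add: card_insert_if)
    finally show ?thesis .
  next
    case False
    have "nb q (set (f # A @ f' # rev Q)) \<subseteq> nb q (set W) \<union> nb q (set Q)"
      unfolding s using sub(1) by (auto simp: nb_def)
    then have "card (nb q (set (f # A @ f' # rev Q))) \<le> card (nb q (set W) \<union> nb q (set Q))"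
      by (intro card_mono) auto
    also have "\<dots> \<le> card (nb q (set W)) + card (nb q (set Q))" by (rule card_Un_le)
    also have "\<dots> \<le> 2 + 1"
      using w(6)[OF q(1) False q(3,4)] few[OF q(1) False q(3,4)] q(2) by (intro add_mono) auto
    finally show ?thesis using not_three_nb[OF h q(2)] by linarith
  qed
  then show "mild_wheel U y (f # A @ f' # rev Q)"
    unfolding mild_wheel_def using h n three w(2-4) sub Q(3,5) by auto
qed

text \<open>Since \<open>U\<close> without the closed neighbourhood of \<open>y\<close> is
  connected, an induced path there leads from the interior \<open>S\<close> of one sector to a
  vertex of \<open>B\<close> that is no spoke. Its inner vertices are the detour.\<close>

lemma detour_exists:
  assumes W: "mild_wheel U y W" and c: "conn (U - insert y (nb y U))"
  obtains u w P where "detour U y W u w P"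
proof -
  note w = mild_wheelD[OF W]
  have nadj: "\<not> E a b" if "E y a" "E y b" for a b using no_C3[of y a b] that sym by blast
  have "nb y (set W) \<noteq> {}" using w(5) by auto
  then obtain h where h: "h \<in> set W" "E y h" by (auto simp: nb_def)
  obtain C where C: "hole (h # C)" "set (h # C) = set W" by (rule hole_start[OF w(1) h(1)])
  have "nb y (set W) \<subseteq> insert h (nb y (set C))" unfolding C(2)[symmetric] by (auto simp: nb_def)
  then have "card (nb y (set W)) \<le> card (insert h (nb y (set C)))" by (intro card_mono) auto
  also have "\<dots> \<le> Suc (card (nb y (set C)))" by (rule card_insert_le_m1) auto
  finally have c3: "card (nb y (set C)) \<ge> 3" using w(5) by simp
  then have "nb y (set C) \<noteq> {}" by auto
  then have "\<exists>v \<in> set C. E y v" by (auto simp: nb_def)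
  from split_list_first_prop[OF this] obtain S h' B
    where S: "C = S @ h' # B" "E y h'" "\<forall>v \<in> set S. \<not> E y v" by blast
  have hole: "hole (h # S @ h' # B)" using C(1) S(1) by simp
  have d: "distinct (h # S @ h' # B)" using hole by (rule hole_distinct)
  have nB: "nb y (set B) \<noteq> {}"
  proof
    assume "nb y (set B) = {}"
    then have "nb y (set C) \<subseteq> {h'}" using S by (auto simp: nb_def)
    then have "card (nb y (set C)) \<le> card {h'}" by (intro card_mono) auto
    then show False using c3 by simp
  qed
  \<comment> \<open>Adjacent spokes would form a triangle with \<open>y\<close>, so every sector has
    an inner vertex.\<close>
  have "S \<noteq> []"
  proof
    assume "S = []"
    then have "hole ([h] @ (h' # B))" using hole by simp
    then have "E h h'" using hole_appendD(4)[of "[h]" "h' # B" h h'] by simp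
    then show False using nadj h(2) S(2) by blast
  qed
  have "B \<noteq> []" using nB by (auto simp: nb_def)
  have "E h' (hd B)" using hole_arc_cross[OF hole, of h' "hd B"] \<open>B \<noteq> []\<close> by simp
  then have nhd: "\<not> E y (hd B)" using nadj[OF S(2)] by blast
  let ?D = "U - insert y (nb y U)"
  have inD: "v \<in> ?D" if "v \<in> set W" "\<not> E y v" for v using that w(2,4) by (auto simp: nb_def)
  have sW: "set (h # S @ h' # B) = set W" using C(2) S(1) by simp
  obtain s0 where s0: "s0 \<in> set S" using \<open>S \<noteq> []\<close> hd_in_set by blast
  have "s0 \<in> set W" "hd B \<in> set W" unfolding sW[symmetric] using s0 \<open>B \<noteq> []\<close> by simp_all
  then have s0D: "s0 \<in> ?D" and hdD: "hd B \<in> ?D" using inD s0 S(3) nhd by blast+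
  have hdY: "hd B \<in> {v \<in> set B. \<not> E y v}" using nhd \<open>B \<noteq> []\<close> by auto
  obtain xs where xs: "ipath xs" "xs \<noteq> []" "set xs \<subseteq> ?D" "hd xs \<in> set S" "last xs \<in> {v \<in> set B. \<not> E y v}"
    "set (tl xs) \<inter> set S = {}" "set (butlast xs) \<inter> {v \<in> set B. \<not> E y v} = {}"
    by (rule conn_path_between[OF c s0D s0 hdD hdY])
  have "hd xs \<noteq> last xs" using xs(4,5) d by auto
  then have "tl xs \<noteq> []" using xs(2) by (cases xs) auto
  then have "xs = hd xs # butlast (tl xs) @ [last xs]"
    using xs(2) by (cases xs) auto
  then obtain P where P: "xs = hd xs # P @ [last xs]" by blast
  define u w where "u = hd xs" and "w = last xs"
  have e: "xs = u # P @ [w]" using P unfolding u_def w_def .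
  have uS: "u \<in> set S" and wB: "w \<in> set B" "\<not> E y w" using xs(4,5) unfolding u_def w_def by auto
  have "P \<noteq> []"
  proof
    assume "P = []"
    then have "E u w" using xs(1) e by simp
    then show False using hole_arcs_apart(1)[OF hole uS wB(1)] by blast
  qed
  have ip: "ipath P" using xs(1) e ipath_appendD[of "[u]" "P @ [w]"] ipath_appendD[of P "[w]"] by simp
  have Eu: "E u (hd P)"
    using xs(1) e ipath_cross[of "[u]" "P @ [w]" u "hd P"] \<open>P \<noteq> []\<close> by simp
  have Ew: "E w (last P)"
    using xs(1) e ipath_cross[of "u # P" "[w]" "last P" w] \<open>P \<noteq> []\<close> sym by simp
  have PD: "set P \<subseteq> ?D" using xs(3) e by auto
  have "v \<notin> set W" if v: "v \<in> set P" for v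
  proof
    assume vW: "v \<in> set W"
    have yv: "\<not> E y v" using PD v by (auto simp: nb_def)
    then have "v \<noteq> h" "v \<noteq> h'" using h(2) S(2) by auto
    then have "v \<in> set S \<or> v \<in> set B" using vW sW by auto
    moreover have "v \<notin> set S" using xs(6) e v by auto
    moreover have "v \<in> set (butlast xs)" using e v by (simp add: butlast_append)
    then have "v \<notin> set B" using xs(7) yv by blast
    ultimately show False by blast
  qed
  then have PW: "set P \<inter> set W = {}" by blast
  obtain S1 S2 where S12: "S = S1 @ u # S2" using uS by (metis split_list)
  obtain B1 B2 where B12: "B = B1 @ w # B2" using wB by (metis split_list)
  have "hole (u # (S2 @ h' # B1) @ w # (B2 @ h # S1))"
    using hole_rotate[of "h # S1" "u # S2 @ h' # B1 @ w # B2"] hole S12 B12 by simp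
  moreover have "set (u # (S2 @ h' # B1) @ w # (B2 @ h # S1)) = set W" using sW S12 B12 by auto
  moreover have "\<not> E y u" using S(3) uS by blast
  moreover have "nb y (set (S2 @ h' # B1)) \<noteq> {}" "nb y (set (B2 @ h # S1)) \<noteq> {}" using S(2) h(2) by (auto simp: nb_def)
  ultimately have "separated y W u w" using wB(2) by (intro separatedI)
  moreover have "y \<notin> set P" "nb y (set P) = {}" "set P \<subseteq> U" using PD by (auto simp: nb_def)
  ultimately show thesis using that[of u w P] ip \<open>P \<noteq> []\<close> PW Eu Ew unfolding detour_def by blast
qed

end

section \<open>Detours of minimal length around a fixed hub\<close>

locale minimal_hub = g5_graph +
  fixes U :: "'a set" and y :: 'a and k m :: nat
  assumes kmin: "mild_wheel U y W \<Longrightarrow> k \<le> card (nb y (set W))"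
    and mmin: "mild_wheel U y W \<Longrightarrow> card (nb y (set W)) = k \<Longrightarrow> detour U y W u w P \<Longrightarrow> m \<le> length P"
begin

definition minimal_detour :: "'a list \<Rightarrow> 'a \<Rightarrow> 'a \<Rightarrow> 'a list \<Rightarrow> bool" where
  "minimal_detour W u w P \<longleftrightarrow> mild_wheel U y W \<and> card (nb y (set W)) = k \<and> detour U y W u w P \<and> length P = m"

lemma minimal_detourD:
  assumes "minimal_detour W u w P"
  shows "mild_wheel U y W" "card (nb y (set W)) = k" "detour U y W u w P" "length P = m"
    "ipath P" "P \<noteq> []" "set P \<subseteq> U" "set P \<inter> set W = {}" "y \<notin> set P" "nb y (set P) = {}"
    "separated y W u w" "E u (hd P)" "E w (last P)"
  using assms unfolding minimal_detour_def detour_def by blast+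

text \<open>Otherwise \<open>q\<close> could replace the stretch \<open>M\<close> between its
  extreme neighbours on \<open>P\<close>. By girth 5, \<open>M\<close> has at least two vertices, so
  the detour would get shorter.\<close>

lemma few_nb_detour:
  assumes md: "minimal_detour W u w P" and q: "q \<in> U" "q \<notin> set W" "q \<noteq> y" "\<not> E q y" "q \<notin> set P"
  shows "card (nb q (set P)) \<le> 1"
proof (rule ccontr)
  note d = minimal_detourD[OF md]
  assume "\<not> ?thesis"
  then have two: "card (nb q (set P)) \<ge> 2" by simp
  then have "nb q (set P) \<noteq> {}" by auto
  then have "\<exists>p \<in> set P. E q p" by (auto simp: nb_def)
  from split_list_first_prop[OF this] obtain P1 p P'
    where p: "P = P1 @ p # P'" "E q p" "\<forall>v \<in> set P1. \<not> E q v" by blast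
  have "nb q (set P') \<noteq> {}"
  proof
    assume "nb q (set P') = {}"
    then have "nb q (set P) \<subseteq> {p}" using p by (auto simp: nb_def)
    then have "card (nb q (set P)) \<le> card {p}" by (intro card_mono) auto
    then show False using two by simp
  qed
  then have "\<exists>p \<in> set P'. E q p" by (auto simp: nb_def)
  from split_list_last_prop[OF this] obtain M p' P2
    where p': "P' = M @ p' # P2" "E q p'" "\<forall>v \<in> set P2. \<not> E q v" by blast
  have e: "P = (P1 @ [p]) @ (M @ p' # P2)" using p(1) p'(1) by simp
  have ip: "ipath ((P1 @ [p]) @ (M @ p' # P2))" using d(5) unfolding e .
  have dP: "distinct ((P1 @ [p]) @ (M @ p' # P2))" using ip by (rule ipath_distinct)
  have cr: "E x z \<longleftrightarrow> x = p \<and> z = hd (M @ p' # P2)" if "x \<in> set (P1 @ [p])" "z \<in> set (M @ p' # P2)" for x z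
    using ipath_cross[OF ip that] by simp
  have M1: "M \<noteq> []"
  proof
    assume "M = []"
    then have "E p p'" using cr[of p p'] by simp
    then show False using no_C3[of q p p'] p(2) p'(2) sym by blast
  qed
  have M2: "length M \<noteq> 1"
  proof
    assume "length M = 1"
    then obtain z where z: "M = [z]" by (cases M) auto
    have "E p z" using cr[of p z] z by simp
    moreover have "E z p'" using ipath_cross[of "[z]" "p' # P2" z p'] ipath_appendD(2)[OF ip] z by simp
    ultimately show False using no_C4[of q p z p'] p(2) p'(2) sym q(5) dP z e by auto
  qed
  have lenM: "length M \<ge> 2" using M1 M2 by (cases M) (auto simp: Suc_le_eq)
  let ?P = "(P1 @ [p]) @ (q # p' # P2)"
  have ip1: "ipath (P1 @ [p])" using ip by (rule ipath_appendD)
  have "ipath (p' # P2)" using ipath_appendD(2)[OF ipath_appendD(2)[OF ip]] .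
  then have ip2: "ipath (q # p' # P2)" using p' q(5) e by (auto simp: ipath_Cons)
  have c: "E x z \<longleftrightarrow> x = last (P1 @ [p]) \<and> z = hd (q # p' # P2)" if "x \<in> set (P1 @ [p])" "z \<in> set (q # p' # P2)" for x z
  proof (cases "z = q")
    case True
    then show ?thesis using that p E_commute[of x q] by auto
  next
    case False
    then have z: "z \<in> set (p' # P2)" using that by auto
    have "hd (M @ p' # P2) \<in> set M" using M1 by simp
    then have "z \<noteq> hd (M @ p' # P2)" using z dP by auto
    then have "\<not> E x z" using cr[OF that(1), of z] z by auto
    then show ?thesis using False by simp
  qed
  have "set (P1 @ [p]) \<inter> set (q # p' # P2) = {}" using dP q(5) e by auto
  then have "ipath ?P" using ip1 ip2 c ipath_append[of "P1 @ [p]" "q # p' # P2"] by blast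
  moreover have "set ?P \<subseteq> insert q (set P)" using e by auto
  moreover have "hd ?P = hd P" "last ?P = last P" unfolding e by (cases P1) auto
  moreover have "\<not> E y q" using q(4) sym by blast
  ultimately have "detour U y W u w ?P"
    unfolding detour_def using d(6-13) q by (auto simp: nb_def)
  then have "m \<le> length ?P" using mmin d(1,2) by blast
  moreover have "length P = m" by (rule d(4))
  ultimately show False using lenM unfolding e by simp
qed

text \<open>If \<open>v\<close> were no spoke, \<open>separated_middle\<close> would make the piece
  of \<open>P\<close> up to \<open>p\<close> or the piece from \<open>p\<close> on a detour with end
  \<open>v\<close>, and both are shorter than \<open>P\<close>.\<close>

lemma inner_foot:
  assumes md: "minimal_detour W u w P" and P: "P = P1 @ p # P2" "P1 \<noteq> []" "P2 \<noteq> []" and v: "v \<in> set W" "E v p"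
  shows "E y v"
proof (rule ccontr)
  note d = minimal_detourD[OF md]
  assume n: "\<not> E y v"
  from separated_middle[OF d(11) mild_wheelD(1)[OF d(1)] v(1) n] show False
  proof
    assume s: "separated y W u v"
    have "ipath (P1 @ [p])" using d(5) P(1) ipath_appendD(1)[of "P1 @ [p]" P2] by simp
    then have "detour U y W u v (P1 @ [p])"
      unfolding detour_def using d(6-13) s v P by (auto simp: nb_def)
    then have "m \<le> length (P1 @ [p])" using mmin d(1,2) by blast
    then show False using d(4) P(1,3) by (cases P2) auto
  next
    assume s: "separated y W v w"
    have "ipath (p # P2)" using d(5) P(1) ipath_appendD(2)[of P1 "p # P2"] by simp
    then have "detour U y W v w (p # P2)"
      unfolding detour_def using d(6-13) s v P by (auto simp: nb_def)
    then have "m \<le> length (p # P2)" using mmin d(1,2) by blast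
    then show False using d(4) P(1,2) by (cases P1) auto
  qed
qed

text \<open>Two feet of \<open>p\<close> would both be spokes and form a 4-cycle with
  \<open>p\<close> and \<open>y\<close>.\<close>

lemma inner_foot_unique:
  assumes md: "minimal_detour W u w P" and P: "P = P1 @ p # P2" "P1 \<noteq> []" "P2 \<noteq> []"
    and v: "v \<in> set W" "E v p" "v' \<in> set W" "E v' p"
  shows "v = v'"
proof (rule ccontr)
  assume "v \<noteq> v'"
  moreover have "E y v" "E y v'" using inner_foot[OF md P] v by blast+
  moreover have "p \<noteq> y" using minimal_detourD(9)[OF md] P(1) by auto
  ultimately show False using no_C4[of v p v' y] v sym by blast
qed

section \<open>Stretches \<open>Q\<close> of a minimal detour that touch the rim only in two
  nonadjacent feet\<close>

context
  fixes W u w P P1 Q P2 f f'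
  assumes md: "minimal_detour W u w P" and P: "P = P1 @ Q @ P2" "Q \<noteq> []"
    and f: "f \<in> set W" "f' \<in> set W" "f \<noteq> f'" "\<not> E f f'"
    and cr: "\<And>v p. v \<in> set W \<Longrightarrow> p \<in> set Q \<Longrightarrow> E v p \<longleftrightarrow> (v = f \<and> p = hd Q) \<or> (v = f' \<and> p = last Q)"
begin

text \<open>Off the detour this is \<open>few_nb_detour\<close>. A vertex of \<open>P1\<close> or
  \<open>P2\<close> can only be adjacent to the end of \<open>Q\<close> on its side.\<close>

lemma few_nb_part:
  assumes q: "q \<in> U" "q \<notin> set W" "q \<noteq> y" "\<not> E q y" "q \<notin> set Q"
  shows "card (nb q (set Q)) \<le> 1"
proof (cases "q \<in> set P")
  case False
  have "nb q (set Q) \<subseteq> nb q (set P)" using P by (auto simp: nb_def)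
  then have "card (nb q (set Q)) \<le> card (nb q (set P))" by (intro card_mono) auto
  then show ?thesis using few_nb_detour[OF md q(1-4) False] by simp
next
  case True
  note ip = minimal_detourD(5)[OF md]
  have "\<exists>x. nb q (set Q) \<subseteq> {x}"
  proof (cases "q \<in> set P1")
    case True
    have "nb q (set Q) \<subseteq> {hd (Q @ P2)}"
      using ipath_cross[of P1 "Q @ P2" q] ip P True by (auto simp: nb_def)
    then show ?thesis by blast
  next
    case False
    then have qP2: "q \<in> set P2" using True q(5) P by auto
    have "nb q (set Q) \<subseteq> {last (P1 @ Q)}"
      using ipath_cross[of "P1 @ Q" P2 _ q] ip P qP2 sym by (auto simp: nb_def)
    then show ?thesis by blast
  qed
  then obtain x where "nb q (set Q) \<subseteq> {x}" by blast
  then have "card (nb q (set Q)) \<le> card {x}" by (intro card_mono) auto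
  then show ?thesis by simp
qed

lemma arcs_nonempty:
  assumes h: "hole (f # A @ f' # B)"
  shows "A \<noteq> []" "B \<noteq> []"
proof -
  have h1: "hole ((f # A) @ (f' # B))" using h(1) by simp
  have cr1: "E f f' \<longleftrightarrow> f = last (f # A) \<or> f' = last (f' # B)"
    using hole_appendD(4)[OF h1, of f f'] by simp
  show "A \<noteq> []" using cr1 f(4) by (cases "A = []") auto
  show "B \<noteq> []" using cr1 f(4) by (cases "B = []") auto
qed

lemma reroute_part:
  assumes h: "hole (f # A @ f' # B)" "set (f # A @ f' # B) = set W" and three: "card (nb y (set (f # A @ [f']))) \<ge> 3"
  shows "mild_wheel U y (f # A @ f' # rev Q)" "nb y (set (f # A @ f' # rev Q)) = nb y (set (f # A @ [f']))"
proof -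
  note d = minimal_detourD[OF md]
  have B: "B \<noteq> []" by (rule arcs_nonempty(2)[OF h(1)])
  have dW: "distinct (f # A @ f' # B)" using h(1) by (rule hole_distinct)
  have ipQ: "ipath Q" using d(5) P(1) ipath_appendD(2)[of P1 "Q @ P2"] ipath_appendD(1)[of Q P2] by simp
  have Q: "set Q \<subseteq> U" "set Q \<inter> set W = {}" "y \<notin> set Q" "nb y (set Q) = {}"
    using d(7-10) P(1) by (auto simp: nb_def)
  have c: "E v p \<longleftrightarrow> (v = f \<and> p = hd Q) \<or> (v = f' \<and> p = last Q)" if "v \<in> set (f # A @ [f'])" "p \<in> set Q" for v p
    by (rule cr) (use that h(2) in auto)
  have nB: "\<not> E v p" if "v \<in> set B" "\<not> E v y" "p \<in> set Q" for v p
    using cr[of v p] that h(2) dW by auto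
  show "mild_wheel U y (f # A @ f' # rev Q)" "nb y (set (f # A @ f' # rev Q)) = nb y (set (f # A @ [f']))"
    by (rule mild_wheel_reroute[OF d(1) h B ipQ P(2) Q c nB few_nb_part three]; assumption)+
qed

text \<open>Rerouting along \<open>Q\<close> gives up the spokes on one arc, so by the choice of
  \<open>k\<close> at most two spokes may remain, whichever arc is given up. As \<open>k\<close> is
  at least 4, each arc carries exactly two and neither \<open>f\<close> nor \<open>f'\<close> is a
  spoke; \<open>theta_with_hub\<close> settles this case.\<close>

lemma both_arcs_spoked:
  assumes h: "hole (f # A @ f' # B)" "set (f # A @ f' # B) = set W" and n: "nb y (set A) \<noteq> {}" "nb y (set B) \<noteq> {}"
  shows False
proof -
  note d = minimal_detourD[OF md]
  have dW: "distinct (f # A @ f' # B)" using h(1) by (rule hole_distinct)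
  let ?s = "card (nb y {f, f'})" and ?a = "card (nb y (set A))" and ?b = "card (nb y (set B))"
  have ab: "?a \<ge> 1" "?b \<ge> 1" using n by (simp_all add: Suc_le_eq card_gt_0_iff)
  have eA: "nb y (set (f # A @ [f'])) = nb y {f, f'} \<union> nb y (set A)" by (auto simp: nb_def)
  have cA: "card (nb y (set (f # A @ [f']))) = ?s + ?a"
    unfolding eA by (rule card_Un_disjoint) (use dW in \<open>auto simp: nb_def\<close>)
  have eB: "nb y (set (f # rev B @ [f'])) = nb y {f, f'} \<union> nb y (set B)" by (auto simp: nb_def)
  have cB: "card (nb y (set (f # rev B @ [f']))) = ?s + ?b"
    unfolding eB by (rule card_Un_disjoint) (use dW in \<open>auto simp: nb_def\<close>)
  have "nb y (set W) = nb y (set (f # A @ [f'])) \<union> nb y (set B)" unfolding h(2)[symmetric] by (auto simp: nb_def)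
  moreover have "card (nb y (set (f # A @ [f'])) \<union> nb y (set B)) = card (nb y (set (f # A @ [f']))) + ?b"
    by (rule card_Un_disjoint) (use dW in \<open>auto simp: nb_def\<close>)
  ultimately have kk: "k = ?s + ?a + ?b" using d(2) cA by simp
  have k4: "k \<ge> 4" using mild_wheelD(5)[OF d(1)] d(2) by simp
  have "\<not> ?s + ?a \<ge> 3"
  proof
    assume "?s + ?a \<ge> 3"
    then have "card (nb y (set (f # A @ [f']))) \<ge> 3" using cA by simp
    note r = reroute_part[OF h this]
    have "k \<le> ?s + ?a" using kmin[OF r(1)] r(2) cA by simp
    then show False using kk ab by simp
  qed
  moreover have "\<not> ?s + ?b \<ge> 3"
  proof
    assume "?s + ?b \<ge> 3"
    then have c3: "card (nb y (set (f # rev B @ [f']))) \<ge> 3" using cB by simp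
    have "set (f # rev B @ f' # rev A) = set W" using h(2) by auto
    note r = reroute_part[OF hole_mirror[OF h(1)] this c3]
    have "k \<le> ?s + ?b" using kmin[OF r(1)] r(2) cB by simp
    then show False using kk ab by simp
  qed
  ultimately have z: "?s = 0" "?a = 2" "?b = 2" using kk k4 ab by linarith+
  then have "card (nb y (set (f # A @ [f']))) = 2" using cA by simp
  then obtain h1 h2 where hh: "nb y (set (f # A @ [f'])) = {h1, h2}" "h1 \<noteq> h2"
    unfolding card_2_iff by blast
  have nf: "\<not> E y f'" using z(1) by (auto simp: nb_def)
  have "\<exists>g \<in> set B. E y g" using n(2) by (auto simp: nb_def)
  from split_list_first_prop[OF this] obtain B1 g B2
    where B: "B = B1 @ g # B2" "E y g" "\<forall>v \<in> set B1. \<not> E y v" by blast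
  have "B2 \<noteq> []"
  proof
    assume "B2 = []"
    then have "nb y (set B) \<subseteq> {g}" using B by (auto simp: nb_def)
    then have "?b \<le> card {g}" by (intro card_mono) auto
    then show False using z(3) by simp
  qed
  have h': "hole (f # A @ f' # B1 @ g # B2)" using h(1) B(1) by simp
  have sW: "set (f # A @ f' # B1 @ g # B2) = set W" using h(2) B(1) by simp
  have ipQ: "ipath Q" using d(5) P(1) ipath_appendD(2)[of P1 "Q @ P2"] ipath_appendD(1)[of Q P2] by simp
  have QW: "set Q \<inter> set W = {}" "y \<notin> set Q" "nb y (set Q) = {}" using d(8-10) P(1) by (auto simp: nb_def)
  have K: "hole (f # A @ f' # rev Q)"
  proof (rule hole_reroute[OF h(1) arcs_nonempty(2)[OF h(1)] ipQ P(2)])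
    show "set Q \<inter> set (f # A @ [f']) = {}" using QW(1) h(2) by auto
    show "E v p \<longleftrightarrow> v = f \<and> p = hd Q \<or> v = f' \<and> p = last Q" if "v \<in> set (f # A @ [f'])" "p \<in> set Q" for v p
      by (rule cr) (use that h(2) in auto)
  qed
  show False
  proof (rule theta_with_hub[OF h' \<open>B2 \<noteq> []\<close> K _ _ QW(2,3) hh nf B(2)])
    show "set Q \<inter> set (f # A @ f' # B1 @ g # B2) = {}" "y \<notin> set (f # A @ f' # B1 @ g # B2)"
      unfolding sW using QW mild_wheelD(4)[OF d(1)] by blast+
    fix v p assume v: "v \<in> set (B1 @ [g])" "p \<in> set Q"
    have "v \<in> set W" "v \<noteq> f" "v \<noteq> f'" using v(1) sW dW B(1) by auto
    then show "\<not> E p v" using cr[of v p] v(2) sym[of p v] by blast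
  qed
qed

context
  fixes A B
  assumes h: "hole (f # A @ f' # B)" "set (f # A @ f' # B) = set W" and sf: "nb y (set B) = {}"
begin

text \<open>As \<open>B\<close> has no spoke, exchanging it for \<open>Q\<close> keeps all
  \<open>k\<close> spokes, so the minimality of \<open>m\<close> also constrains the new
  wheel.\<close>

lemma rerouted:
  shows "mild_wheel U y (f # A @ f' # rev Q)" "card (nb y (set (f # A @ f' # rev Q))) = k"
proof -
  note d = minimal_detourD[OF md]
  have e: "nb y (set (f # A @ [f'])) = nb y (set W)"
    unfolding h(2)[symmetric] using sf by (auto simp: nb_def)
  have "card (nb y (set (f # A @ [f']))) \<ge> 3" unfolding e using mild_wheelD(5)[OF d(1)] by simp
  note r = reroute_part[OF h this]
  show "mild_wheel U y (f # A @ f' # rev Q)" "card (nb y (set (f # A @ f' # rev Q))) = k"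
    using r(1,2) e d(2) by simp_all
qed

text \<open>On the rerouted rim the end of \<open>Q\<close> is separated from \<open>w\<close>, so
  \<open>P2\<close> is a detour there. It is shorter than \<open>m\<close> because \<open>Q\<close>
  is nonempty.\<close>

lemma shorter_suffix:
  assumes A: "A = A1 @ w # A2" and n: "nb y (set (f # A1)) \<noteq> {}" "nb y (set (A2 @ [f'])) \<noteq> {}" and P2: "P2 \<noteq> []"
  shows False
proof -
  note d = minimal_detourD[OF md]
  let ?x = "last Q" and ?Q2 = "rev (butlast Q)"
  have rQ: "rev Q = ?x # ?Q2" using P(2) by (metis append_butlast_last_id rev.simps(2) rev_append rev_rev_ident rev_singleton_conv append_Cons append_Nil)
  have W': "hole (f # A1 @ w # A2 @ f' # ?x # ?Q2)" using mild_wheelD(1)[OF rerouted(1)] A rQ by simp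
  have s1: "hole (?x # (?Q2 @ f # A1) @ w # (A2 @ [f']))"
    using hole_rotate[of "f # A1 @ w # A2 @ [f']" "?x # ?Q2"] W' by simp
  have s2: "set (?x # (?Q2 @ f # A1) @ w # (A2 @ [f'])) = set (f # A @ f' # rev Q)"
    unfolding A rQ by auto
  have "?x \<in> set P" using P by simp
  then have s3: "\<not> E y ?x" using d(10) by (auto simp: nb_def)
  have "nb y (set (?Q2 @ f # A1)) \<noteq> {}" using n(1) by (auto simp: nb_def)
  then have s: "separated y (f # A @ f' # rev Q) ?x w"
    by (rule separatedI[OF s1 s2 s3 separatedD(2)[OF d(11)] _ n(2)])
  have ip: "ipath ((P1 @ Q) @ P2)" using d(5) P(1) by simp
  have "E (last (P1 @ Q)) (hd P2)"
    using ipath_cross[OF ip, of "last (P1 @ Q)" "hd P2"] P(2) P2 last_in_set[of "P1 @ Q"] by simp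
  then have "E ?x (hd P2)" using P(2) by simp
  moreover have "set P2 \<inter> set (f # A @ f' # rev Q) = {}"
  proof -
    have "set (f # A @ f' # rev Q) \<subseteq> set W \<union> set Q" using h(2) by auto
    moreover have "set P2 \<inter> set W = {}" using d(8) P(1) by auto
    moreover have "set P2 \<inter> set Q = {}" using ipath_distinct[OF ip] by auto
    ultimately show ?thesis by blast
  qed
  moreover have "last P = last P2" using P(1) P2 by simp
  ultimately have "detour U y (f # A @ f' # rev Q) ?x w P2"
    unfolding detour_def using s P2 d(7,9,10,13) P(1) ipath_appendD(2)[OF ip] by (auto simp: nb_def)
  then have "m \<le> length P2" using mmin rerouted by blast
  then show False using d(4) P by (cases Q) auto
qed

lemma shorter_prefix:
  assumes A: "A = A1 @ u # A2" and n: "nb y (set (f # A1)) \<noteq> {}" "nb y (set (A2 @ [f'])) \<noteq> {}" and P1: "P1 \<noteq> []"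
  shows False
proof -
  note d = minimal_detourD[OF md]
  let ?x = "hd Q" and ?Q1 = "rev (tl Q)"
  have rQ: "rev Q = ?Q1 @ [?x]" using P(2) by (cases Q) auto
  have W': "hole (f # A1 @ u # A2 @ f' # ?Q1 @ [?x])" using mild_wheelD(1)[OF rerouted(1)] A rQ by simp
  have s1: "hole (?x # (f # A1) @ u # (A2 @ f' # ?Q1))"
    using hole_rotate[of "f # A1 @ u # A2 @ f' # ?Q1" "[?x]"] W' by simp
  have s2: "set (?x # (f # A1) @ u # (A2 @ f' # ?Q1)) = set (f # A @ f' # rev Q)"
    unfolding A rQ by auto
  have "?x \<in> set P" using P by simp
  then have s3: "\<not> E y ?x" using d(10) by (auto simp: nb_def)
  have "nb y (set (A2 @ f' # ?Q1)) \<noteq> {}" using n(2) by (auto simp: nb_def)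
  then have s: "separated y (f # A @ f' # rev Q) u ?x"
    by (rule separated_sym[OF separatedI[OF s1 s2 s3 separatedD(1)[OF d(11)] n(1)]])
  have ip: "ipath (P1 @ (Q @ P2))" using d(5) P(1) by simp
  have "E (last P1) (hd (Q @ P2))"
    using ipath_cross[OF ip, of "last P1" "hd (Q @ P2)"] P(2) P1 hd_in_set[of "Q @ P2"] by simp
  then have "E ?x (last P1)" using P(2) sym by simp
  moreover have "set P1 \<inter> set (f # A @ f' # rev Q) = {}"
  proof -
    have "set (f # A @ f' # rev Q) \<subseteq> set W \<union> set Q" using h(2) by auto
    moreover have "set P1 \<inter> set W = {}" using d(8) P(1) by auto
    moreover have "set P1 \<inter> set Q = {}" using ipath_distinct[OF ip] by auto
    ultimately show ?thesis by blast
  qed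
  moreover have "hd P = hd P1" using P(1) P1 by simp
  ultimately have "detour U y (f # A @ f' # rev Q) u ?x P1"
    unfolding detour_def using s P1 d(7,9,10,12) P(1) ipath_appendD(1)[OF ip] by (auto simp: nb_def)
  then have "m \<le> length P1" using mmin rerouted by blast
  then show False using d(4) P by (cases Q) auto
qed

text \<open>\<open>u\<close> and \<open>w\<close> cannot both lie on \<open>B\<close> or at its
  ends, as no spoke would separate them along \<open>B\<close>. So one of them lies inside
  \<open>A\<close>, and the piece of the detour that leads to it is a shorter detour of the rerouted
  wheel.\<close>

lemma spokefree_arc:
  assumes c: "P1 = [] \<Longrightarrow> f = u" "P1 \<noteq> [] \<Longrightarrow> E y f" "P2 = [] \<Longrightarrow> f' = w" "P1 \<noteq> [] \<Longrightarrow> P2 \<noteq> [] \<Longrightarrow> E y f'"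
  shows False
proof -
  note d = minimal_detourD[OF md]
  note sp = separatedD[OF d(11)]
  show False
  proof (cases "P1 = []")
    case True
    then have fu: "f = u" using c(1) by blast
    have "w \<noteq> f'" using sp(7)[of A B] h sf fu by auto
    moreover have "w \<notin> set B"
    proof
      assume "w \<in> set B"
      then obtain B1 B2 where B: "B = B1 @ w # B2" by (metis split_list)
      then have "nb y (set B2) \<noteq> {}" using sp(7)[of "A @ f' # B1" B2] h fu by auto
      then show False using sf B by (auto simp: nb_def)
    qed
    ultimately have "w \<in> set A" using sp(3,5) h(2) fu by auto
    then obtain A1 A2 where A: "A = A1 @ w # A2" by (metis split_list)
    then have n: "nb y (set A1) \<noteq> {}" "nb y (set (A2 @ f' # B)) \<noteq> {}" using sp(7)[of A1 "A2 @ f' # B"] h fu by auto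
    have "P2 \<noteq> []" using c(3) \<open>w \<noteq> f'\<close> by blast
    moreover have "nb y (set (f # A1)) \<noteq> {}" "nb y (set (A2 @ [f'])) \<noteq> {}"
      using n sf by (auto simp: nb_def)
    ultimately show False using shorter_suffix[OF A] by blast
  next
    case False
    then have yf: "E y f" using c(2) by blast
    then have uf: "u \<noteq> f" "w \<noteq> f" using sp(1,2) by auto
    have nf: "nb y (set (f # X)) \<noteq> {}" for X using yf by (auto simp: nb_def)
    show False
    proof (cases "P2 = []")
      case True
      then have fw: "f' = w" using c(3) by blast
      have hs: "hole (w # B @ f # A)" "set (w # B @ f # A) = set W" using hole_swap[OF h(1)] h(2) fw by auto
      note sp' = separatedD(7)[OF separated_sym[OF d(11)]]
      have "u \<notin> set B"
      proof
        assume "u \<in> set B"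
        then obtain B1 B2 where B: "B = B1 @ u # B2" by (metis split_list)
        then have "nb y (set B1) \<noteq> {}" using sp'[of B1 "B2 @ f # A"] hs by auto
        then show False using sf B by (auto simp: nb_def)
      qed
      then have "u \<in> set A" using sp(3,4) h(2) fw uf by auto
      then obtain A1 A2 where A: "A = A1 @ u # A2" by (metis split_list)
      then have "nb y (set A2) \<noteq> {}" using sp'[of "B @ f # A1" A2] hs by auto
      then have "nb y (set (A2 @ [f'])) \<noteq> {}" by (auto simp: nb_def)
      then show False using shorter_prefix[OF A nf _ False] by blast
    next
      case P2: False
      then have yf': "E y f'" using c(4) False by blast
      then have uf': "u \<noteq> f'" "w \<noteq> f'" using sp(1,2) by auto
      have nf': "nb y (set (X @ [f'])) \<noteq> {}" for X using yf' by (auto simp: nb_def)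
      have uA: "u \<notin> set A"
      proof
        assume "u \<in> set A"
        then obtain A1 A2 where "A = A1 @ u # A2" by (metis split_list)
        then show False using shorter_prefix[OF _ nf nf' False] by blast
      qed
      have wA: "w \<notin> set A"
      proof
        assume "w \<in> set A"
        then obtain A1 A2 where "A = A1 @ w # A2" by (metis split_list)
        then show False using shorter_suffix[OF _ nf nf' P2] by blast
      qed
      have uB: "u \<in> set B" and wB: "w \<in> set B" using uA wA sp(4,5) uf uf' h(2) by auto
      obtain B1 B2 where B: "B = B1 @ u # B2" using uB by (metis split_list)
      have "w \<in> set B1 \<or> w \<in> set B2" using wB B sp(3) by auto
      then show False
      proof
        assume "w \<in> set B2"
        then obtain C1 C2 where C: "B2 = C1 @ w # C2" by (metis split_list)
        have "hole (u # C1 @ w # (C2 @ f # A @ f' # B1))"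
          using hole_rotate[of "f # A @ f' # B1" "u # C1 @ w # C2"] h(1) B C by simp
        then have "nb y (set C1) \<noteq> {}" using sp(7)[of C1 "C2 @ f # A @ f' # B1"] h(2) B C by auto
        then show False using sf B C by (auto simp: nb_def)
      next
        assume "w \<in> set B1"
        then obtain C1 C2 where C: "B1 = C1 @ w # C2" by (metis split_list)
        have "hole (w # C2 @ u # (B2 @ f # A @ f' # C1))"
          using hole_rotate[of "f # A @ f' # C1" "w # C2 @ u # B2"] h(1) B C by simp
        then have "nb y (set C2) \<noteq> {}"
          using separatedD(7)[OF separated_sym[OF d(11)], of C2 "B2 @ f # A @ f' # C1"] h(2) B C by auto
        then show False using sf B C by (auto simp: nb_def)
      qed
    qed
  qed
qed

end

text \<open>Nothing is asked of \<open>f'\<close> when \<open>Q\<close> starts with the detour and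
  stops before its end. This covers a second foot of the first vertex of the detour.\<close>

lemma two_feet_part:
  assumes c: "P1 = [] \<Longrightarrow> f = u" "P1 \<noteq> [] \<Longrightarrow> E y f" "P2 = [] \<Longrightarrow> f' = w" "P1 \<noteq> [] \<Longrightarrow> P2 \<noteq> [] \<Longrightarrow> E y f'"
  shows False
proof -
  obtain A B where h: "hole (f # A @ f' # B)" "set (f # A @ f' # B) = set W"
    by (rule hole_two[OF mild_wheelD(1)[OF minimal_detourD(1)[OF md]] f(1,2,3)])
  have h': "hole (f # rev B @ f' # rev A)" "set (f # rev B @ f' # rev A) = set W"
    using hole_mirror[OF h(1)] h(2) by auto
  consider "nb y (set B) = {}" | "nb y (set (rev A)) = {}" | "nb y (set A) \<noteq> {}" "nb y (set B) \<noteq> {}" by fastforce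
  then show False
    using spokefree_arc[OF h _ c] spokefree_arc[OF h' _ c] both_arcs_spoked[OF h] by cases blast+
qed

end

text \<open>A second foot \<open>h\<close> turns the single vertex \<open>hd P\<close> into a
  stretch with feet \<open>u\<close> and \<open>h\<close>; it has no others, since a mild wheel
  allows it only two rim neighbours.\<close>

lemma first_foot_unique:
  assumes md: "minimal_detour W u w P" and h: "h \<in> set W" "E h (hd P)"
  shows "h = u"
proof (rule ccontr)
  assume hu: "h \<noteq> u"
  note d = minimal_detourD[OF md]
  note sp = separatedD[OF d(11)]
  obtain p1 P' where P: "P = p1 # P'" using d(6) by (cases P) auto
  have p1: "p1 \<in> U" "p1 \<notin> set W" "p1 \<noteq> y" "\<not> E p1 y" "E u p1" "E h p1"
    using d(7-10,12) P h sym by (auto simp: nb_def)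
  have n: "{u, h} \<subseteq> nb p1 (set W)" using p1(5,6) sp(4) h(1) sym by (auto simp: nb_def)
  have "nb p1 (set W) = {u, h}"
    using card_seteq[OF _ n] mild_wheelD(6)[OF d(1) p1(1-4)] hu by simp
  then have foot: "E v p1 \<longleftrightarrow> v = u \<or> v = h" if "v \<in> set W" for v
    using that E_commute[of v p1] unfolding nb_def by blast
  show False
  proof (rule two_feet_part[OF md, of "[]" "[p1]" P' u h])
    show "P = [] @ [p1] @ P'" using P by simp
    show "\<not> E u h" using no_C3[of p1 u h] p1(5,6) sym by blast
    show "h = w" if "P' = []"
      using foot[of w] sp(3,5) d(13) P that by auto
  qed (use sp(4) h(1) hu foot in auto)
qed

lemma minimal_detour_rev: "minimal_detour W u w P \<Longrightarrow> minimal_detour W w u (rev P)"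
  unfolding minimal_detour_def using detour_rev by auto

lemma last_foot_unique:
  assumes "minimal_detour W u w P" "h \<in> set W" "E h (last P)"
  shows "h = w"
  using first_foot_unique[OF minimal_detour_rev[OF assms(1)], of h] assms(2,3)
    minimal_detourD(6)[OF assms(1)] by (simp add: hd_rev)

lemma later_foot:
  assumes md: "minimal_detour W u w P" and P: "P = X @ p # Y" "X \<noteq> []" and v: "v \<in> set W" "E v p"
  shows "Y = [] \<Longrightarrow> v = w" "Y \<noteq> [] \<Longrightarrow> E y v" "v' \<in> set W \<Longrightarrow> E v' p \<Longrightarrow> v' = v"
proof -
  show 1: "v = w" if "Y = []" using last_foot_unique[OF md v(1)] v(2) P that by simp
  show "E y v" if "Y \<noteq> []" by (rule inner_foot[OF md P that v])
  assume v': "v' \<in> set W" "E v' p"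
  show "v' = v"
  proof (cases "Y = []")
    case True
    then have "last P = p" using P by simp
    then show ?thesis using last_foot_unique[OF md] v v' by blast
  next
    case False
    show ?thesis by (rule inner_foot_unique[OF md P False v' v])
  qed
qed

text \<open>By \<open>two_feet_part\<close>, consecutive different feet along the detour are
  adjacent. From \<open>u\<close> this leads to a spoke \<open>h\<close> next to it and from there
  directly to \<open>w\<close>. Rerouting along the whole detour then bypasses \<open>h\<close> and
  loses exactly one spoke, against the choice of \<open>k\<close>.\<close>

lemma no_minimal_detour:
  assumes md: "minimal_detour W u w P"
  shows False
proof -
  note d = minimal_detourD[OF md]
  note sp = separatedD[OF d(11)]
  note mw = mild_wheelD[OF d(1)]
  have dP: "distinct P" using d(5) by (rule ipath_distinct)
  obtain p1 P' where P: "P = p1 # P'" using d(6) by (cases P) auto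
  have p1: "E v p1 \<longleftrightarrow> v = u" if "v \<in> set W" for v
    using first_foot_unique[OF md that] d(12) P by auto
  have "P' \<noteq> []"
  proof
    assume "P' = []"
    then have "E w p1" using d(13) P by simp
    then show False using p1 sp(3,5) by blast
  qed
  then have lP: "last P = last P'" "last P' \<in> set P'" using P by simp_all
  then have "\<exists>p \<in> set P'. \<exists>v \<in> set W. E v p" using d(13) sp(5) by metis
  from split_list_first_prop[OF this] obtain R1 p R2
    where R: "P' = R1 @ p # R2" "\<exists>v \<in> set W. E v p" "\<forall>x \<in> set R1. \<not> (\<exists>v \<in> set W. E v x)" by blast
  obtain h where h: "h \<in> set W" "E h p" using R(2) by blast
  have e1: "P = (p1 # R1) @ p # R2" using P R(1) by simp
  note lf = later_foot[OF md e1 _ h]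
  have foot_p: "E v p \<longleftrightarrow> v = h" if "v \<in> set W" for v using lf(3)[of v] that h by auto
  have hu: "h \<noteq> u" using lf(1,2) sp(1,3) by (cases "R2 = []") auto
  have "E u h"
  proof (rule ccontr)
    assume nadj: "\<not> E u h"
    show False
    proof (rule two_feet_part[OF md, of "[]" "p1 # R1 @ [p]" R2 u h])
      fix v q assume v: "v \<in> set W" and q: "q \<in> set (p1 # R1 @ [p])"
      have dd: "distinct (p1 # R1 @ [p])" using dP e1 by auto
      show "E v q \<longleftrightarrow> v = u \<and> q = hd (p1 # R1 @ [p]) \<or> v = h \<and> q = last (p1 # R1 @ [p])"
        using p1[OF v] foot_p[OF v] R(3) v q dd by auto
    qed (use e1 nadj hu h(1) sp(4) lf(1) in auto)
  qed
  have R2: "R2 \<noteq> []" using lf(1) sp(6) \<open>E u h\<close> by auto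
  then have yh: "E y h" using lf(2) by simp
  then have wh: "w \<noteq> h" using sp(2) by blast
  have "last P \<in> set R2" using e1 R2 by simp
  then have "\<exists>x \<in> set R2. \<exists>v \<in> set W. v \<noteq> h \<and> E v x" using d(13) sp(5) wh by metis
  from split_list_first_prop[OF this] obtain R3 p2 R4
    where R3: "R2 = R3 @ p2 # R4" "\<exists>v \<in> set W. v \<noteq> h \<and> E v p2" "\<forall>x \<in> set R3. \<not> (\<exists>v \<in> set W. v \<noteq> h \<and> E v x)" by blast
  obtain h2 where h2: "h2 \<in> set W" "h2 \<noteq> h" "E h2 p2" using R3(2) by blast
  have e2: "P = (p1 # R1 @ p # R3) @ p2 # R4" using e1 R3(1) by simp
  note lf2 = later_foot[OF md e2 _ h2(1,3)]
  have foot_p2: "E v p2 \<longleftrightarrow> v = h2" if "v \<in> set W" for v using lf2(3)[of v] that h2 by auto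
  \<comment> \<open>\<open>p3\<close> is the last neighbour of \<open>h\<close> before
    \<open>p2\<close>, so the inner vertices of the stretch from \<open>p3\<close> to
    \<open>p2\<close> have no foot.\<close>
  have "\<exists>x \<in> set (p # R3). E h x" using h(2) by simp
  from split_list_last_prop[OF this] obtain R5 p3 R6
    where R5: "p # R3 = R5 @ p3 # R6" "E h p3" "\<forall>x \<in> set R6. \<not> E h x" by blast
  have e3: "P = (p1 # R1 @ R5) @ p3 # (R6 @ p2 # R4)" using e2 R5(1) by simp
  note lf3 = later_foot[OF md e3 _ h(1) R5(2)]
  have foot_p3: "E v p3 \<longleftrightarrow> v = h" if "v \<in> set W" for v using lf3(3)[of v] that R5(2) by auto
  have "E h h2"
  proof (rule ccontr)
    assume nadj: "\<not> E h h2"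
    show False
    proof (rule two_feet_part[OF md, of "p1 # R1 @ R5" "p3 # R6 @ [p2]" R4 h h2])
      fix v q assume v: "v \<in> set W" and q: "q \<in> set (p3 # R6 @ [p2])"
      have dd: "distinct (p3 # R6 @ [p2])" using dP e3 by auto
      have "\<not> E v x" if x: "x \<in> set R6" for x
      proof (cases "v = h")
        case True
        then show ?thesis using R5(3) x by blast
      next
        case False
        have "x \<in> set (p # R3)" using x R5(1) by simp
        then show ?thesis using R3(3) foot_p[OF v] False v by auto
      qed
      then show "E v q \<longleftrightarrow> v = h \<and> q = hd (p3 # R6 @ [p2]) \<or> v = h2 \<and> q = last (p3 # R6 @ [p2])"
        using foot_p3[OF v] foot_p2[OF v] q dd by auto
    qed (use e3 nadj h2 h(1) yh lf2(1,2) in auto)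
  qed
  \<comment> \<open>Two adjacent rim vertices are not both spokes. As \<open>h2\<close> is none,
    \<open>p2\<close> must end the detour, and \<open>h2\<close> is \<open>w\<close>.\<close>
  then have "\<not> E y h2" using no_C3[of y h h2] yh sym by blast
  then have R4: "R4 = []" using lf2(2) by auto
  then have h2w: "h2 = w" using lf2(1) by simp
  obtain C where C: "hole (h # C)" "set (h # C) = set W" by (rule hole_start[OF mw(1) h(1)])
  have Cn: "length C \<ge> 2" "\<And>v. v \<in> set C \<Longrightarrow> E h v \<longleftrightarrow> v = hd C \<or> v = last C"
    using C(1) by (auto simp: hole_def)
  have Cne: "C \<noteq> []" using Cn(1) by auto
  have "E h u" "E h w" using \<open>E u h\<close> \<open>E h h2\<close> h2w sym by blast+
  moreover have "u \<in> set C" "w \<in> set C" using C(2) sp(4,5) hu wh by auto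
  ultimately have "(u = hd C \<and> w = last C) \<or> (w = hd C \<and> u = last C)"
    using Cn(2)[of u] Cn(2)[of w] sp(3) by metis
  then obtain A where A: "hole (u # A @ w # [h])" "set (u # A @ w # [h]) = set W"
  proof
    have Cs: "C = hd C # butlast (tl C) @ [last C]" using Cn(1) Cne
      by (cases C) (auto simp: Suc_le_eq)
    have "hole (C @ [h])" using hole_rotate[of "[h]" C] C(1) by simp
    moreover assume "u = hd C \<and> w = last C"
    ultimately show thesis using that[of "butlast (tl C)"] Cs C(2)
      by (metis append.assoc append_Cons append_Nil insert_commute list.simps(15) set_append Un_insert_right sup_bot.right_neutral empty_set)
  next
    have Cs: "C = hd C # butlast (tl C) @ [last C]" using Cn(1) Cne
      by (cases C) (auto simp: Suc_le_eq)
    assume uw: "w = hd C \<and> u = last C"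
    have "hole (rev (h # C))" using C(1) by (rule hole_rev)
    then have "hole (rev C @ [h])" by simp
    moreover have "rev C = u # rev (butlast (tl C)) @ [w]" using arg_cong[OF Cs, of rev] uw by simp
    ultimately have "hole (u # rev (butlast (tl C)) @ w # [h])" by simp
    moreover have "set (u # rev (butlast (tl C)) @ w # [h]) = set W"
    proof -
      have "set (u # rev (butlast (tl C)) @ w # [h]) = insert h (set (rev C))"
        unfolding \<open>rev C = u # rev (butlast (tl C)) @ [w]\<close> by auto
      then show ?thesis using C(2) by simp
    qed
    ultimately show thesis using that by blast
  qed
  have dA: "distinct (u # A @ w # [h])" using A(1) by (rule hole_distinct)
  have e4: "P = p1 # R1 @ p # R3 @ [p2]" using e2 R4 by simp
  have cr: "E v q \<longleftrightarrow> (v = u \<and> q = hd P) \<or> (v = w \<and> q = last P)" if v: "v \<in> set (u # A @ [w])" and q: "q \<in> set P" for v q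
  proof -
    have vW: "v \<in> set W" "v \<noteq> h" using v A(2) dA by auto
    have "\<not> E v x" if "x \<in> set (R1 @ p # R3)" for x
      using that R(3) R3(3) foot_p[OF vW(1)] vW by auto
    then show ?thesis
      using p1[OF vW(1)] foot_p2[OF vW(1)] h2w q dP unfolding e4 by auto
  qed
  have nW: "nb y (set W) = insert h (nb y (set (u # A @ [w])))"
    unfolding A(2)[symmetric] using yh by (auto simp: nb_def)
  have cW: "card (nb y (set W)) = Suc (card (nb y (set (u # A @ [w]))))"
    unfolding nW by (rule card_insert_disjoint) (use dA in \<open>auto simp: nb_def\<close>)
  have three: "card (nb y (set (u # A @ [w]))) \<ge> 3" using cW mw(5) by simp
  \<comment> \<open>The abandoned arc is the single vertex \<open>h\<close>, which is adjacent to
    \<open>y\<close>; so the condition on \<open>B\<close> holds vacuously.\<close>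
  have noB: "\<not> E v q" if "v \<in> set [h]" "\<not> E v y" for v q using that yh sym by auto
  note r = mild_wheel_reroute[OF d(1) A _ d(5-10) cr noB few_nb_detour[OF md] three]
  have "k \<le> card (nb y (set (u # A @ [w])))"
    using kmin[OF r(1)] r(2) by simp
  then show False using cW d(2) by simp
qed

end

context g5_graph
begin

text \<open>Length is minimised over all wheels in order to find a mild one. Its hub
  \<open>z\<close> stays fixed while \<open>k\<close> and \<open>m\<close> are minimised, and
  \<open>detour_exists\<close> provides a detour for the definition of \<open>m\<close>.\<close>

theorem no_wheel:
  assumes c: "\<And>y. y \<in> U \<Longrightarrow> conn (U - insert y (nb y U))"
    and W: "hole W" "set W \<subseteq> U" "y \<in> U" "y \<notin> set W"
  shows "card (nb y (set W)) \<le> 2"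
proof (rule ccontr)
  assume "\<not> ?thesis"
  then have n: "card (nb y (set W)) \<ge> 3" by simp
  let ?W = "\<lambda>W. hole W \<and> set W \<subseteq> U \<and> (\<exists>y. y \<in> U \<and> y \<notin> set W \<and> card (nb y (set W)) \<ge> 3)"
  have "?W W" using W n by blast
  from ex_has_least_nat[of ?W, OF this, of length]
  obtain W0 where W0: "?W W0" "\<And>K. ?W K \<Longrightarrow> length W0 \<le> length K" by blast
  then obtain z where z: "z \<in> U" "z \<notin> set W0" "card (nb z (set W0)) \<ge> 3" by blast
  have min: "card (nb v (set K)) \<le> 2" if "hole K" "set K \<subseteq> U" "length K < length W0" "v \<in> U - set K" for K v
  proof (rule ccontr)
    assume "\<not> ?thesis"
    then have "?W K" using that by force
    then show False using W0(2) that(3) by fastforce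
  qed
  have z4: "card (nb z (set W0)) \<ge> 4" using z(3) not_three_nb[of W0 z] W0(1) z(2) by fastforce
  have "card (nb q (set W0)) \<le> 2" if "q \<in> U" "q \<notin> set W0" "q \<noteq> z" "\<not> E q z" for q
    using shortest_wheel[OF min _ _ z(1,2) z4 that] W0(1) by simp
  then have mild: "mild_wheel U z W0" unfolding mild_wheel_def using W0(1) z by blast
  from ex_has_least_nat[of "mild_wheel U z", OF mild, of "\<lambda>W. card (nb z (set W))"]
  obtain W1 where W1: "mild_wheel U z W1" "\<And>W. mild_wheel U z W \<Longrightarrow> card (nb z (set W1)) \<le> card (nb z (set W))" by blast
  define k where "k = card (nb z (set W1))"
  let ?D = "\<lambda>n. \<exists>W u w P. mild_wheel U z W \<and> card (nb z (set W)) = k \<and> detour U z W u w P \<and> length P = n"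
  obtain u w P where "detour U z W1 u w P" by (rule detour_exists[OF W1(1) c[OF z(1)]])
  then have "?D (length P)" using W1(1) k_def by blast
  then have D: "?D (LEAST n. ?D n)" by (rule LeastI)
  interpret minimal_hub E U z k "LEAST n. ?D n"
  proof
    show "k \<le> card (nb z (set W))" if "mild_wheel U z W" for W using W1(2)[OF that] k_def by simp
    show "(LEAST n. ?D n) \<le> length P" if "mild_wheel U z W" "card (nb z (set W)) = k" "detour U z W u w P" for W u w P
      by (rule Least_le) (use that in blast)
  qed
  show False using D no_minimal_detour unfolding minimal_detour_def by blast
qed

section \<open>Attachments on a hole of a wheel-free graph\<close>

definition att :: "'a list \<Rightarrow> 'a set \<Rightarrow> 'a set" where
  "att H A = {h \<in> set H. \<exists>v \<in> A. E h v}"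

lemma finite_att [simp]: "finite (att H A)"
  by (simp add: att_def)

lemma att_Un: "att H (A \<union> B) = att H A \<union> att H B"
  by (auto simp: att_def)

lemma att_mono: "A \<subseteq> B \<Longrightarrow> att H A \<subseteq> att H B"
  by (auto simp: att_def)

lemma att_singleton: "att H {v} = nb v (set H)"
  using sym by (auto simp: att_def nb_def)

text \<open>On the hole made of the arc from \<open>a\<close> to \<open>c\<close> and
  \<open>P\<close>, the connected set \<open>Y'\<close> has the feet \<open>c\<close>,
  \<open>last P\<close> (through \<open>c'\<close>) and \<open>hd P\<close> (through
  \<open>a'\<close>). The nonempty rest \<open>Y''\<close> keeps \<open>Y'\<close> away from
  \<open>a\<close>.\<close>

lemma double_fork:
  assumes h: "hole (a # X @ c # Y)" and Y: "Y = Y' @ Y''" "Y'' \<noteq> []" "a' \<in> set Y'" "c' \<in> set Y'" "a' \<noteq> c'"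
    and P: "ipath P" "P \<noteq> []" "hd P \<noteq> last P" "set P \<inter> set (a # X @ c # Y) = {}"
    and cr: "\<And>h p. h \<in> set (a # X @ c # Y) \<Longrightarrow> p \<in> set P \<Longrightarrow>
      E h p \<longleftrightarrow> (p = hd P \<and> (h = a \<or> h = a')) \<or> (p = last P \<and> (h = c \<or> h = c'))"
  shows False
proof -
  have d: "distinct (a # X @ c # Y)" using h by (rule hole_distinct)
  have YN: "Y \<noteq> []" "Y' \<noteq> []" using Y by auto
  have K: "hole (a # X @ c # rev P)"
  proof (rule hole_reroute[OF h YN(1) P(1,2)])
    show "set P \<inter> set (a # X @ [c]) = {}" using P(4) by auto
    fix h p assume hp: "h \<in> set (a # X @ [c])" "p \<in> set P"
    then have "h \<noteq> a'" "h \<noteq> c'" using d Y by auto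
    then show "E h p \<longleftrightarrow> h = a \<and> p = hd P \<or> h = c \<and> p = last P" using cr[of h p] hp by auto
  qed
  have "ipath Y" using h by (rule hole_ipath_arc)
  then have A: "conn (set Y')" using Y(1) ipath_appendD(1) conn_ipath by blast
  have PP: "hd P \<in> set P" "last P \<in> set P" using P(2) by auto
  show False
  proof (rule three_feet[OF K A, of c "last P" "hd P" "hd Y'" c' a'])
    show "set Y' \<inter> set (a # X @ c # rev P) = {}" using d Y P(4) by auto
    show "c \<noteq> last P" "last P \<noteq> hd P" "c \<noteq> hd P" using P PP by auto
    fix h v assume hv: "h \<in> set (a # X @ c # rev P)" "v \<in> set Y'"
    have vY: "v \<in> set Y" using hv(2) Y(1) by simp
    consider "h \<in> set (a # X @ [c])" | "h \<in> set P" using hv(1) by auto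
    then show "E h v \<longleftrightarrow> h = c \<and> v = hd Y' \<or> h = last P \<and> v = c' \<or> h = hd P \<and> v = a'"
    proof cases
      case 1
      then have "h \<noteq> hd P" "h \<noteq> last P" using P(4) PP by auto
      moreover have "hd Y = hd Y'" using Y(1) YN by simp
      moreover have "last Y \<in> set Y''" using Y by simp
      then have "v \<noteq> last Y" using hv(2) d Y(1) by auto
      ultimately show ?thesis using hole_arc_cross[OF h 1 vY] by auto
    next
      case 2
      have "v \<noteq> a" "v \<noteq> c" "h \<noteq> c" using vY d 2 P(4) by auto
      then show ?thesis using cr[of v h] vY 2 E_commute[of h v] by auto
    qed
  qed (use PP YN Y in auto)
qed

text \<open>Only the cyclic order of the four feet matters. From \<open>a\<close>, in one of the two
  directions, a foot of the other fork is met before \<open>a'\<close>; the two remaining feet then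
  lie on the other arc, as \<open>part2\<close> requires.\<close>

lemma double_fork_general:
  assumes h: "hole H" and a: "a \<in> set H" "a' \<in> set H" "a \<noteq> a'" and c: "c \<in> set H" "c' \<in> set H" "c \<noteq> c'"
    and ac: "{a, a'} \<inter> {c, c'} = {}"
    and P: "ipath P" "P \<noteq> []" "hd P \<noteq> last P" "set P \<inter> set H = {}"
    and cr: "\<And>h p. h \<in> set H \<Longrightarrow> p \<in> set P \<Longrightarrow>
      E h p \<longleftrightarrow> (p = hd P \<and> (h = a \<or> h = a')) \<or> (p = last P \<and> (h = c \<or> h = c'))"
  shows False
proof -
  have PP: "hd P \<in> set P" "last P \<in> set P" using P(2) by auto
  have foot: "E a (hd P)" "E a' (hd P)" "E c (last P)" "E c' (last P)" using cr PP a c by auto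
  have na: "\<not> E a a'" "\<not> E c c'" using no_C3[of a a' "hd P"] no_C3[of c c' "last P"] foot sym by blast+
  have part1: False
    if "hole (p # X @ q # Y)" "set (p # X @ q # Y) = set H" "Y = Y' @ Y''" "Y'' \<noteq> []" "p' \<in> set Y'" "q' \<in> set Y'"
      "{p, p'} = {a, a'}" "{q, q'} = {c, c'}" for p X q Y Y' Y'' p' q'
  proof (rule double_fork[OF that(1,3-6) _ P(1-3)])
    show "p' \<noteq> q'" "set P \<inter> set (p # X @ q # Y) = {}" using that ac P(4) by blast+
    show "E h z \<longleftrightarrow> z = hd P \<and> (h = p \<or> h = p') \<or> z = last P \<and> (h = q \<or> h = q')"
      if hz: "h \<in> set (p # X @ q # Y)" "z \<in> set P" for h z
    proof -
      have "(h = p \<or> h = p') = (h = a \<or> h = a')" "(h = q \<or> h = q') = (h = c \<or> h = c')"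
        using \<open>{p, p'} = {a, a'}\<close> \<open>{q, q'} = {c, c'}\<close> by blast+
      moreover have "h \<in> set H" using hz(1) \<open>set (p # X @ q # Y) = set H\<close> by blast
      ultimately show ?thesis using cr[of h z] hz(2) by simp
    qed
  qed
  have part1r: False
    if "hole (q # X @ p # Y)" "set (q # X @ p # Y) = set H" "Y = Y' @ Y''" "Y'' \<noteq> []" "q' \<in> set Y'" "p' \<in> set Y'"
      "{p, p'} = {a, a'}" "{q, q'} = {c, c'}" for p X q Y Y' Y'' p' q'
  proof (rule double_fork[OF that(1,3-6) _ ipath_rev[OF P(1)]])
    show "q' \<noteq> p'" "set (rev P) \<inter> set (q # X @ p # Y) = {}" using that ac P(4) by auto
    show "rev P \<noteq> []" "hd (rev P) \<noteq> last (rev P)" using P(2,3) by (simp_all add: hd_rev last_rev)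
    show "E h z \<longleftrightarrow> z = hd (rev P) \<and> (h = q \<or> h = q') \<or> z = last (rev P) \<and> (h = p \<or> h = p')"
      if hz: "h \<in> set (q # X @ p # Y)" "z \<in> set (rev P)" for h z
    proof -
      have "(h = p \<or> h = p') = (h = a \<or> h = a')" "(h = q \<or> h = q') = (h = c \<or> h = c')"
        using \<open>{p, p'} = {a, a'}\<close> \<open>{q, q'} = {c, c'}\<close> by blast+
      moreover have "h \<in> set H" using hz(1) \<open>set (q # X @ p # Y) = set H\<close> by blast
      ultimately show ?thesis using cr[of h z] hz(2) P(2) by (auto simp: hd_rev last_rev)
    qed
  qed
  have part2: False
    if hpq: "hole (p # X @ q # Y)" "set (p # X @ q # Y) = set H" and p': "p' \<in> set Y" and q': "q' \<in> set Y"
      and eq: "{p, p'} = {a, a'}" "{q, q'} = {c, c'}" for p X q Y p' q'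
  proof -
    have d: "distinct (p # X @ q # Y)" using hpq(1) by (rule hole_distinct)
    have YN: "Y \<noteq> []" using p' by auto
    have npp: "\<not> E p p'" "\<not> E q q'" using na eq sym by (auto simp: doubleton_eq_iff)
    have ft: "E p (hd P)" "E p' (hd P)" using foot eq by (auto simp: doubleton_eq_iff)
    have pq': "p' \<noteq> q'" using eq ac by blast
    have El: "E p (last Y)" "E q (hd Y)"
      using hole_arc_cross[OF hpq(1), of p "last Y"] hole_arc_cross[OF hpq(1), of q "hd Y"] YN by auto
    have Yb: "Y = butlast Y @ [last Y]" using YN by simp
    have mem: "z \<in> set (butlast Y)" if "z \<in> set Y" "z \<noteq> last Y" for z
    proof -
      have "z \<in> set (butlast Y @ [last Y])" using that(1) Yb by simp
      then show ?thesis using that(2) by simp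
    qed
    \<comment> \<open>\<open>part1\<close> with \<open>Y' = butlast Y\<close> fails only if
      \<open>Y\<close> ends in \<open>q'\<close>. In the same way, the mirror image forces
      \<open>Y\<close> to start with \<open>p'\<close>.\<close>
    have lq: "last Y = q'"
    proof (rule ccontr)
      assume "last Y \<noteq> q'"
      moreover have "last Y \<noteq> p'" using El(1) npp(1) by auto
      ultimately show False using part1[OF hpq Yb _ _ _ eq] mem p' q' by auto
    qed
    have hp: "hd Y = p'"
    proof (rule ccontr)
      assume n1: "hd Y \<noteq> p'"
      have n2: "hd Y \<noteq> q'" using El(2) npp(2) by auto
      have Yt: "Y = hd Y # tl Y" using YN by simp
      have "hole (q # rev X @ p # rev Y)" using hole_swap[OF hole_mirror[OF hpq(1)]] .
      moreover have "set (q # rev X @ p # rev Y) = set H" using hpq(2) by auto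
      moreover have "rev Y = rev (tl Y) @ [hd Y]" using arg_cong[OF Yt, of rev] by simp
      moreover have "z \<in> set (rev (tl Y))" if "z \<in> set Y" "z \<noteq> hd Y" for z
        using that YN by (cases Y) auto
      ultimately show False using part1r[of q "rev X" p "rev Y" "rev (tl Y)" "[hd Y]" q' p'] eq n1 n2 p' q' by auto
    qed
    obtain D where D: "Y = p' # D @ [q']"
    proof -
      have "tl Y \<noteq> []" using hp lq pq' YN by (cases Y) auto
      then have "Y = p' # butlast (tl Y) @ [q']" using hp lq YN by (cases Y) auto
      then show thesis using that by blast
    qed
    \<comment> \<open>Now the cyclic order is \<open>p\<close>, \<open>q\<close>, \<open>p'\<close>,
      \<open>q'\<close> with \<open>q\<close> and \<open>p'\<close> consecutive. Start at
      \<open>p'\<close> instead: \<open>p\<close> and \<open>q'\<close> lie on the long arc, and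
      \<open>D\<close> is the rest that separates them from \<open>p'\<close>.\<close>
    have hD: "hole (p' # [] @ q # (rev X @ p # q' # rev D))"
    proof -
      have "hole (rev (p # X @ q # p' # D @ [q']))" using hole_rev[OF hpq(1)] D by simp
      then have "hole ((q' # rev D) @ (p' # q # rev X @ [p]))" by simp
      then have "hole ((p' # q # rev X @ [p]) @ (q' # rev D))" by (rule hole_rotate)
      then show ?thesis by simp
    qed
    have "D \<noteq> []"
    proof
      assume "D = []"
      then have "hole ((p # X @ [q]) @ [p', q'])" using hpq(1) D by simp
      then have "ipath [p', q']" by (rule hole_appendD) auto
      then have "E p' q'" by simp
      moreover have "E p q'" using El(1) lq by simp
      moreover have "p \<noteq> p'" using d p' by auto
      moreover have "q' \<noteq> hd P" using q' hpq(2) P(4) PP by auto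
      ultimately show False using no_C4[of p q' p' "hd P"] ft sym by blast
    qed
    then have rD: "rev D \<noteq> []" by simp
    have sD: "set (p' # [] @ q # (rev X @ p # q' # rev D)) = set H" using hpq(2) D by auto
    have eD: "{p', p} = {a, a'}" using eq(1) by blast
    show False
      by (rule part1[OF hD sD _ rD _ _ eD eq(2), where Y' = "rev X @ [p, q']"]) simp_all
  qed
  obtain L where L: "hole (a # L)" "set (a # L) = set H" by (rule hole_start[OF h a(1)])
  have inL: "a' \<in> set L" "c \<in> set L" "c' \<in> set L" using L(2) a c ac by auto
  then have "\<exists>z \<in> set L. z \<in> {a', c, c'}" by blast
  from split_list_first_prop[OF this] obtain L1 z L2
    where z: "L = L1 @ z # L2" "z \<in> {a', c, c'}" "\<forall>v \<in> set L1. v \<notin> {a', c, c'}" by blast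
  have swapc: "{c', c} = {c, c'}" by blast
  show False
  proof (cases "z = a'")
    case False
    have h1: "hole (a # L1 @ z # L2)" "set (a # L1 @ z # L2) = set H" using L z(1) by auto
    have "v \<in> set L2" if "v \<in> {a', c, c'}" "v \<noteq> z" for v using that inL z by auto
    then have m: "a' \<in> set L2" "z = c \<Longrightarrow> c' \<in> set L2" "z = c' \<Longrightarrow> c \<in> set L2" using False c(3) by auto
    from z(2) False consider "z = c" | "z = c'" by blast
    then show False
    proof cases
      case 1
      then show False using part2[OF h1 m(1) m(2)] by simp
    next
      case 2
      then show False using part2[OF h1 m(1) m(3)] swapc by simp
    qed
  next
    case True
    then have inL2: "c \<in> set L2" "c' \<in> set L2" using inL z a ac by auto
    have "\<exists>v \<in> set L2. v \<in> {c, c'}" using inL2 by blast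
    from split_list_last_prop[OF this] obtain M1 t M2
      where t: "L2 = M1 @ t # M2" "t \<in> {c, c'}" "\<forall>v \<in> set M2. v \<notin> {c, c'}" by blast
    have "hole (a # (L1 @ a' # M1) @ t # M2)" using L(1) z(1) True t(1) by simp
    then have h1: "hole (a # rev M2 @ t # rev (L1 @ a' # M1))" by (rule hole_mirror)
    have h2: "set (a # rev M2 @ t # rev (L1 @ a' # M1)) = set H" using L(2) z(1) True t(1) by auto
    have "v \<in> set M1" if "v \<in> {c, c'}" "v \<noteq> t" for v using that inL2 t by auto
    then have m: "a' \<in> set (rev (L1 @ a' # M1))" "t = c \<Longrightarrow> c' \<in> set (rev (L1 @ a' # M1))"
      "t = c' \<Longrightarrow> c \<in> set (rev (L1 @ a' # M1))" using c(3) by auto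
    from t(2) consider "t = c" | "t = c'" by blast
    then show False
    proof cases
      case 1
      then show False using part2[OF h1 h2 m(1) m(2)] by simp
    next
      case 2
      then show False using part2[OF h1 h2 m(1) m(3)] swapc by simp
    qed
  qed
qed

text \<open>Induced paths are treated separately: in a shortest one with three attachments, both
  ends have a private attachment, and either exactly one more exists or each end carries two and the
  inside none. Knowing that all induced paths have at most two, one can combine paths between
  neighbours of three attachments into a set with exactly three feet.\<close>

lemma attachments_le_two:
  assumes nw: "\<And>W v. hole W \<Longrightarrow> set W \<subseteq> U \<Longrightarrow> v \<in> U \<Longrightarrow> v \<notin> set W \<Longrightarrow> card (nb v (set W)) \<le> 2"
    and H: "hole H" "set H \<subseteq> U" and A: "A \<subseteq> U" "conn A" "A \<inter> set H = {}"
  shows "card (att H A) \<le> 2"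
proof (rule ccontr)
  assume "\<not> ?thesis"
  then have three: "card (att H A) \<ge> 3" by simp
  let ?P = "\<lambda>xs. ipath xs \<and> xs \<noteq> [] \<and> set xs \<subseteq> A \<and> card (att H (set xs)) \<ge> 3"
  have nopath: False if "?P ps" for ps
  proof -
    from ex_has_least_nat[of ?P, OF that, of length]
    obtain P where P: "?P P" and min: "\<And>ys. ?P ys \<Longrightarrow> length P \<le> length ys" by blast
    have one: "card (att H {v}) \<le> 2" if "v \<in> A" for v
      unfolding att_singleton using nw[OF H, of v] that A by blast
    obtain p1 P' where P1: "P = p1 # P'" using P by (cases P) auto
    have P'ne: "P' \<noteq> []"
    proof
      assume "P' = []"
      then have "card (att H {p1}) \<ge> 3" using P P1 by simp
      moreover have "p1 \<in> A" using P P1 by simp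
      ultimately show False using one[of p1] by simp
    qed
    define P'' pm where "P'' = butlast P" and "pm = last P"
    have P2: "P = P'' @ [pm]" "P'' \<noteq> []" unfolding P''_def pm_def using P P1 P'ne by auto
    have dP: "distinct P" using P ipath_distinct by blast
    have ht: "hd P = p1" "last P = pm" "p1 \<noteq> pm" "p1 \<in> set P''" "pm \<in> set P'"
    proof -
      show "hd P = p1" "last P = pm" using P1 pm_def by simp_all
      show "p1 \<in> set P''" using P1 P2 by (cases P'') auto
      then show "p1 \<noteq> pm" using dP P2 by auto
      show "pm \<in> set P'" using P1 P'ne pm_def by simp
    qed
    have c1: "card (att H (set P')) \<le> 2"
    proof (rule ccontr)
      assume "\<not> ?thesis"
      then have "?P P'" using P P1 P'ne ipath_appendD(2)[of "[p1]" P'] by simp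
      from min[OF this] show False using P1 by simp
    qed
    have c2: "card (att H (set P'')) \<le> 2"
    proof (rule ccontr)
      assume "\<not> ?thesis"
      then have "?P P''" using P P2 ipath_appendD(1)[of P'' "[pm]"] by simp
      from min[OF this] show False using P2 by simp
    qed
    have e1: "att H (set P) = att H {p1} \<union> att H (set P')" using P1 att_Un[of H "{p1}" "set P'"] by simp
    have e2: "att H (set P) = att H (set P'') \<union> att H {pm}" using P2 att_Un[of H "set P''" "{pm}"] by simp
    have PH: "set P \<inter> set H = {}" "set P \<subseteq> U" using P A by blast+
    have "\<not> att H (set P) \<subseteq> att H S" if "card (att H S) \<le> 2" for S
    proof
      assume "att H (set P) \<subseteq> att H S"
      then have "card (att H (set P)) \<le> card (att H S)" by (intro card_mono) auto
      then show False using P that by linarith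
    qed
    \<comment> \<open>Dropping either end of \<open>P\<close> loses an attachment, so each end has
      one that no other vertex of \<open>P\<close> provides.\<close>
    from this[OF c1] this[OF c2] obtain a c where ac: "a \<in> att H {p1}" "a \<notin> att H (set P')" "c \<in> att H {pm}" "c \<notin> att H (set P'')"
      using e1 e2 by blast
    have ac': "a \<in> set H" "c \<in> set H" "E a p1" "E c pm" using ac by (auto simp: att_def)
    have fa: "E a p \<longleftrightarrow> p = p1" if "p \<in> set P" for p
      using that ac(2) ac' P1 by (auto simp: att_def)
    have fc: "E c p \<longleftrightarrow> p = pm" if "p \<in> set P" for p
      using that ac(4) ac' P2 by (auto simp: att_def)
    have ne: "a \<noteq> c" using fa[of p1] fc[of p1] ac'(3) ht(3) P1 by auto
    show False
    proof (cases "card (att H (set P)) = 3")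
      case True
      have "{a, c} \<subseteq> att H (set P)" using ac e1 e2 by blast
      then have "card (att H (set P) - {a, c}) = 1" using True ne by (simp add: card_Diff_subset)
      then obtain b where b: "att H (set P) - {a, c} = {b}" by (auto simp: card_1_singleton_iff)
      then have bb: "b \<in> set H" "b \<noteq> a" "b \<noteq> c" "att H (set P) = {a, b, c}"
        using \<open>{a, c} \<subseteq> att H (set P)\<close> by (auto simp: att_def)
      have only: "h \<in> {a, b, c}" if "h \<in> set H" "p \<in> set P" "E h p" for h p
        using that bb(4) by (auto simp: att_def)
      obtain X Y Z where h3: "hole (a # X @ c # Y @ b # Z)" "set (a # X @ c # Y @ b # Z) = set H"
        by (rule hole_three[OF H(1) ac'(1,2) bb(1) ne]) (use bb in auto)
      have dH: "distinct (a # X @ c # Y @ b # Z)" using h3(1) by (rule hole_distinct)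
      have K: "hole (a # X @ c # rev P)"
      proof (rule hole_reroute[OF h3(1)])
        fix h p assume hp: "h \<in> set (a # X @ [c])" "p \<in> set P"
        have "h \<in> set H" "h \<noteq> b" using hp(1) h3(2) dH by auto
        then show "E h p \<longleftrightarrow> h = a \<and> p = hd P \<or> h = c \<and> p = last P"
          using only[of h p] hp(2) fa fc ht(1,2) ne by auto
      qed (use P PH h3(2) in auto)
      have bK: "b \<notin> set (a # X @ c # rev P)" using dH PH bb(1) by auto
      have cb: "card (nb b (set (a # X @ c # rev P))) \<le> 2"
        by (rule nw[OF K]) (use h3(2) H(2) PH(2) bb(1) bK in auto)
      have sK: "nb b (set (a # X @ c # rev P)) = nb b (set (a # X @ [c])) \<union> nb b (set P)" by (auto simp: nb_def)
      have tle: "card (nb b (set P)) \<le> 2"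
        using cb card_mono[of "nb b (set (a # X @ c # rev P))" "nb b (set P)"] unfolding sK by simp
      have "nb b (set P) \<noteq> {}" using bb(4) by (auto simp: att_def nb_def)
      then have "card (nb b (set P)) \<noteq> 0" by simp
      \<comment> \<open>\<open>b\<close> is off the hole \<open>K\<close> and is no hub of it. One
        neighbour on \<open>P\<close> gives three feet of \<open>P\<close> on \<open>H\<close>; two
        give three feet on \<open>K\<close> for the part of \<open>H\<close> after \<open>c\<close>
        up to \<open>b\<close>.\<close>
      then consider "card (nb b (set P)) = 1" | "card (nb b (set P)) = 2" using tle by linarith
      then show False
      proof cases
        case 1
        then obtain p where p: "nb b (set P) = {p}" by (auto simp: card_1_singleton_iff)
        then have "p \<in> set P" by (auto simp: nb_def)
        have cP: "conn (set P)" using P conn_ipath by blast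
        show False
        proof (rule three_feet[OF H(1) cP PH(1) ac'(1,2) bb(1) ne _ _ _ _ \<open>p \<in> set P\<close>, of p1 pm])
          show "E h v \<longleftrightarrow> h = a \<and> v = p1 \<or> h = c \<and> v = pm \<or> h = b \<and> v = p" if "h \<in> set H" "v \<in> set P" for h v
          proof -
            have "E b v \<longleftrightarrow> v = p" using p that(2) by (auto simp: nb_def)
            then show ?thesis using only[OF that] fa[OF that(2)] fc[OF that(2)] bb ne by auto
          qed
        qed (use P1 ht(5) bb in auto)
      next
        case 2
        then obtain p p' where p: "nb b (set P) = {p, p'}" "p \<noteq> p'" by (auto simp: card_2_iff)
        have pp: "p \<in> set P" "p' \<in> set P" using p(1) by (auto simp: nb_def)
        have "nb b (set (a # X @ [c])) = {}"
        proof -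
          have "nb b (set (a # X @ c # rev P)) = nb b (set P)"
            using card_seteq[of "nb b (set (a # X @ c # rev P))" "nb b (set P)"] cb 2 unfolding sK by simp
          then have "nb b (set (a # X @ [c])) \<subseteq> nb b (set P)" unfolding sK by blast
          moreover have "set (a # X @ [c]) \<inter> set P = {}" using PH(1) h3(2) by auto
          ultimately show ?thesis by (auto simp: nb_def)
        qed
        then have nba: "\<not> E b a" "\<not> E b c" by (auto simp: nb_def)
        have "Z \<noteq> []"
        proof
          assume "Z = []"
          then have "E a b" using hole_arc_cross[OF h3(1), of a b] by simp
          then show False using nba sym by blast
        qed
        have "ipath (Y @ b # Z)" using h3(1) by (rule hole_ipath_arc)
        then have "ipath (Y @ [b])" using ipath_appendD(1)[of "Y @ [b]" Z] by simp
        then have cY: "conn (set (Y @ [b]))" by (rule conn_ipath)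
        have hdY: "hd (Y @ [b]) = hd (Y @ b # Z)" by (cases Y) auto
        show False
        proof (rule three_feet[OF K cY, of c p p' "hd (Y @ [b])" b b])
          show "set (Y @ [b]) \<inter> set (a # X @ c # rev P) = {}" using dH PH(1) h3(2) by auto
          have "c \<notin> set P" using PH(1) ac'(2) by blast
          then show "c \<noteq> p" "p \<noteq> p'" "c \<noteq> p'" using p(2) pp by auto
          show "c \<in> set (a # X @ c # rev P)" "p \<in> set (a # X @ c # rev P)" "p' \<in> set (a # X @ c # rev P)"
            using pp by auto
          show "hd (Y @ [b]) \<in> set (Y @ [b])" "b \<in> set (Y @ [b])" "b \<in> set (Y @ [b])"
            using hd_in_set[of "Y @ [b]"] by auto
          fix h v assume hv: "h \<in> set (a # X @ c # rev P)" "v \<in> set (Y @ [b])"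
          have vH: "v \<in> set H" "v \<noteq> a" "v \<noteq> c" "v \<notin> set P" using hv(2) h3(2) dH PH(1) by auto
          consider "h \<in> set (a # X @ [c])" | "h \<in> set P" using hv(1) by auto
          then show "E h v \<longleftrightarrow> h = c \<and> v = hd (Y @ [b]) \<or> h = p \<and> v = b \<or> h = p' \<and> v = b"
          proof cases
            case 1
            then have "h \<notin> set P" using PH(1) h3(2) by auto
            then have "h \<noteq> p" "h \<noteq> p'" using pp by auto
            moreover have "last (Y @ b # Z) \<in> set Z" using \<open>Z \<noteq> []\<close> by simp
            then have "v \<noteq> last (Y @ b # Z)" using hv(2) dH by auto
            ultimately show ?thesis using hole_arc_cross[OF h3(1) 1, of v] hv(2) hdY by auto
          next
            case 2
            have "h \<noteq> c" using 2 PH(1) ac'(2) by blast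
            moreover have "E b h \<longleftrightarrow> h = p \<or> h = p'" using p(1) 2 by (auto simp: nb_def)
            ultimately show ?thesis using only[OF vH(1) 2] vH E_commute[of h v] by auto
          qed
        qed
      qed
    next
      case False
      then have four: "card (att H (set P)) \<ge> 4" using P by simp
      have m: "p1 \<in> A" "pm \<in> A" using P P1 ht(5) by auto
      \<comment> \<open>Each end has at most two attachments and the rest of the path at most two,
        while there are at least four in all; so every bound is attained and nothing is
        shared.\<close>
      have eq: "card (att H {p1}) = 2" "card (att H {pm}) = 2" "att H {p1} \<inter> att H (set P') = {}"
        "att H (set P'') \<inter> att H {pm} = {}" "card (att H (set P')) = 2" "card (att H (set P'')) = 2"
      proof -
        have i: "card (att H (set P)) + card (att H {p1} \<inter> att H (set P')) = card (att H {p1}) + card (att H (set P'))"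
          unfolding e1 using card_Un_Int[of "att H {p1}" "att H (set P')"] by simp
        have j: "card (att H (set P)) + card (att H (set P'') \<inter> att H {pm}) = card (att H (set P'')) + card (att H {pm})"
          unfolding e2 using card_Un_Int[of "att H (set P'')" "att H {pm}"] by simp
        show "card (att H {p1}) = 2" "card (att H (set P')) = 2" "card (att H {pm}) = 2" "card (att H (set P'')) = 2"
          using i j four one[OF m(1)] one[OF m(2)] c1 c2 by linarith+
        have "card (att H {p1} \<inter> att H (set P')) = 0" "card (att H (set P'') \<inter> att H {pm}) = 0"
          using i j four one[OF m(1)] one[OF m(2)] c1 c2 by linarith+
        then show "att H {p1} \<inter> att H (set P') = {}" "att H (set P'') \<inter> att H {pm} = {}" by simp_all
      qed
      obtain a1 a2 where a: "att H {p1} = {a1, a2}" "a1 \<noteq> a2" using eq(1) by (auto simp: card_2_iff)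
      obtain b1 b2 where b: "att H {pm} = {b1, b2}" "b1 \<noteq> b2" using eq(2) by (auto simp: card_2_iff)
      have P'': "att H (set P'') = {a1, a2}"
      proof -
        have "att H {p1} \<subseteq> att H (set P'')" using ht(4) by (intro att_mono) auto
        then show ?thesis using card_seteq[of "att H (set P'')" "att H {p1}"] eq a by simp
      qed
      have P'e: "att H (set P') = {b1, b2}"
      proof -
        have "att H {pm} \<subseteq> att H (set P')" using ht(5) by (intro att_mono) auto
        then show ?thesis using card_seteq[of "att H (set P')" "att H {pm}"] eq b by simp
      qed
      have dis: "{a1, a2} \<inter> {b1, b2} = {}" using eq(3) a P'e by simp
      have mem: "a1 \<in> set H" "a2 \<in> set H" "b1 \<in> set H" "b2 \<in> set H" using a(1) b(1) by (auto simp: att_def)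
      show False
      proof (rule double_fork_general[OF H(1) mem(1,2) a(2) mem(3,4) b(2) dis _ _ _ PH(1)])
        show "ipath P" "P \<noteq> []" "hd P \<noteq> last P" using P ht by auto
        fix h p assume hp: "h \<in> set H" "p \<in> set P"
        have 1: "E h p1 \<longleftrightarrow> h = a1 \<or> h = a2" using a(1) hp(1) by (auto simp: att_def)
        have 2: "E h pm \<longleftrightarrow> h = b1 \<or> h = b2" using b(1) hp(1) by (auto simp: att_def)
        have 3: "\<not> E h p" if "p \<noteq> p1" "p \<noteq> pm"
        proof
          assume "E h p"
          have "p \<in> set P'" using that hp(2) P1 by simp
          moreover have "p \<in> set (P'' @ [pm])" using hp(2) P2(1) by simp
          then have "p \<in> set P''" using that by simp
          ultimately have "p \<in> set P'" "p \<in> set P''" by blast+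
          then have "h \<in> att H (set P')" "h \<in> att H (set P'')" using hp(1) \<open>E h p\<close> by (auto simp: att_def)
          then show False using P'' P'e dis by blast
        qed
        show "E h p \<longleftrightarrow> p = hd P \<and> (h = a1 \<or> h = a2) \<or> p = last P \<and> (h = b1 \<or> h = b2)"
          unfolding ht(1,2) using 1 2 3 ht(3) by auto
      qed
    qed
  qed
  have le2: "card (att H (set xs)) \<le> 2" if "ipath xs" "xs \<noteq> []" "set xs \<subseteq> A" for xs
    using nopath[of xs] that by (cases "card (att H (set xs)) \<le> 2") auto
  obtain a b c where abc: "{a, b, c} \<subseteq> att H A" "a \<noteq> b" "b \<noteq> c" "a \<noteq> c"
  proof -
    obtain T where T: "T \<subseteq> att H A" "card T = 3" by (rule obtain_subset_with_card_n[OF three])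
    then obtain a b c where "T = {a, b, c}" "a \<noteq> b" "b \<noteq> c" "a \<noteq> c" by (auto simp: card_3_iff)
    with T(1) show thesis using that by blast
  qed
  have mH: "a \<in> set H" "b \<in> set H" "c \<in> set H" using abc(1) by (auto simp: att_def)
  obtain a0 b0 c0 where v0: "a0 \<in> A" "E a a0" "b0 \<in> A" "E b b0" "c0 \<in> A" "E c c0" using abc(1) by (auto simp: att_def)
  have v0': "a0 \<in> {v. E a v}" "b0 \<in> {v. E b v}" "c0 \<in> {v. E c v}" using v0 by auto
  obtain P where P: "ipath P" "P \<noteq> []" "set P \<subseteq> A" "hd P \<in> {v. E a v}" "last P \<in> {v. E b v}"
    "set (tl P) \<inter> {v. E a v} = {}" "set (butlast P) \<inter> {v. E b v} = {}"
    by (rule conn_path_between[OF A(2) v0(1) v0'(1) v0(3) v0'(2)])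
  have atP: "att H (set P) = {a, b}"
  proof -
    have "{a, b} \<subseteq> att H (set P)" using P(2,4,5) mH hd_in_set[of P] last_in_set[of P] by (auto simp: att_def)
    then show ?thesis using card_seteq[of "att H (set P)" "{a, b}"] le2[OF P(1-3)] abc(2) by simp
  qed
  then have cP: "\<not> E c p" if "p \<in> set P" for p using that mH(3) abc(3,4) by (auto simp: att_def)
  let ?Y = "{v. v \<in> set P \<or> (\<exists>p \<in> set P. E v p)}"
  have a0Y: "hd P \<in> A" "hd P \<in> ?Y" using P by auto
  obtain R where R: "ipath R" "R \<noteq> []" "set R \<subseteq> A" "hd R \<in> {v. E c v}" "last R \<in> ?Y"
    "set (tl R) \<inter> {v. E c v} = {}" "set (butlast R) \<inter> ?Y = {}"
    by (rule conn_path_between[OF A(2) v0(5) v0'(3) a0Y])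
  define R0 r where "R0 = butlast R" and "r = last R"
  have R': "R = R0 @ [r]" unfolding R0_def r_def using R(2) by simp
  have R0: "\<And>v p. v \<in> set R0 \<Longrightarrow> p \<in> set P \<Longrightarrow> v \<noteq> p \<and> \<not> E v p \<and> \<not> E p v"
    using R(7) sym unfolding R0_def by blast
  have rP: "r \<notin> set P"
  proof
    assume r: "r \<in> set P"
    show False
    proof (cases "R0 = []")
      case True
      then show False using R(4) R' cP[OF r] by simp
    next
      case False
      then have "E (last R0) r" using R(1) R' ipath_append[of R0 "[r]"] by simp
      then show False using R0[of "last R0" r] r False by simp
    qed
  qed
  then obtain p0 where p0: "p0 \<in> set P" "E r p0" using R(5) unfolding r_def by blast
  have revR: "ipath (rev R)" "rev R \<noteq> []" "hd (rev R) = r" "set (rev R) = set R"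
    using ipath_rev[OF R(1)] R' by auto
  \<comment> \<open>Following \<open>S\<close> to the earliest neighbour of \<open>r\<close> and
    then \<open>R\<close> backwards is an induced path that attaches to \<open>e\<close> and
    \<open>c\<close>, so it attaches to nothing else. Applied to \<open>P\<close> and to
    \<open>rev P\<close>, this leaves only \<open>c\<close> for \<open>R\<close>.\<close>
  have bound: "att H (set R) \<subseteq> {e, c}"
    if S: "ipath S" "S \<noteq> []" "set S = set P" "E e (hd S)" "e \<in> set H" "e \<noteq> c" for S e
  proof -
    have "\<exists>p \<in> set S. E r p" using p0 S(3) by blast
    from split_list_first_prop[OF this] obtain S1 p S2
      where e: "S = S1 @ p # S2" "E r p" "\<forall>y \<in> set S1. \<not> E r y" by blast
    have i1: "ipath (S1 @ [p])" using S(1) e(1) ipath_appendD(1)[of "S1 @ [p]" S2] by simp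
    have sub: "set (S1 @ [p]) \<subseteq> set P" using e(1) S(3) by auto
    have "ipath ((S1 @ [p]) @ rev R)"
    proof (subst ipath_append)
      have "E x z \<longleftrightarrow> x = p \<and> z = r" if "x \<in> set (S1 @ [p])" "z \<in> set (rev R)" for x z
      proof (cases "z = r")
        case True
        then show ?thesis using that(1) e(2,3) E_commute[of x r] by auto
      next
        case False
        then have "z \<in> set R0" using that(2) R' by auto
        then show ?thesis using R0[of z x] that(1) sub False by blast
      qed
      moreover have "set (S1 @ [p]) \<inter> set (rev R) = {}"
        using R0 rP sub unfolding R' by auto
      ultimately show "ipath (S1 @ [p]) \<and> ipath (rev R) \<and> set (S1 @ [p]) \<inter> set (rev R) = {} \<and>
        (\<forall>x\<in>set (S1 @ [p]). \<forall>y\<in>set (rev R). E x y = (x = last (S1 @ [p]) \<and> y = hd (rev R)))"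
        using i1 revR by simp
    qed (use revR in auto)
    moreover have "set ((S1 @ [p]) @ rev R) \<subseteq> A" using sub P(3) R(3) by auto
    ultimately have le: "card (att H (set ((S1 @ [p]) @ rev R))) \<le> 2" by (intro le2) auto
    have "hd S \<in> set ((S1 @ [p]) @ rev R)" using e(1) by (cases S1) auto
    moreover have "hd R \<in> set ((S1 @ [p]) @ rev R)" using R(2) by simp
    ultimately have ec: "{e, c} \<subseteq> att H (set ((S1 @ [p]) @ rev R))"
      using S(4,5) R(4) mH(3) by (auto simp: att_def)
    have "att H (set ((S1 @ [p]) @ rev R)) = {e, c}"
      using card_seteq[OF _ ec] le S(6) by simp
    moreover have "att H (set R) \<subseteq> att H (set ((S1 @ [p]) @ rev R))" by (rule att_mono) auto
    ultimately show ?thesis by blast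
  qed
  have "att H (set R) \<subseteq> {a, c}" using bound[OF P(1,2) refl, of a] P(4) mH abc by auto
  moreover have "att H (set R) \<subseteq> {b, c}"
    using bound[OF ipath_rev[OF P(1)], of b] P(2,5) mH abc by (auto simp: hd_rev)
  ultimately have atR: "att H (set R) \<subseteq> {c}" using abc by blast
  have cPR: "conn (set R \<union> set P)"
    by (rule conn_Un[OF conn_ipath[OF R(1)] conn_ipath[OF P(1)] _ p0]) (use R' in simp)
  show False
  proof (rule three_feet[OF H(1) cPR _ mH abc(2,3,4), of "hd P" "last P" "hd R"])
    show "(set R \<union> set P) \<inter> set H = {}" using A(3) P(3) R(3) by blast
    show "hd P \<in> set R \<union> set P" "last P \<in> set R \<union> set P" "hd R \<in> set R \<union> set P" using P(2) R(2) by auto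
    fix h v assume hv: "h \<in> set H" "v \<in> set R \<union> set P"
    have PR: "set P \<inter> set R = {}" using R0 rP R' by auto
    show "E h v \<longleftrightarrow> h = a \<and> v = hd P \<or> h = b \<and> v = last P \<or> h = c \<and> v = hd R"
    proof (cases "v \<in> set P")
      case True
      have "v \<noteq> hd R" using True PR R(2) by auto
      moreover have "h = a \<or> h = b" if "E h v" using that atP True hv(1) by (auto simp: att_def)
      moreover have "E a v \<longleftrightarrow> v = hd P" using P(2,4,6) True by (cases P) auto
      moreover have "E b v \<longleftrightarrow> v = last P"
      proof -
        have "P = butlast P @ [last P]" using P(2) by simp
        then have "v \<in> set (butlast P) \<or> v = last P" using True by (metis Un_iff empty_iff empty_set set_ConsD set_append)
        then show ?thesis using P(5,7) by blast
      qed
      ultimately show ?thesis using abc(2) by auto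
    next
      case False
      then have vR: "v \<in> set R" using hv(2) by blast
      have "v \<noteq> hd P" "v \<noteq> last P" using False P(2) by auto
      moreover have "h = c" if "E h v" using that atR vR hv(1) by (auto simp: att_def)
      moreover have "E c v \<longleftrightarrow> v = hd R" using R(2,4,6) vR by (cases R) auto
      ultimately show ?thesis by auto
    qed
  qed
qed

text \<open>The end \<open>e\<close> of a longest induced path from \<open>s\<close> has a neighbour
  \<open>v\<close> besides its predecessor. By maximality \<open>v\<close> is adjacent to an earlier
  vertex, and the latest such vertex closes a hole. The exception \<open>s\<close> is never the
  end.\<close>

lemma hole_of_degree:
  assumes "finite S" "s \<in> S" "\<And>v. v \<in> S \<Longrightarrow> v \<noteq> s \<Longrightarrow> card (nb v S) \<ge> 2" "nb s S \<noteq> {}"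
  obtains H where "hole H" "set H \<subseteq> S"
proof -
  let ?P = "\<lambda>xs. ipath xs \<and> length xs \<ge> 2 \<and> hd xs = s \<and> set xs \<subseteq> S"
  obtain t where t: "t \<in> S" "E s t" using assms(4) by (auto simp: nb_def)
  have "?P [s, t]" using t assms(2) irrefl by auto
  moreover have "\<forall>xs. ?P xs \<longrightarrow> length xs < Suc (card S)"
    using assms(1) distinct_card[OF ipath_distinct] card_mono[of S] by (metis le_imp_less_Suc)
  ultimately have "\<exists>xs. ?P xs \<and> (\<forall>ys. ?P ys \<longrightarrow> length ys \<le> length xs)"
    by (rule ex_has_greatest_nat)
  then obtain xs where xs: "?P xs" and max: "\<And>ys. ?P ys \<Longrightarrow> length ys \<le> length xs" by blast
  define ys e where "ys = butlast xs" and "e = last xs"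
  have e: "xs = ys @ [e]" unfolding ys_def e_def using xs by (cases "xs = []") auto
  have ys: "ys \<noteq> []" using xs e by (cases ys) auto
  have dx: "distinct xs" using xs ipath_distinct by blast
  have "s = hd ys" using xs e ys by simp
  then have es: "e \<noteq> s" using dx e ys by (cases ys) auto
  have eS: "e \<in> S" using xs e by auto
  have cr: "E x e \<longleftrightarrow> x = last ys" if "x \<in> set ys" for x
    using ipath_cross[of ys "[e]" x e] xs e that by simp
  have "\<not> nb e S \<subseteq> {last ys}"
  proof
    assume "nb e S \<subseteq> {last ys}"
    then have "card (nb e S) \<le> card {last ys}" by (intro card_mono) auto
    then show False using assms(3)[OF eS es] by simp
  qed
  then obtain v where v: "v \<in> S" "E e v" "v \<noteq> last ys" by (auto simp: nb_def)
  have vx: "v \<notin> set xs" using v cr[of v] e irrefl sym by auto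
  have "\<exists>x \<in> set ys. E x v"
  proof (rule ccontr)
    assume no: "\<not> ?thesis"
    have "ipath (xs @ [v])"
      using ipath_append[of xs "[v]"] xs vx no v(2) e by auto
    then have "?P (xs @ [v])" using xs v(1) by (cases xs) auto
    from max[OF this] show False by simp
  qed
  from split_list_last_prop[OF this] obtain Y1 x Y2
    where x: "ys = Y1 @ x # Y2" "E x v" "\<forall>z \<in> set Y2. \<not> E z v" by blast
  have "ipath (x # Y2 @ [e])" using xs e x(1) ipath_appendD(2)[of Y1 "x # Y2 @ [e]"] by simp
  moreover have "v \<notin> set (x # Y2 @ [e])" using vx e x(1) by auto
  moreover have "E v z \<longleftrightarrow> z = x \<or> z = e" if "z \<in> set (x # Y2 @ [e])" for z
    using that x(2,3) v(2) sym by auto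
  ultimately have "hole (v # x # Y2 @ [e])" unfolding hole_def by auto
  moreover have "set (v # x # Y2 @ [e]) \<subseteq> S" using xs e x(1) v(1) by auto
  ultimately show thesis using that by blast
qed

end

section \<open>Minimal pockets of double stars\<close>

definition (in g5_graph) pocket :: "'a set \<Rightarrow> 'a \<Rightarrow> 'a \<Rightarrow> 'a set \<Rightarrow> bool" where
  "pocket V x b C \<longleftrightarrow> x \<in> V \<and> b \<in> V \<and> E x b \<and> C \<subseteq> V \<and> C \<noteq> {} \<and>
     (\<forall>c \<in> C. c \<noteq> x \<and> c \<noteq> b \<and> \<not> E c x \<and> \<not> E c b) \<and>
     (\<forall>c \<in> C. \<forall>v \<in> V. E c v \<longrightarrow> v \<in> C \<or> E v x \<or> E v b)"

text \<open>Minimality ranges over the pockets of all edges inside \<open>V\<close>; the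
  connectivity proofs below produce pockets of other edges.\<close>

locale min_pocket = g5_graph +
  fixes V :: "'a set" and x b :: 'a and C :: "'a set"
  assumes finV: "finite V" and deg: "v \<in> V \<Longrightarrow> card (nb v V) \<ge> 3"
    and pocket: "pocket V x b C"
    and minC: "pocket V x' b' D \<Longrightarrow> card C \<le> card D"
begin

text \<open>This is the set U of the overview.\<close>

definition region :: "'a set" where
  "region = C \<union> {x, b} \<union> {v \<in> V. (E v x \<or> E v b) \<and> (\<exists>c \<in> C. E v c)}"

lemma pk: "x \<in> V" "b \<in> V" "E x b" "C \<subseteq> V" "C \<noteq> {}"
  "c \<in> C \<Longrightarrow> c \<noteq> x \<and> c \<noteq> b \<and> \<not> E c x \<and> \<not> E c b"
  "c \<in> C \<Longrightarrow> v \<in> V \<Longrightarrow> E c v \<Longrightarrow> v \<in> C \<or> E v x \<or> E v b"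
  using pocket unfolding pocket_def by blast+

lemma finC: "finite C"
  using finV pk(4) finite_subset by blast

lemma swapped: "min_pocket E V b x C"
proof
  show "pocket V b x C" using pocket sym unfolding pocket_def by blast
qed (use finV deg minC in auto)

lemma region_swapped: "min_pocket.region E V b x C = region"
  unfolding region_def min_pocket.region_def[OF swapped] by blast

lemma no_smaller:
  assumes "pocket V x' b' D" "D \<subseteq> C" "c \<in> C" "c \<notin> D"
  shows False
proof -
  have "card D < card C" using assms(2-4) finC by (intro psubset_card_mono) auto
  then show False using minC[OF assms(1)] by simp
qed

lemma region_sub: "region \<subseteq> V"
  using pk(1,2,4) unfolding region_def by blast

lemma nb_in_region: "c \<in> C \<Longrightarrow> v \<in> V \<Longrightarrow> E c v \<Longrightarrow> v \<in> region"
  using pk(7)[of c v] sym[of c v] unfolding region_def by blast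

lemma region_cases:
  assumes "v \<in> region"
  obtains "v \<in> C" | "v = x" | "v = b"
    | c where "E v x" "v \<noteq> b" "\<not> E v b" "c \<in> C" "E v c" "v \<notin> C" "v \<noteq> x"
    | c where "E v b" "v \<noteq> x" "\<not> E v x" "c \<in> C" "E v c" "v \<notin> C" "v \<noteq> b"
proof -
  have "\<not> (E v x \<and> E v b)" using no_C3[of v x b] pk(3) sym by blast
  then show thesis using assms that pk(6)[of v] irrefl unfolding region_def by blast
qed

text \<open>A component of \<open>C\<close> is again a pocket of the same edge.\<close>

lemma conn_C: "conn C"
proof -
  obtain c where c: "c \<in> C" using pk(5) by blast
  let ?D = "comp_of C c"
  have D: "?D \<subseteq> C" using c by (rule comp_of_subset)
  have "pocket V x b ?D"
    unfolding pocket_def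
  proof (intro conjI ballI impI)
    show "?D \<noteq> {}" using comp_of_self by blast
    fix d v assume "d \<in> ?D" "v \<in> V" "E d v"
    then show "v \<in> ?D \<or> E v x \<or> E v b" using pk(7)[of d v] comp_of_closed[of d C c v] D by blast
  qed (use pk D in blast)+
  then have "?D = C" using no_smaller[of x b ?D] D by blast
  then show ?thesis using comp_of_conn[OF c] by simp
qed

lemma has_nb: "v \<in> V \<Longrightarrow> \<exists>z \<in> V. E v z"
proof -
  assume "v \<in> V"
  then have "nb v V \<noteq> {}" using deg[of v] by auto
  then show ?thesis by (auto simp: nb_def)
qed

text \<open>A part \<open>?D\<close> cut off from \<open>x\<close> lies in \<open>C\<close>, and its
  neighbours outside are neighbours of \<open>y\<close>. For a neighbour \<open>z\<close> of
  \<open>y\<close>, the vertices of \<open>?D\<close> not adjacent to \<open>z\<close> form a pocket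
  of the edge from \<open>y\<close> to \<open>z\<close> that misses \<open>y\<close>, so it is
  smaller than \<open>C\<close>.\<close>

lemma conn_avoiding_inner:
  assumes y: "y \<in> C"
  shows "conn (region - insert y (nb y region))"
proof -
  let ?S = "region - insert y (nb y region)"
  have xS: "x \<in> ?S" and bS: "b \<in> ?S" using pk(6)[OF y] unfolding region_def nb_def by auto
  have bR: "b \<in> comp_of ?S x" by (rule comp_of_closed[OF comp_of_self pk(3) bS])
  let ?D = "?S - comp_of ?S x"
  have closed: "v \<in> ?D" if "d \<in> ?D" "v \<in> ?S" "E d v" for d v
    using that comp_of_closed[of v ?S x d] sym by blast
  have DC: "?D \<subseteq> C"
  proof
    fix v assume v: "v \<in> ?D"
    then have "v \<in> region" by blast
    then show "v \<in> C"
    proof (cases rule: region_cases)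
      case (4 c)
      then have "v \<in> comp_of ?S x" using comp_of_closed[OF comp_of_self, of x v ?S] v sym by blast
      then show ?thesis using v by blast
    next
      case (5 c)
      then have "v \<in> comp_of ?S x" using comp_of_closed[OF bR, of v] v sym by blast
      then show ?thesis using v by blast
    qed (use v comp_of_self bR in auto)
  qed
  have Dy: "d \<noteq> y \<and> \<not> E d y" if "d \<in> ?D" for d
  proof -
    have "d \<in> region" "d \<notin> nb y region" "d \<noteq> y" using that by blast+
    then show ?thesis using sym[of d y] unfolding nb_def by blast
  qed
  have out: "v \<in> ?D \<or> E v y" if d: "d \<in> ?D" and v: "v \<in> V" "E d v" for d v
  proof -
    have "v \<in> region" using nb_in_region[of d v] DC d v by blast
    moreover have "v \<noteq> y" using Dy[OF d] v by blast
    ultimately show ?thesis using closed[OF d _ v(2)] sym unfolding nb_def by blast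
  qed
  obtain z where z: "z \<in> V" "E y z" using has_nb[of y] pk(4) y by blast
  have "?D = {}"
  proof (rule ccontr)
    assume "?D \<noteq> {}"
    then obtain d0 where d0: "d0 \<in> ?D" by blast
    let ?D' = "{d \<in> ?D. \<not> E d z}"
    \<comment> \<open>If all of \<open>?D\<close> were adjacent to \<open>z\<close>, no two vertices
      of \<open>?D\<close> would be adjacent. Then the three or more neighbours of \<open>d0\<close>
      would all be adjacent to \<open>y\<close>, but two vertices share at most one
      neighbour.\<close>
    have "?D' \<noteq> {}"
    proof
      assume "?D' = {}"
      then have allz: "E d z" if "d \<in> ?D" for d using that by blast
      have "E v y" if v: "v \<in> V" "E d0 v" for v
        using out[OF d0 v] allz[OF d0] allz[of v] no_C3[of d0 v z] v sym by blast
      then have sub: "nb d0 V \<subseteq> nb d0 V \<inter> nb y V" using sym by (auto simp: nb_def)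
      have "card (nb d0 V) \<le> card (nb d0 V \<inter> nb y V)"
        using sub finV by (intro card_mono) auto
      also have "\<dots> \<le> 1" using common_nb_card[of d0 y V] Dy[OF d0] by blast
      finally show False using deg[of d0] DC d0 pk(4) by force
    qed
    moreover have "z \<notin> ?D" using z nb_in_region[OF y z] unfolding nb_def by blast
    ultimately have "pocket V y z ?D'"
      unfolding pocket_def using z y pk(4) DC Dy out by blast
    then show False by (rule no_smaller[of y z ?D' y]) (use DC y in auto)
  qed
  then show ?thesis by (intro conn_from[OF xS]) blast
qed

text \<open>\<open>C\<close> is connected and untouched, \<open>b\<close> goes with the neighbours
  of \<open>x\<close>, and every other remaining vertex has a neighbour in \<open>C\<close>.\<close>

lemma conn_avoiding_centre: "conn (region - insert x (nb x region))"
proof -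
  let ?S = "region - insert x (nb x region)"
  have CS: "C \<subseteq> ?S" using pk(6) sym unfolding region_def nb_def by blast
  obtain c0 where c0: "c0 \<in> C" using pk(5) by blast
  have CR: "C \<subseteq> comp_of ?S c0"
    using conn_comp_of[OF conn_C c0] comp_of_mono[OF CS] by blast
  show ?thesis
  proof (rule conn_from[of c0])
    show "c0 \<in> ?S" using c0 CS by blast
    fix v assume v: "v \<in> ?S"
    then have "v \<in> region" by blast
    then show "v \<in> comp_of ?S c0"
    proof (cases rule: region_cases)
      case 1
      then show ?thesis using CR by blast
    next
      case 2
      then show ?thesis using v by blast
    next
      case 3
      then show ?thesis using v pk(3) unfolding nb_def by blast
    next
      case (4 c)
      then show ?thesis using comp_of_closed[of c ?S c0 v] CR v sym by blast
    next
      case (5 c)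
      then show ?thesis using comp_of_closed[of c ?S c0 v] CR v sym by blast
    qed
  qed
qed

text \<open>Here \<open>x\<close> is removed along with \<open>n\<close>, so the part
  \<open>?D\<close> cut off from \<open>b\<close> may contain neighbours of \<open>x\<close>.
  Without them it would be a pocket of the edge from \<open>x\<close> to \<open>n\<close> missing
  \<open>c1\<close>, so nothing else is in it. A neighbour \<open>d\<close> of \<open>x\<close> in
  \<open>?D\<close> has a neighbour \<open>c\<close> in \<open>C\<close>, which must be adjacent to
  \<open>n\<close>; this closes the 4-cycle \<open>n\<close>, \<open>c\<close>, \<open>d\<close>,
  \<open>x\<close>.\<close>

lemma conn_avoiding_arm:
  assumes n: "n \<in> region" "E n x" "n \<noteq> b"
  shows "conn (region - insert n (nb n region))"
proof -
  have nC: "n \<notin> C" using n(2) pk(6) by blast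
  have nx: "n \<noteq> x" using n(2) irrefl by blast
  have nb: "\<not> E n b" using no_C3[of n x b] n(2) pk(3) sym by blast
  obtain c1 where c1: "c1 \<in> C" "E n c1"
    using n(1) by (cases rule: region_cases) (use nC nx n nb in auto)
  have nV: "n \<in> V" using n(1) region_sub by blast
  let ?S = "region - insert n (nb n region)"
  have bS: "b \<in> ?S" using nb n(3) unfolding region_def nb_def by auto
  have xS: "x \<notin> ?S" using n(2) unfolding region_def nb_def by auto
  let ?D = "?S - comp_of ?S b"
  have closed: "v \<in> ?D" if "d \<in> ?D" "v \<in> ?S" "E d v" for d v
    using that comp_of_closed[of v ?S b d] sym by blast
  have Dn: "d \<noteq> n \<and> \<not> E d n" if "d \<in> ?D" for d
  proof -
    have "d \<in> region" "d \<notin> nb n region" "d \<noteq> n" using that by blast+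
    then show ?thesis using sym[of d n] unfolding nb_def by blast
  qed
  let ?D' = "{d \<in> ?D. \<not> E d x}"
  have DC: "?D' \<subseteq> C"
  proof
    fix v assume v: "v \<in> ?D'"
    then have "v \<in> region" by blast
    then show "v \<in> C"
    proof (cases rule: region_cases)
      case (5 c)
      then have "v \<in> comp_of ?S b" using comp_of_closed[OF comp_of_self, of b v ?S] v sym by blast
      then show ?thesis using v by blast
    qed (use v comp_of_self xS in auto)
  qed
  have D': "?D' = {}"
  proof (rule ccontr)
    assume ne: "?D' \<noteq> {}"
    have "v \<in> ?D' \<or> E v x \<or> E v n" if d: "d \<in> ?D'" and v: "v \<in> V" "E d v" for d v
    proof -
      have "v \<in> region" using nb_in_region[of d v] DC d v by blast
      moreover have "v \<noteq> n" using Dn[of d] d v by blast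
      moreover have "d \<in> ?D" using d by blast
      ultimately show ?thesis using closed[of d v] v(2) sym unfolding nb_def by blast
    qed
    moreover have "d \<noteq> x \<and> d \<noteq> n \<and> \<not> E d x \<and> \<not> E d n" if "d \<in> ?D'" for d
      using that Dn[of d] DC pk(6) by blast
    moreover have "E x n" using n(2) sym by blast
    ultimately have "pocket V x n ?D'"
      unfolding pocket_def using ne pk(1,4) nV DC by blast
    moreover have "c1 \<notin> ?D'" using c1(2) Dn[of c1] sym by blast
    ultimately show False using no_smaller[of x n ?D' c1] DC c1(1) by blast
  qed
  have "?D = {}"
  proof (rule ccontr)
    assume "?D \<noteq> {}"
    then obtain d where d: "d \<in> ?D" by blast
    then have dx: "E d x" using D' by blast
    have "d \<noteq> b" using d comp_of_self by blast
    have "d \<in> region" using d by blast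
    then obtain c where c: "c \<in> C" "E d c"
      by (cases rule: region_cases) (use dx pk(6) irrefl \<open>d \<noteq> b\<close> in auto)
    have cr: "c \<in> region" using c(1) unfolding region_def by blast
    have "E n c"
    proof (rule ccontr)
      assume "\<not> E n c"
      then have "c \<in> ?S" using cr c(1) nC unfolding nb_def by blast
      then have "c \<in> ?D'" using closed[OF d _ c(2)] pk(6)[OF c(1)] by blast
      then show False using D' by blast
    qed
    moreover have "n \<noteq> d" using d by blast
    moreover have "c \<noteq> x" using pk(6)[OF c(1)] by blast
    ultimately show False using no_C4[of n c d x] c(2) dx n(2) sym by blast
  qed
  then show ?thesis by (intro conn_from[OF bS]) blast
qed

lemma conn_avoiding:
  assumes "y \<in> region"
  shows "conn (region - insert y (nb y region))"
  using assms
proof (cases rule: region_cases)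
  case 1
  then show ?thesis by (rule conn_avoiding_inner)
next
  case 2
  then show ?thesis using conn_avoiding_centre by simp
next
  case 3
  then show ?thesis using min_pocket.conn_avoiding_centre[OF swapped] region_swapped by simp
next
  case (4 c)
  then show ?thesis using conn_avoiding_arm assms by blast
next
  case (5 c)
  then show ?thesis using min_pocket.conn_avoiding_arm[OF swapped, of y] region_swapped assms by simp
qed

lemma region_attachments:
  assumes "hole H" "set H \<subseteq> region" "A \<subseteq> region" "conn A" "A \<inter> set H = {}"
  shows "card (att H A) \<le> 2"
  by (rule attachments_le_two[OF no_wheel[OF conn_avoiding] assms])

text \<open>\<open>c\<close> has at least three neighbours, but at most one in \<open>C\<close> and
  at most one in common with each of \<open>x\<close> and \<open>b\<close>; so each kind
  occurs.\<close>

lemma leaf_feet: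
  assumes c: "c \<in> C" "card (nb c C) \<le> 1"
  obtains n m c0 where "n \<in> region" "E c n" "E n x" "m \<in> region" "E c m" "E m b" "c0 \<in> C" "E c c0"
proof -
  have cV: "c \<in> V" using c pk(4) by blast
  let ?X = "nb c V \<inter> nb x V" and ?B = "nb c V \<inter> nb b V"
  have "nb c V \<subseteq> (nb c C \<union> ?X) \<union> ?B"
    using pk(7)[OF c(1)] sym by (auto simp: nb_def)
  then have "card (nb c V) \<le> card ((nb c C \<union> ?X) \<union> ?B)"
    using finV finC by (intro card_mono) auto
  also have "\<dots> \<le> card (nb c C) + card ?X + card ?B"
    using card_Un_le[of "nb c C \<union> ?X" ?B] card_Un_le[of "nb c C" ?X] by linarith
  finally have "card (nb c C) + card ?X + card ?B \<ge> 3" using deg[OF cV] by linarith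
  moreover have "card ?X \<le> 1" "card ?B \<le> 1" using common_nb_card[of c x V] common_nb_card[of c b V] pk(6)[OF c(1)] by auto
  ultimately have "card (nb c C) \<noteq> 0" "card ?X \<noteq> 0" "card ?B \<noteq> 0" using c(2) by linarith+
  then have "nb c C \<noteq> {}" "?X \<noteq> {}" "?B \<noteq> {}" by (metis card.empty)+
  then obtain c0 n m where "c0 \<in> nb c C" "n \<in> ?X" "m \<in> ?B" by blast
  then show thesis using that[of n m c0] nb_in_region[OF c(1)] sym by (auto simp: nb_def)
qed

text \<open>The 5-cycle is \<open>c\<close>, \<open>n\<close>, \<open>x\<close>, \<open>b\<close>,
  \<open>m\<close>. A path in \<open>C\<close> from \<open>c\<close> to \<open>d\<close>, without
  \<open>c\<close> but with \<open>n'\<close> and \<open>m'\<close> where these are new, attaches to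
  \<open>c\<close>, to one of \<open>n\<close> and \<open>x\<close>, and to one of \<open>m\<close>
  and \<open>b\<close>.\<close>

lemma two_leaves:
  assumes c: "c \<in> C" "card (nb c C) \<le> 1" and d: "d \<in> C" "card (nb d C) \<le> 1" "c \<noteq> d"
  shows False
proof -
  obtain n m where nm: "n \<in> region" "E c n" "E n x" "m \<in> region" "E c m" "E m b"
    by (rule leaf_feet[OF c])
  obtain n' m' where nm': "n' \<in> region" "E d n'" "E n' x" "m' \<in> region" "E d m'" "E m' b"
    by (rule leaf_feet[OF d(1,2)])
  have not_both: "\<not> (E v x \<and> E v b)" for v using no_C3[of v x b] pk(3) sym by blast
  have arm: "v \<noteq> x \<and> v \<noteq> b \<and> v \<notin> C" if "E v x \<or> E v b" "E v e" "e \<in> C" for v e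
    using that pk(6)[of v] pk(6)[of e] sym irrefl by blast
  have pc: "c \<noteq> x" "c \<noteq> b" "\<not> E c x" "\<not> E c b" using pk(6)[OF c(1)] by auto
  have an: "n \<noteq> x" "n \<noteq> b" "n \<notin> C" "m \<noteq> x" "m \<noteq> b" "m \<notin> C"
    "n' \<noteq> x" "n' \<noteq> b" "n' \<notin> C" "m' \<noteq> x" "m' \<noteq> b" "m' \<notin> C"
    using arm[of n c] arm[of m c] arm[of n' d] arm[of m' d] nm nm' c d sym by auto
  have nnm: "n \<noteq> m" "n' \<noteq> m" "m' \<noteq> n" "n' \<noteq> m'" using nm nm' not_both by auto
  have ne: "\<not> E n b" "\<not> E m x" using nm not_both by auto
  have nmE: "\<not> E n m" using no_C4[of n x b m] nm pk(3) an sym by blast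
  let ?H = "[c, n, x, b, m]"
  have ip: "ipath [n, x, b, m]"
    using nm pk(3) ne nmE an nnm irrefl sym by auto
  have "E c v \<longleftrightarrow> v = n \<or> v = m" if "v \<in> set [n, x, b, m]" for v
    using that nm pc by auto
  moreover have "c \<notin> set [n, x, b, m]" using an pc c(1) by auto
  ultimately have H: "hole ?H" using ip unfolding hole_def by simp
  have HU: "set ?H \<subseteq> region" using nm c(1) unfolding region_def by auto
  obtain xs where xs: "ipath xs" "xs \<noteq> []" "hd xs = c" "last xs = d" "set xs \<subseteq> C"
    by (rule conn_path[OF conn_C c(1) d(1)])
  obtain ys where ys: "xs = c # ys" using xs(2,3) by (cases xs) auto
  have yne: "ys \<noteq> []" using ys xs(4) d(3) by auto
  have dys: "d \<in> set ys" using ys xs(4) yne by auto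
  have ipy: "ipath ys" "c \<notin> set ys" "E c (hd ys)" using xs(1) ys yne by (auto simp: ipath_Cons)
  let ?A = "set ys \<union> ({n', m'} - {n, m})"
  have A1: "conn (set ys)" using ipy(1) by (rule conn_ipath)
  have nd: "E n' d" "E m' d" using nm' sym by blast+
  have A: "conn ?A"
  proof -
    have "conn (insert n' (set ys))" "conn (insert m' (set ys))" "conn (insert m' (insert n' (set ys)))"
      using conn_insert[OF A1 dys nd(1)] conn_insert[OF A1 dys nd(2)]
        conn_insert[OF conn_insert[OF A1 dys nd(1)] _ nd(2)] dys by auto
    moreover have "?A = set ys \<or> ?A = insert n' (set ys) \<or> ?A = insert m' (set ys) \<or> ?A = insert m' (insert n' (set ys))"
      by auto
    ultimately show ?thesis using A1 by metis
  qed
  have yC: "set ys \<subseteq> C" using xs(5) ys by auto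
  have AH: "?A \<inter> set ?H = {}"
    using yC ipy(2) an pk(6) nm' c(1) by auto
  have AU: "?A \<subseteq> region" using yC nm' unfolding region_def by auto
  \<comment> \<open>If \<open>n'\<close> is \<open>n\<close>, then \<open>d\<close> attaches to
    \<open>n\<close>; otherwise \<open>n'\<close> belongs to \<open>?A\<close> and attaches to
    \<open>x\<close>. The same holds for \<open>m\<close> and \<open>b\<close>.\<close>
  define s t where "s = (if n' = n then n else x)" and "t = (if m' = m then m else b)"
  have "c \<in> att ?H ?A" using ipy(3) yne by (auto simp: att_def)
  moreover have "s \<in> att ?H ?A"
  proof (cases "n' = n")
    case True
    then show ?thesis using nd dys unfolding s_def att_def by auto
  next
    case False
    then show ?thesis using nm'(3) nnm sym unfolding s_def att_def by auto
  qed
  moreover have "t \<in> att ?H ?A"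
  proof (cases "m' = m")
    case True
    then show ?thesis using nd dys unfolding t_def att_def by auto
  next
    case False
    then show ?thesis using nm'(6) nnm sym unfolding t_def att_def by auto
  qed
  ultimately have sub: "{c, s, t} \<subseteq> att ?H ?A" by blast
  have "c \<noteq> s" "c \<noteq> t" "s \<noteq> t"
    using an pc nnm c(1) pk(3) irrefl unfolding s_def t_def by auto
  then have "card {c, s, t} = 3" by simp
  then have "3 \<le> card (att ?H ?A)" using card_mono[OF _ sub] by simp
  moreover have "card (att ?H ?A) \<le> 2" by (rule region_attachments[OF H HU AU A AH])
  ultimately show False by simp
qed

text \<open>By \<open>two_leaves\<close> at most one vertex of \<open>C\<close> has fewer than two
  neighbours in \<open>C\<close>, and that one can serve as the exception in
  \<open>hole_of_degree\<close>.\<close>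

lemma hole_in_C:
  obtains H where "hole H" "set H \<subseteq> C"
proof -
  obtain s where s: "s \<in> C" "\<And>v. v \<in> C \<Longrightarrow> v \<noteq> s \<Longrightarrow> card (nb v C) \<ge> 2"
  proof (cases "\<exists>s \<in> C. card (nb s C) \<le> 1")
    case True
    then obtain s where s: "s \<in> C" "card (nb s C) \<le> 1" by blast
    have "card (nb v C) \<ge> 2" if "v \<in> C" "v \<noteq> s" for v
    proof (rule ccontr)
      assume "\<not> ?thesis"
      then have "card (nb v C) \<le> 1" by simp
      then show False using two_leaves[OF s that(1)] that(2) by blast
    qed
    then show thesis using that s(1) by blast
  next
    case False
    obtain s where s: "s \<in> C" using pk(5) by blast
    have "card (nb v C) \<ge> 2" if "v \<in> C" for v
    proof -
      have "\<not> card (nb v C) \<le> 1" using False that by blast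
      then show ?thesis by simp
    qed
    then show thesis using that s by blast
  qed
  have "nb s C \<noteq> {}"
  proof (cases "card (nb s C) \<le> 1")
    case True
    obtain c0 where "c0 \<in> C" "E s c0" by (rule leaf_feet[OF s(1) True])
    then show ?thesis by (auto simp: nb_def)
  qed auto
  then show thesis using hole_of_degree[OF finC s(1) s(2)] that by blast
qed

text \<open>The component \<open>?X\<close> of \<open>x\<close> contains all of
  \<open>region\<close> outside \<open>C\<close> and attaches to at most two vertices of
  \<open>H\<close>. So some \<open>h\<close> in \<open>H\<close> has a neighbour in another
  component \<open>?Z\<close>, which lies in \<open>C\<close>. A hole inside \<open>?Z\<close>
  leaves \<open>?X\<close> intact and releases a vertex of \<open>H\<close> attached to
  \<open>?X\<close>.\<close>

lemma bigger_component:
  assumes H: "hole H" "set H \<subseteq> C"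
  shows "\<exists>H'. hole H' \<and> set H' \<subseteq> C \<and> card (comp_of (region - set H) x) < card (comp_of (region - set H') x)"
proof -
  let ?R = "region - set H"
  let ?X = "comp_of ?R x"
  have HU: "set H \<subseteq> region" using H(2) unfolding region_def by auto
  have xR: "x \<in> ?R" and bR: "b \<in> ?R" using H(2) pk(6) unfolding region_def by auto
  have XR: "?X \<subseteq> ?R" by (rule comp_of_subset[OF xR])
  have bX: "b \<in> ?X" by (rule comp_of_closed[OF comp_of_self pk(3) bR])
  have outC: "v \<in> ?X" if v: "v \<in> region" "v \<notin> C" for v
  proof -
    have vR: "v \<in> ?R" using v H(2) by blast
    show ?thesis using v(1)
    proof (cases rule: region_cases)
      case (4 c)
      then show ?thesis using comp_of_closed[OF comp_of_self, of x v ?R] vR sym by blast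
    next
      case (5 c)
      then show ?thesis using comp_of_closed[OF bX, of v] vR sym by blast
    qed (use v bX comp_of_self in auto)
  qed
  have finR: "finite region" using region_sub finV finite_subset by blast
  have aX: "card (att H ?X) \<le> 2"
    by (rule region_attachments[OF H(1) HU _ comp_of_conn[OF xR]]) (use XR in auto)
  have lenH: "card (set H) = length H" "length H \<ge> 3" using distinct_card[OF hole_distinct[OF H(1)]] H(1) by (auto simp: hole_def)
  have "\<not> set H \<subseteq> att H ?X"
  proof
    assume "set H \<subseteq> att H ?X"
    then have "card (set H) \<le> card (att H ?X)" by (intro card_mono) auto
    then show False using aX lenH by simp
  qed
  then obtain h where h: "h \<in> set H" "h \<notin> att H ?X" by blast
  have hC: "h \<in> C" using h(1) H(2) by blast
  obtain L where L: "hole (h # L)" "set (h # L) = set H" by (rule hole_start[OF H(1) h(1)])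
  have hL: "nb h (set H) \<subseteq> {hd L, last L}"
  proof
    fix v assume "v \<in> nb h (set H)"
    then have v: "v \<in> set (h # L)" "E h v" using L(2) by (auto simp: nb_def)
    moreover have "v \<noteq> h" using v(2) irrefl by blast
    ultimately have "v \<in> set L" "E h v" by auto
    then show "v \<in> {hd L, last L}" using L(1) by (auto simp: hole_def)
  qed
  then have "card (nb h (set H)) \<le> card {hd L, last L}" by (intro card_mono) auto
  also have "\<dots> \<le> 2" by (simp add: card_insert_if)
  finally have "\<not> nb h V \<subseteq> nb h (set H)"
    using card_mono[of "nb h (set H)" "nb h V"] deg[of h] hC pk(4) by force
  then obtain z where z: "z \<in> V" "E h z" "z \<notin> set H" by (auto simp: nb_def)
  have zU: "z \<in> region" using nb_in_region[OF hC z(1,2)] .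
  then have zR: "z \<in> ?R" using z(3) by blast
  have zX: "z \<notin> ?X" using h z(2) by (auto simp: att_def)
  let ?Z = "comp_of ?R z"
  have ZR: "?Z \<subseteq> ?R" by (rule comp_of_subset[OF zR])
  have ZX: "?Z \<inter> ?X = {}"
  proof (rule ccontr)
    assume "?Z \<inter> ?X \<noteq> {}"
    then obtain v where v: "v \<in> ?Z" "v \<in> ?X" by blast
    have "v \<in> comp_of ?Z z" using conn_comp_of[OF comp_of_conn[OF zR] comp_of_self] v(1) by blast
    have "z \<in> comp_of ?Z v" using conn_comp_of[OF comp_of_conn[OF zR] v(1)] comp_of_self by blast
    then have "z \<in> comp_of ?R v" using comp_of_mono[OF ZR] by blast
    then have "z \<in> ?X" using v(2) unfolding comp_of_def by (auto intro: rtranclp_trans)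
    then show False using zX by blast
  qed
  have ZC: "?Z \<subseteq> C" using outC ZR ZX by blast
  have aZ: "card (att H ?Z) \<le> 2"
    by (rule region_attachments[OF H(1) HU _ comp_of_conn[OF zR]]) (use ZR in auto)
  have finZ: "finite ?Z" using ZC finC finite_subset by blast
  have cardZ: "card (nb v ?Z) + card (nb v (set H)) \<ge> 3" if v: "v \<in> ?Z" for v
  proof -
    have vC: "v \<in> C" using v ZC by blast
    have "nb v V \<subseteq> nb v ?Z \<union> nb v (set H)"
    proof
      fix w assume "w \<in> nb v V"
      then have w: "w \<in> V" "E v w" by (auto simp: nb_def)
      have "w \<in> region" using nb_in_region[OF vC w] .
      then show "w \<in> nb v ?Z \<union> nb v (set H)"
        using comp_of_closed[OF v w(2)] w(2) by (auto simp: nb_def)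
    qed
    then have "card (nb v V) \<le> card (nb v ?Z \<union> nb v (set H))" using finZ by (intro card_mono) auto
    also have "\<dots> \<le> card (nb v ?Z) + card (nb v (set H))" by (rule card_Un_le)
    finally show ?thesis using deg[of v] vC pk(4) by force
  qed
  have nbatt: "nb v (set H) \<subseteq> att H ?Z" if "v \<in> ?Z" for v
    using that sym by (auto simp: nb_def att_def)
  have nble: "card (nb v (set H)) \<le> 2" if "v \<in> ?Z" for v
    using card_mono[OF finite_att nbatt[OF that]] aZ by linarith
  \<comment> \<open>\<open>?Z\<close> attaches to at most two vertices of \<open>H\<close>, and two
    vertices of \<open>?Z\<close> adjacent to both would form a 4-cycle. So at most one vertex of
    \<open>?Z\<close> has fewer than two neighbours in \<open>?Z\<close>.\<close>
  have uniq: "v = w" if "v \<in> ?Z" "w \<in> ?Z" "card (nb v (set H)) = 2" "card (nb w (set H)) = 2" for v w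
  proof (rule ccontr)
    assume "v \<noteq> w"
    have "nb v (set H) = att H ?Z" "nb w (set H) = att H ?Z"
      using card_seteq[OF finite_att nbatt[OF that(1)]] card_seteq[OF finite_att nbatt[OF that(2)]] that(3,4) aZ by auto
    then have "card (nb v (set H) \<inter> nb w (set H)) = 2" using that(3) by simp
    then show False using common_nb_card[OF \<open>v \<noteq> w\<close>, of "set H"] by simp
  qed
  obtain s where s: "s \<in> ?Z" "\<And>v. v \<in> ?Z \<Longrightarrow> v \<noteq> s \<Longrightarrow> card (nb v ?Z) \<ge> 2"
  proof (cases "\<exists>s \<in> ?Z. card (nb s (set H)) = 2")
    case True
    then obtain s where s: "s \<in> ?Z" "card (nb s (set H)) = 2" by blast
    have "card (nb v ?Z) \<ge> 2" if "v \<in> ?Z" "v \<noteq> s" for v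
    proof -
      have "card (nb v (set H)) \<noteq> 2" using uniq[OF that(1) s(1)] that(2) s(2) by blast
      then show ?thesis using nble[OF that(1)] cardZ[OF that(1)] by linarith
    qed
    then show thesis using that s(1) by blast
  next
    case False
    have "card (nb v ?Z) \<ge> 2" if "v \<in> ?Z" for v
    proof -
      have "card (nb v (set H)) \<noteq> 2" using False that by blast
      then show ?thesis using nble[OF that] cardZ[OF that] by linarith
    qed
    then show thesis using that[of z] comp_of_self by blast
  qed
  have "card (nb s ?Z) \<noteq> 0" using cardZ[OF s(1)] nble[OF s(1)] by linarith
  then have "nb s ?Z \<noteq> {}" by (metis card.empty)
  then obtain H' where H': "hole H'" "set H' \<subseteq> ?Z" using hole_of_degree[OF finZ s] by blast
  let ?R' = "region - set H'"
  let ?X' = "comp_of ?R' x"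
  have xR': "x \<in> ?R'" using xR H'(2) ZC pk(6) by blast
  have XX': "?X \<subseteq> ?X'"
  proof -
    have "?X \<subseteq> ?R'" using XR H'(2) ZX by blast
    then show ?thesis using conn_comp_of[OF comp_of_conn[OF xR] comp_of_self] comp_of_mono by blast
  qed
  \<comment> \<open>Some \<open>g\<close> in \<open>H\<close> is not adjacent to \<open>h\<close>.
    Removing the closed neighbourhood of \<open>h\<close> leaves \<open>x\<close> and
    \<open>g\<close> connected, and a path between them enters \<open>H\<close> from a vertex of
    \<open>?X\<close>.\<close>
  have "\<exists>h1 \<in> set H. \<exists>p \<in> ?X. E p h1"
  proof -
    have "\<not> set H \<subseteq> insert h (nb h (set H))"
    proof
      assume *: "set H \<subseteq> insert h (nb h (set H))"
      have "set L \<subseteq> {hd L, last L}" using * hL L(2) hole_distinct[OF L(1)] by auto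
      have L2: "length L \<ge> 2" "ipath L" and hLE: "\<And>v. v \<in> set L \<Longrightarrow> E h v \<longleftrightarrow> v = hd L \<or> v = last L"
        using L(1) by (auto simp: hole_def)
      have "L \<noteq> []" using L2(1) by auto
      then have "E h (hd L)" "E h (last L)" using hLE[of "hd L"] hLE[of "last L"] by auto
      obtain l1 l2 L' where L': "L = l1 # l2 # L'" using L2(1) by (cases L; cases "tl L") auto
      have "l2 \<in> {hd L, last L}" using \<open>set L \<subseteq> {hd L, last L}\<close> L' by auto
      moreover have "l2 \<noteq> hd L" using L' hole_distinct[OF L(1)] by auto
      ultimately have "l2 = last L" by blast
      then have "E h l1" "E h l2" "E l1 l2" using \<open>E h (hd L)\<close> \<open>E h (last L)\<close> \<open>ipath L\<close> L' by auto
      then show False using no_C3[of h l1 l2] sym by blast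
    qed
    then obtain g where g: "g \<in> set H" "g \<noteq> h" "\<not> E h g" by (auto simp: nb_def)
    let ?S = "region - insert h (nb h region)"
    have c: "conn ?S" by (rule conn_avoiding) (use h(1) HU in blast)
    have xS: "x \<in> ?S" using pk(6)[OF hC] unfolding region_def nb_def by auto
    have gS: "g \<in> ?S" using g HU unfolding nb_def by blast
    obtain ps where ps: "ipath ps" "ps \<noteq> []" "set ps \<subseteq> ?S" "hd ps \<in> {x}" "last ps \<in> set H"
      "set (butlast ps) \<inter> set H = {}"
      by (rule conn_path_between[OF c xS singletonI gS g(1)]) blast
    define qs l where "qs = butlast ps" and "l = last ps"
    have e: "ps = qs @ [l]" unfolding qs_def l_def using ps(2) by simp
    have qne: "qs \<noteq> []"
    proof
      assume "qs = []"
      then have "l = x" using ps(4) e by simp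
      then show False using ps(5) xR unfolding l_def by blast
    qed
    have ipq: "ipath qs" using ps(1) e ipath_appendD(1) by blast
    have "E (last qs) l" using ps(1) e qne ipath_append[of qs "[l]"] by simp
    moreover have "last qs \<in> ?X"
    proof -
      have "set qs \<subseteq> ?R" using ps(3,6) e unfolding qs_def[symmetric] by auto
      moreover have "x \<in> set qs" using ps(4) e qne by (cases qs) auto
      ultimately show ?thesis
        using conn_comp_of[OF conn_ipath[OF ipq], of x] comp_of_mono[of "set qs" ?R x] last_in_set[OF qne] by blast
    qed
    ultimately show ?thesis using ps(5) unfolding l_def[symmetric] by blast
  qed
  then obtain h1 p where h1: "h1 \<in> set H" "p \<in> ?X" "E p h1" by blast
  have "h1 \<in> ?R'" using h1(1) HU H'(2) ZR by blast
  then have "h1 \<in> ?X'" using comp_of_closed[of p ?R' x h1] XX' h1 by blast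
  moreover have "h1 \<notin> ?X" using XR h1(1) by blast
  ultimately have "?X \<subset> ?X'" using XX' by blast
  moreover have "finite ?X'" using comp_of_subset[OF xR'] finR finite_subset by blast
  ultimately have "card ?X < card ?X'" by (rule psubset_card_mono[rotated])
  then show ?thesis using H' ZC by blast
qed

lemma impossible: False
proof -
  let ?P = "\<lambda>H. hole H \<and> set H \<subseteq> C"
  let ?f = "\<lambda>H. card (comp_of (region - set H) x)"
  obtain H0 where "?P H0" using hole_in_C by blast
  moreover have "\<forall>H. ?P H \<longrightarrow> ?f H < Suc (card region)"
  proof (intro allI impI)
    fix H assume "?P H"
    then have "x \<in> region - set H" using pk(6) unfolding region_def by auto
    then have "comp_of (region - set H) x \<subseteq> region" using comp_of_subset by blast
    moreover have "finite region" using region_sub finV finite_subset by blast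
    ultimately show "?f H < Suc (card region)" using card_mono by (metis le_imp_less_Suc)
  qed
  ultimately have "\<exists>H. ?P H \<and> (\<forall>K. ?P K \<longrightarrow> ?f K \<le> ?f H)" by (rule ex_has_greatest_nat)
  then obtain H where H: "?P H" "\<And>K. ?P K \<Longrightarrow> ?f K \<le> ?f H" by blast
  then obtain K where "?P K" "?f H < ?f K" using bigger_component by blast
  then show False using H(2)[of K] by simp
qed

end

section \<open>Low degree vertices and colouring\<close>

context g5_graph
begin

text \<open>A pocket exists: from \<open>x\<close> go to a neighbour \<open>c\<close> other than
  \<open>b\<close> and on to \<open>e\<close>; by girth 5, \<open>e\<close> is outside the double
  star of \<open>x\<close> and \<open>b\<close>. A smallest pocket over all edges then satisfies
  \<open>min_pocket\<close>.\<close>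

theorem low_degree_vertex:
  assumes "finite V" "V \<noteq> {}"
  shows "\<exists>v \<in> V. card (nb v V) \<le> 2"
proof (rule ccontr)
  assume "\<not> ?thesis"
  then have deg: "card (nb v V) \<ge> 3" if "v \<in> V" for v using that by force
  have two: "\<exists>w. w \<in> nb v V \<and> w \<noteq> u" if "v \<in> V" for u v
  proof (rule ccontr)
    assume "\<not> ?thesis"
    then have "nb v V \<subseteq> {u}" by blast
    then have "card (nb v V) \<le> card {u}" by (intro card_mono) auto
    then show False using deg[OF that] by simp
  qed
  obtain x where x: "x \<in> V" using assms(2) by blast
  obtain b where b: "b \<in> V" "E x b" using two[OF x] by (auto simp: nb_def)
  obtain c where c: "c \<in> V" "E x c" "c \<noteq> b" using two[OF x, of b] by (auto simp: nb_def)
  obtain e where e: "e \<in> V" "E c e" "e \<noteq> x" using two[OF c(1), of x] by (auto simp: nb_def)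
  have ex: "\<not> E e x" using no_C3[of x c e] c(2) e(2) by blast
  have eb: "e \<noteq> b" using ex b(2) sym by blast
  have eb2: "\<not> E e b" using no_C4[of x c e b] c(2,3) e(2,3) b(2) sym by blast
  let ?C = "{v \<in> V. v \<noteq> x \<and> v \<noteq> b \<and> \<not> E v x \<and> \<not> E v b}"
  have "pocket V x b ?C"
    unfolding pocket_def using x b e ex eb eb2 sym by blast
  then have "\<exists>x b. pocket V x b ?C" by blast
  from ex_has_least_nat[of "\<lambda>D. \<exists>x b. pocket V x b D", OF this, of card]
  obtain D where D: "\<exists>x b. pocket V x b D" "\<And>D'. \<exists>x b. pocket V x b D' \<Longrightarrow> card D \<le> card D'" by blast
  then obtain x' b' where xb: "pocket V x' b' D" by blast
  interpret min_pocket E V x' b' D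
    by unfold_locales (use assms(1) deg xb D(2) in blast)+
  show False by (rule impossible)
qed

text \<open>The induction shrinks \<open>V\<close> and keeps \<open>E\<close>, as
  \<open>low_degree_vertex\<close> holds for every nonempty finite set.\<close>

theorem three_colouring:
  assumes "finite V"
  shows "\<exists>col :: 'a \<Rightarrow> nat. (\<forall>v \<in> V. col v < 3) \<and> (\<forall>u \<in> V. \<forall>v \<in> V. E u v \<longrightarrow> col u \<noteq> col v)"
  using assms
proof (induction "card V" arbitrary: V)
  case 0
  then show ?case by auto
next
  case (Suc n)
  then have "V \<noteq> {}" by auto
  then obtain v where v: "v \<in> V" "card (nb v V) \<le> 2" using low_degree_vertex Suc.prems by blast
  have "n = card (V - {v})" "finite (V - {v})" using Suc v by auto
  from Suc.hyps(1)[OF this] obtain col :: "'a \<Rightarrow> nat"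
    where col: "\<forall>u \<in> V - {v}. col u < 3" "\<forall>u \<in> V - {v}. \<forall>w \<in> V - {v}. E u w \<longrightarrow> col u \<noteq> col w" by blast
  have "card (col ` nb v V) \<le> 2" using card_image_le[of "nb v V" col] v(2) Suc.prems by simp
  then have "\<not> {..<3} \<subseteq> col ` nb v V"
    using card_mono[of "col ` nb v V" "{..<3::nat}"] Suc.prems by fastforce
  then obtain i where i: "i < 3" "i \<notin> col ` nb v V" by auto
  have fresh: "col u \<noteq> i" if "u \<in> V" "E v u" for u using i(2) that by (auto simp: nb_def)
  have "\<forall>u \<in> V. (col(v := i)) u < 3" using col(1) i(1) by simp
  moreover have "\<forall>u \<in> V. \<forall>w \<in> V. E u w \<longrightarrow> (col(v := i)) u \<noteq> (col(v := i)) w"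
    using col(2) fresh irrefl sym by (auto simp: fun_upd_def)
  ultimately show ?case by blast
qed

end

theorem theorem5p5:
  fixes G :: "'a pair_pre_digraph"
  assumes "pair_graph G"
    and "ISK4_free G"
    and "girth G \<ge> 5"
  shows "(pverts G \<noteq> {} \<longrightarrow> (\<exists>v \<in> pverts G. out_degree (with_proj G) v \<le> 2)) \<and> colorable 3 G"
proof -
  interpret G: pair_graph G by fact
  let ?E = "\<lambda>u v. (u, v) \<in> parcs G"
  interpret g5_graph ?E
  proof
    show "\<not> has_ISK4 ?E" using assms(1,2) by (rule ISK4_free_imp_not_has_ISK4)
  qed (use G.arcs_symmetric G.no_loops' girth_no_short_cycle[OF assms(1,3)] in blast)+
  \<comment> \<open>Each edge is present in both orientations, so the arcs leaving \<open>v\<close>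
    count its neighbours.\<close>
  have "out_degree (with_proj G) v = card (nb v (pverts G))" for v
  proof -
    have "out_arcs (with_proj G) v = Pair v ` nb v (pverts G)"
      by (auto simp: out_arcs_def nb_def dest: G.in_arcsD2)
    then show ?thesis
      by (simp add: out_degree_def card_image inj_on_def)
  qed
  then have "pverts G \<noteq> {} \<longrightarrow> (\<exists>v \<in> pverts G. out_degree (with_proj G) v \<le> 2)"
    using low_degree_vertex[OF G.pair_finite_verts] by simp
  moreover have "colorable 3 G"
  proof -
    obtain col :: "'a \<Rightarrow> nat" where col: "\<forall>v \<in> pverts G. col v < 3"
      "\<forall>u \<in> pverts G. \<forall>v \<in> pverts G. (u, v) \<in> parcs G \<longrightarrow> col u \<noteq> col v"
      using three_colouring[OF G.pair_finite_verts] by blast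
    have "col u \<noteq> col v" if "(u, v) \<in> parcs G" for u v
      using col(2) that G.in_arcsD1[OF that] G.in_arcsD2[OF that] by blast
    then show ?thesis unfolding colorable_def using col(1) by blast
  qed
  ultimately show ?thesis by blast
qed

end
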